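(* For every $n\ge 3$, the double circle on $2n$ points is universal.
   Context: All point sets are in the plane and in general position (no three collinear). An edge of a point set is a segment with two distinct endpoints in it; a triangulation is a maximal set of pairwise non-crossing edges. For point sets $P,Q$ and a bijection $f:P\to Q$, a compatible triangulation of $(P,Q)$ with respect to $f$ is a pair $(T_P,T_Q)$ of triangulations of $P$ and $Q$ such that $(p,p')\in T_P$ iff $(f(p),f(p'))\in T_Q$. A bijection $f_0$ from the vertices of the convex hull of $P$ to the vertices of the convex hull of $Q$ is cyclic if for all hull vertices $p_1,p_2$ of $P$, $p_1p_2$ is a hull edge of $P$ iff $f_0(p_1)f_0(p_2)$ is a hull edge of $Q$. A point set $P$ is universal if for every point set $Q$ with $|Q|=|P|$ and every cyclic bijection $f_0$ from the hull vertices of $P$ to the hull vertices of $Q$, there is a bijection $f:P\to Q$ extending $f_0$ and a compatible triangulation of $(P,Q)$ with respect to $f$. Double circle: let $P_1\dots P_n$ be a regular $n$-gon with center $O$; for each $i$ let $A_i$ be the point on the segment from $O$ to the midpoint of $P_iP_{i+1}$ (indices mod $n$) at distance $\varepsilon$ from the segment $P_iP_{i+1}$, where $\varepsilon>0$ is small enough that the order type of the configuration is the same for all $0<\varepsilon'<\varepsilon$. The double circle is $\{P_1,\dots,P_n,A_1,\dots,A_n\}$. *)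

theory Defs
  imports "HOL-Analysis.Analysis"
begin

text \<open>The plane is the type \<^typ>\<open>complex\<close>.\<close>

definition point_set :: "complex set \<Rightarrow> bool" where
  "point_set P \<longleftrightarrow> finite P \<and>
     (\<forall>a\<in>P. \<forall>b\<in>P. \<forall>c\<in>P. distinct [a, b, c] \<longrightarrow> \<not> collinear {a, b, c})"

definition point_edges :: "complex set \<Rightarrow> complex set set" where
  "point_edges P = {closed_segment p q |p q. p \<in> P \<and> q \<in> P \<and> p \<noteq> q}"

text \<open>The relative interior of a nondegenerate closed segment is the open segment, so edges that
  only share an endpoint do not cross. The relation is meant for distinct segments
  (\<^const>\<open>pairwise\<close> only compares distinct elements).\<close>

definition crosses :: "complex set \<Rightarrow> complex set \<Rightarrow> bool" where
  "crosses s t \<longleftrightarrow> rel_interior s \<inter> rel_interior t \<noteq> {}"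

definition noncrossing_edges :: "complex set \<Rightarrow> complex set set \<Rightarrow> bool" where
  "noncrossing_edges P T \<longleftrightarrow> T \<subseteq> point_edges P \<and> pairwise (\<lambda>s t. \<not> crosses s t) T"

definition triangulation_of :: "complex set \<Rightarrow> complex set set \<Rightarrow> bool" where
  "triangulation_of P T \<longleftrightarrow> noncrossing_edges P T \<and>
     (\<forall>T'. noncrossing_edges P T' \<and> T \<subseteq> T' \<longrightarrow> T' = T)"

definition compatible_triangulation ::
  "complex set \<Rightarrow> complex set \<Rightarrow> (complex \<Rightarrow> complex) \<Rightarrow>
   complex set set \<Rightarrow> complex set set \<Rightarrow> bool" where
  "compatible_triangulation P Q f TP TQ \<longleftrightarrow>
     triangulation_of P TP \<and> triangulation_of Q TQ \<and>
     (\<forall>p\<in>P. \<forall>p'\<in>P. closed_segment p p' \<in> TP \<longleftrightarrow> closed_segment (f p) (f p') \<in> TQ)"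

definition hull_vertices :: "complex set \<Rightarrow> complex set" where
  "hull_vertices P = {p. p extreme_point_of (convex hull P)}"

definition hull_edge :: "complex set \<Rightarrow> complex \<Rightarrow> complex \<Rightarrow> bool" where
  "hull_edge P p q \<longleftrightarrow> closed_segment p q edge_of (convex hull P)"

definition cyclic_bijection :: "complex set \<Rightarrow> complex set \<Rightarrow> (complex \<Rightarrow> complex) \<Rightarrow> bool" where
  "cyclic_bijection P Q f0 \<longleftrightarrow> bij_betw f0 (hull_vertices P) (hull_vertices Q) \<and>
     (\<forall>p1\<in>hull_vertices P. \<forall>p2\<in>hull_vertices P.
        hull_edge P p1 p2 \<longleftrightarrow> hull_edge Q (f0 p1) (f0 p2))"

definition universal :: "complex set \<Rightarrow> bool" where
  "universal P \<longleftrightarrow> point_set P \<and>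
     (\<forall>Q f0. point_set Q \<and> card Q = card P \<and> cyclic_bijection P Q f0 \<longrightarrow>
        (\<exists>f. bij_betw f P Q \<and> (\<forall>p\<in>hull_vertices P. f p = f0 p) \<and>
           (\<exists>TP TQ. compatible_triangulation P Q f TP TQ)))"

text \<open>The sign of the determinant of \<open>b - a\<close> and \<open>c - a\<close>: \<open>1\<close> if \<open>a, b, c\<close> is a
  counterclockwise triangle, \<open>-1\<close> if clockwise, \<open>0\<close> if the points are collinear.\<close>

definition orientation :: "complex \<Rightarrow> complex \<Rightarrow> complex \<Rightarrow> real" where
  "orientation a b c = sgn (Im (cnj (b - a) * (c - a)))"

definition same_order_type :: "'i set \<Rightarrow> ('i \<Rightarrow> complex) \<Rightarrow> ('i \<Rightarrow> complex) \<Rightarrow> bool" where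
  "same_order_type I p q \<longleftrightarrow> (\<forall>i\<in>I. \<forall>j\<in>I. \<forall>k\<in>I.
     orientation (p i) (p j) (p k) = orientation (q i) (q j) (q k))"

text \<open>Vertices are numbered counterclockwise from \<open>0\<close>. The equation is required for every
  natural \<open>i\<close>, so that \<open>P (i + n) = P i\<close> and indices are implicitly taken modulo \<open>n\<close>.\<close>

definition regular_ngon :: "nat \<Rightarrow> complex \<Rightarrow> (nat \<Rightarrow> complex) \<Rightarrow> bool" where
  "regular_ngon n z P \<longleftrightarrow> (\<exists>r \<theta>. r > 0 \<and>
     (\<forall>i. P i = z + of_real r * cis (\<theta> + 2 * pi * real i / real n)))"

definition inner_points ::
  "nat \<Rightarrow> complex \<Rightarrow> (nat \<Rightarrow> complex) \<Rightarrow> real \<Rightarrow> (nat \<Rightarrow> complex) \<Rightarrow> bool" where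
  "inner_points n z P \<epsilon> A \<longleftrightarrow> (\<forall>i<n.
     A i \<in> closed_segment z (midpoint (P i) (P (Suc i))) \<and>
     infdist (A i) (closed_segment (P i) (P (Suc i))) = \<epsilon>)"

definition double_family :: "nat \<Rightarrow> (nat \<Rightarrow> complex) \<Rightarrow> (nat \<Rightarrow> complex) \<Rightarrow> nat \<Rightarrow> complex" where
  "double_family n P A i = (if i < n then P i else A (i - n))"

text \<open>For \<open>0 < \<epsilon>' < \<epsilon>\<close> the inner points \<open>A' 0, \<dots>, A' (n - 1)\<close> at distance \<open>\<epsilon>'\<close> exist and are
  unique. The order type at \<open>\<epsilon>\<close> itself is compared with those at all smaller \<open>\<epsilon>'\<close>, which rules
  out a degenerate configuration at \<open>\<epsilon>\<close>.\<close>

definition double_circle :: "nat \<Rightarrow> complex set \<Rightarrow> bool" where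
  "double_circle n D \<longleftrightarrow> (\<exists>z P \<epsilon> A.
     regular_ngon n z P \<and> \<epsilon> > 0 \<and> inner_points n z P \<epsilon> A \<and>
     (\<forall>\<epsilon>' A'. 0 < \<epsilon>' \<and> \<epsilon>' < \<epsilon> \<and> inner_points n z P \<epsilon>' A' \<longrightarrow>
        same_order_type {..<2 * n} (double_family n P A) (double_family n P A')) \<and>
     D = P ` {..<n} \<union> A ` {..<n})"

end

theory Submission
  imports Defs
begin

text \<open>Label the double circle cyclically by \<open>0, \<dots>, 2n - 1\<close>, the hull vertices by even and the inner
  points by odd numbers. In cyclic order all triples are counterclockwise, except for the
  \<^emph>\<open>ears\<close> \<open>P\<^sub>i A\<^sub>i P\<^sub>i\<^sub>+\<^sub>1\<close>, which are clockwise.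

  Given \<open>Q\<close>, assign its inner points to the hull edges so that the product of the distances is
  minimal. Exchanging two points shows that the triangles over different hull edges do not overlap.
  Cut these triangles off the hull one at a time by letting the apex move in from the hull edge,
  and repair the triangulation by a flip whenever a triangle degenerates. This yields cyclically
  ordered triples, all counterclockwise in \<open>Q\<close>, whose boundary is the remaining polygon. No ear is
  among them, because ears are clockwise in \<open>Q\<close>, so these triples are also counterclockwise in the
  double circle.

  Finally, counterclockwise triangles whose boundary is a convex polygon cover every generic
  point of it exactly once, because the number of triangles around a point is the winding number of
  the boundary. Hence their sides form a triangulation, in the double circle as well as in \<open>Q\<close>.\<close>

section \<open>Signed areas\<close>

text \<open>The polygon left after the cuts need not be convex, and its interior never appears: only
  a chain of label triples with prescribed boundary edges is carried along, so no Jordan curve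
  argument is required. A flip keeps the boundary, the number of triples and the cyclic order of
  their labels; together with the absence of ears, this order is all that positivity in the double
  circle depends on.

  A product is minimised, not a sum, because exchanging two inner points then compares products of
  affine functions. Their difference becomes an affine function of one point that vanishes at an
  apex, and its zero line separates the two triangles.

  A moving apex may make several different triangles degenerate at once, where the flip can fail.
  This happens only at finitely many points, which can be bypassed; at the end point general
  position excludes degeneration.

  The ears are put back before the winding number is counted: the boundary is then the convex hull
  polygon, which a ray from an inner point leaves exactly once, and one and the same chain serves
  both point sets.\<close>

definition area2 :: "complex \<Rightarrow> complex \<Rightarrow> complex \<Rightarrow> real" where
  "area2 a b c = Im (cnj (b - a) * (c - a))"

lemma area2_alt:
  "area2 a b c = (Re b - Re a) * (Im c - Im a) - (Im b - Im a) * (Re c - Re a)"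
  by (simp add: area2_def algebra_simps)

lemma area2_rotate: "area2 b c a = area2 a b c"
  by (simp add: area2_alt algebra_simps)

lemma area2_swap: "area2 b a c = - area2 a b c"
  by (simp add: area2_alt algebra_simps)

lemma area2_swap23: "area2 a c b = - area2 a b c"
  by (simp add: area2_alt algebra_simps)

lemma area2_degenerate [simp]: "area2 a a b = 0" "area2 a b a = 0" "area2 a b b = 0"
  by (simp_all add: area2_alt)

lemma area2_cnj: "area2 (cnj a) (cnj b) (cnj c) = - area2 a b c"
  by (simp add: area2_alt algebra_simps)

lemma area2_eq_inner: "area2 a b x = (\<i> * (b - a)) \<bullet> x - (\<i> * (b - a)) \<bullet> a"
  by (simp add: area2_alt inner_complex_def algebra_simps)

lemma area2_affine:
  assumes "s + t = 1"
  shows "area2 a b (s *\<^sub>R x + t *\<^sub>R y) = s * area2 a b x + t * area2 a b y"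
proof -
  have s: "s = 1 - t" using assms by simp
  show ?thesis unfolding s by (simp add: area2_alt algebra_simps)
qed

lemma area2_split: "area2 a b x + area2 b c x + area2 c a x = area2 a b c"
  by (simp add: area2_alt algebra_simps)

lemma continuous_on_area2 [continuous_intros]:
  "continuous_on S f \<Longrightarrow> continuous_on S g \<Longrightarrow> continuous_on S h \<Longrightarrow>
    continuous_on S (\<lambda>x. area2 (f x) (g x) (h x))"
  unfolding area2_alt by (intro continuous_intros)

lemma collinear_iff_area2: "collinear {a, b, c} \<longleftrightarrow> area2 a b c = 0"
proof -
  have "collinear {a, b, c} \<longleftrightarrow> collinear {b, a, c}" by (simp add: insert_commute)
  also have "\<dots> \<longleftrightarrow> collinear {0, b - a, c - a}"
    by (rule collinear_3) (simp add: NO_MATCH_def)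
  also have "\<dots> \<longleftrightarrow> Im ((c - a) / (b - a)) = 0"
    by (simp add: collinear_iff_Reals complex_is_Real_iff)
  also have "\<dots> \<longleftrightarrow> Im ((c - a) * cnj (b - a)) = 0"
    by (rule Im_complex_div_eq_0)
  also have "\<dots> \<longleftrightarrow> area2 a b c = 0"
    by (auto simp: area2_alt algebra_simps)
  finally show ?thesis .
qed

lemma sgn_area2: "orientation a b c = sgn (area2 a b c)"
  by (simp add: orientation_def area2_def)

lemma open_area2_pos: "open {x. area2 a b x > 0}"
  by (intro open_Collect_less continuous_intros)

lemma convex_area2_pos: "convex {x. area2 a b x > 0}"
  unfolding convex_def
proof (clarsimp simp: area2_affine)
  fix x y and u v :: real
  assume *: "0 < area2 a b x" "0 < area2 a b y" "0 \<le> u" "0 \<le> v" "u + v = 1"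
  then consider "u > 0" | "v > 0" by linarith
  then show "0 < u * area2 a b x + v * area2 a b y"
    using * by cases (simp_all add: add_pos_nonneg add_nonneg_pos)
qed

lemma negligible_area2_zero:
  assumes "a \<noteq> b"
  shows "negligible {x. area2 a b x = 0}"
proof -
  have "{x. area2 a b x = 0} = {x. (\<i> * (b - a)) \<bullet> x = (\<i> * (b - a)) \<bullet> a}"
    by (auto simp: area2_eq_inner)
  then show ?thesis using assms by (simp add: negligible_hyperplane)
qed

section \<open>Chains of triangles and flips\<close>

type_synonym triple = "nat \<times> nat \<times> nat"

definition skew :: "(nat \<Rightarrow> nat \<Rightarrow> int) \<Rightarrow> bool" where
  "skew \<phi> \<longleftrightarrow> (\<forall>u v. \<phi> u v = - \<phi> v u)"

fun circulation :: "(nat \<Rightarrow> nat \<Rightarrow> int) \<Rightarrow> triple \<Rightarrow> int" where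
  "circulation \<phi> (u, v, w) = \<phi> u v + \<phi> v w + \<phi> w u"

text \<open>The boundary of the chain \<open>\<tau>\<close> is \<open>B\<close>, up to cancellation of opposite edges: antisymmetric
  weights are the cochains that do not see such pairs.\<close>

definition spans :: "triple multiset \<Rightarrow> (nat \<times> nat) multiset \<Rightarrow> bool" where
  "spans \<tau> B \<longleftrightarrow>
     (\<forall>\<phi>. skew \<phi> \<longrightarrow> (\<Sum>t\<in>#\<tau>. circulation \<phi> t) = (\<Sum>e\<in>#B. \<phi> (fst e) (snd e)))"

fun sides :: "triple \<Rightarrow> (nat \<times> nat) set" where
  "sides (u, v, w) = {(u, v), (v, w), (w, u)}"

fun corners :: "triple \<Rightarrow> nat set" where
  "corners (u, v, w) = {u, v, w}"

fun proper :: "triple \<Rightarrow> bool" where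
  "proper (u, v, w) \<longleftrightarrow> u \<noteq> v \<and> v \<noteq> w \<and> w \<noteq> u"

fun cyc :: "triple \<Rightarrow> bool" where
  "cyc (u, v, w) \<longleftrightarrow> u < v \<and> v < w \<or> v < w \<and> w < u \<or> w < u \<and> u < v"

fun tarea :: "(nat \<Rightarrow> complex) \<Rightarrow> triple \<Rightarrow> real" where
  "tarea X (u, v, w) = area2 (X u) (X v) (X w)"

lemma cyc_proper: "cyc t \<Longrightarrow> proper t"
  by (cases t rule: cyc.cases) auto

text \<open>Two labels at the same point and any third label would form a proper triple of area
  zero.\<close>

lemma inj_on_general_position:
  assumes "finite V" "card V \<ge> 3" "\<And>t. corners t \<subseteq> V \<Longrightarrow> proper t \<Longrightarrow> tarea X t \<noteq> 0"
  shows "inj_on X V"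
proof
  fix u v assume uv: "u \<in> V" "v \<in> V" "X u = X v"
  show "u = v"
  proof (rule ccontr)
    assume "u \<noteq> v"
    have "\<not> V \<subseteq> {u, v}" using card_mono[of "{u, v}" V] assms(2) by (auto simp: card_insert_if split: if_splits)
    then obtain w where "w \<in> V" "w \<noteq> u" "w \<noteq> v" by auto
    then show False using assms(3)[of "(u, v, w)"] uv \<open>u \<noteq> v\<close> by auto
  qed
qed

text \<open>The elementary cochain of a directed edge: for \<open>u \<noteq> v\<close>, summing it
  over a chain counts the sides \<open>(u, v)\<close> minus the sides \<open>(v, u)\<close>, so
  \<open>spans\<close> can be tested one edge at a time.\<close>

definition edge_flow :: "nat \<Rightarrow> nat \<Rightarrow> nat \<Rightarrow> nat \<Rightarrow> int" where
  "edge_flow u v x y = (if x = u \<and> y = v then 1 else if x = v \<and> y = u then - 1 else 0)"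

lemma skew_edge_flow: "u \<noteq> v \<Longrightarrow> skew (edge_flow u v)"
  by (auto simp: skew_def edge_flow_def)

lemma circulation_edge_flow:
  assumes "proper t" "u \<noteq> v"
  shows "circulation (edge_flow u v) t =
    (if (u, v) \<in> sides t then 1 else if (v, u) \<in> sides t then - 1 else 0)"
proof -
  obtain a b c where t: "t = (a, b, c)" by (cases t) auto
  have n: "a \<noteq> b" "b \<noteq> c" "c \<noteq> a" using assms by (auto simp: t)
  show ?thesis
  proof (cases "a = u \<or> a = v")
    case True
    then show ?thesis using n assms(2) by (elim disjE) (simp_all add: t edge_flow_def)
  next
    case False
    then show ?thesis using n assms(2) by (simp add: t edge_flow_def)
  qed
qed

lemma spans_edge_flow:
  assumes "spans \<tau> B" "\<And>t. t \<in># \<tau> \<Longrightarrow> proper t" "u \<noteq> v"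
  shows "(\<Sum>t\<in>#\<tau>. if (u, v) \<in> sides t then 1 else if (v, u) \<in> sides t then - 1 else 0 :: int)
    = (\<Sum>e\<in>#B. edge_flow u v (fst e) (snd e))"
proof -
  have "(\<Sum>t\<in>#\<tau>. if (u, v) \<in> sides t then 1 else if (v, u) \<in> sides t then - 1 else 0 :: int)
    = (\<Sum>t\<in>#\<tau>. circulation (edge_flow u v) t)"
    using assms(2) circulation_edge_flow[OF _ assms(3)]
    by (intro arg_cong[where f = sum_mset] image_mset_cong) auto
  also have "\<dots> = (\<Sum>e\<in>#B. edge_flow u v (fst e) (snd e))"
    using assms(1) skew_edge_flow[OF assms(3)] unfolding spans_def by blast
  finally show ?thesis .
qed

lemma sum_mset_pos_ex:
  fixes f :: "'a \<Rightarrow> int"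
  assumes "(\<Sum>t\<in>#M. f t) > 0"
  shows "\<exists>t\<in>#M. f t > 0"
proof (rule ccontr)
  assume "\<not> ?thesis"
  then have "\<And>t. t \<in># M \<Longrightarrow> f t \<le> 0" by force
  then have "(\<Sum>t\<in>#M. f t) \<le> (\<Sum>t\<in>#M. 0)" by (rule sum_mset_mono)
  with assms show False by simp
qed

text \<open>No reverse edge in \<open>B\<close> cancels \<open>(u, v)\<close>, so its signed count
  is positive, in \<open>B\<close> and hence in the chain.\<close>

lemma spans_boundary_triple:
  assumes "spans \<tau> B" "\<And>t. t \<in># \<tau> \<Longrightarrow> proper t" "u \<noteq> v"
    and "(u, v) \<in># B" "(v, u) \<notin># B"
  shows "\<exists>t\<in>#\<tau>. (u, v) \<in> sides t"
proof -
  obtain B' where B': "B = add_mset (u, v) B'" using assms(4) by (metis insert_DiffM)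
  have "edge_flow u v (fst e) (snd e) \<ge> 0" if "e \<in># B'" for e
    using assms(5) that by (cases e) (auto simp: B' edge_flow_def)
  then have "(\<Sum>e\<in>#B'. edge_flow u v (fst e) (snd e)) \<ge> (\<Sum>e\<in>#B'. 0)"
    by (intro sum_mset_mono)
  then have "(\<Sum>e\<in>#B. edge_flow u v (fst e) (snd e)) > 0"
    by (simp add: B' edge_flow_def)
  also have "(\<Sum>e\<in>#B. edge_flow u v (fst e) (snd e)) =
      (\<Sum>t\<in>#\<tau>. if (u, v) \<in> sides t then 1 else if (v, u) \<in> sides t then - 1 else 0)"
    using spans_edge_flow[OF assms(1,2,3)] by simp
  finally show ?thesis using sum_mset_pos_ex by (force split: if_splits)
qed

text \<open>An edge that is absent from \<open>B\<close> in both directions has signed count 0. The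
  triple \<open>t\<close> contributes -1 to the count of \<open>(u, v)\<close>, so some other triple
  contributes +1.\<close>

lemma spans_neighbour:
  assumes "spans \<tau> B" "\<And>t. t \<in># \<tau> \<Longrightarrow> proper t" "t \<in># \<tau>" "(v, u) \<in> sides t"
    and "(u, v) \<notin># B" "(v, u) \<notin># B"
  shows "\<exists>t\<in>#\<tau>. (u, v) \<in> sides t"
proof -
  have "proper t" using assms by blast
  with assms(4) have uv: "u \<noteq> v" "(u, v) \<notin> sides t" by (cases t rule: sides.cases; auto)+
  obtain \<tau>' where \<tau>': "\<tau> = add_mset t \<tau>'" using assms(3) by (metis insert_DiffM)
  have "(\<Sum>e\<in>#B. edge_flow u v (fst e) (snd e)) = (\<Sum>e\<in>#B. 0)"
    using assms(5,6) by (intro arg_cong[where f = sum_mset] image_mset_cong) (auto simp: edge_flow_def)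
  then have "(\<Sum>t\<in>#\<tau>. if (u, v) \<in> sides t then 1 else if (v, u) \<in> sides t then - 1 else 0 :: int) = 0"
    using spans_edge_flow[OF assms(1,2) uv(1)] by simp
  then have "(\<Sum>t\<in>#\<tau>'. if (u, v) \<in> sides t then 1 else if (v, u) \<in> sides t then - 1 else 0 :: int) > 0"
    using uv assms(4) by (simp add: \<tau>')
  from sum_mset_pos_ex[OF this] show ?thesis by (auto simp: \<tau>' split: if_splits)
qed

lemma sides_third:
  assumes "(u, v) \<in> sides t"
  obtains w where "\<And>\<phi>. circulation \<phi> t = circulation \<phi> (u, v, w)" "corners t = {u, v, w}"
    "cyc t = cyc (u, v, w)" "\<And>X. tarea X t = tarea X (u, v, w)" "sides t = sides (u, v, w)"
proof -
  obtain a b c where t: "t = (a, b, c)" by (cases t) auto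
  consider "u = a" "v = b" | "u = b" "v = c" | "u = c" "v = a" using assms by (auto simp: t)
  then show thesis
  proof cases
    case 1 then show ?thesis by (intro that[of c]) (auto simp: t)
  next
    case 2 then show ?thesis by (intro that[of a]) (auto simp: t area2_rotate)
  next
    case 3 then show ?thesis by (intro that[of b]) (auto simp: t area2_rotate[symmetric])
  qed
qed

text \<open>Both pairs of triples have the boundary of the quadrilateral \<open>x, y, z, w\<close>:
  the diagonal \<open>xz\<close> cancels in the old pair, the diagonal \<open>yw\<close> in the new
  one.\<close>

lemma spans_flip:
  assumes "spans (add_mset t1 (add_mset t2 \<tau>)) B"
    and "\<And>\<phi>. circulation \<phi> t1 = circulation \<phi> (z, x, y)"
    and "\<And>\<phi>. circulation \<phi> t2 = circulation \<phi> (x, z, w)"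
  shows "spans (add_mset (x, y, w) (add_mset (y, z, w) \<tau>)) B"
  unfolding spans_def
proof (intro allI impI)
  fix \<phi> assume \<phi>: "skew \<phi>"
  then have "\<phi> z x = - \<phi> x z" "\<phi> w y = - \<phi> y w" unfolding skew_def by blast+
  then have "circulation \<phi> (x, y, w) + circulation \<phi> (y, z, w) = circulation \<phi> t1 + circulation \<phi> t2"
    by (simp add: assms(2,3))
  moreover have "(\<Sum>t\<in>#add_mset t1 (add_mset t2 \<tau>). circulation \<phi> t) = (\<Sum>e\<in>#B. \<phi> (fst e) (snd e))"
    using assms(1) \<phi> unfolding spans_def by blast
  ultimately show "(\<Sum>t\<in>#add_mset (x, y, w) (add_mset (y, z, w) \<tau>). circulation \<phi> t)
      = (\<Sum>e\<in>#B. \<phi> (fst e) (snd e))"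
    by simp
qed

lemma degenerate_middle:
  assumes "tarea X t = 0" "inj_on X V" "corners t \<subseteq> V" "proper t"
  obtains x y z where "(z, x) \<in> sides t" "corners t = {x, y, z}" "proper (x, y, z)"
    "X y \<in> open_segment (X x) (X z)" "\<And>\<phi>. circulation \<phi> t = circulation \<phi> (z, x, y)"
    "cyc t = cyc (z, x, y)"
proof -
  obtain a b c where t: "t = (a, b, c)" by (cases t) auto
  have neq: "X a \<noteq> X b" "X b \<noteq> X c" "X a \<noteq> X c"
    using assms by (auto simp: t inj_on_def)
  have "collinear {X a, X b, X c}" using assms(1) by (simp add: t collinear_iff_area2)
  then consider "X a \<in> open_segment (X c) (X b)" | "X b \<in> open_segment (X a) (X c)"
    | "X c \<in> open_segment (X b) (X a)"
    unfolding collinear_between_cases between_mem_segment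
    using neq by (auto simp: open_segment_def closed_segment_commute)
  then show thesis
  proof cases
    case 1 then show ?thesis using assms(4) by (intro that[of b c a]) (auto simp: t)
  next
    case 2 then show ?thesis using assms(4) by (intro that[of c a b]) (auto simp: t)
  next
    case 3 then show ?thesis using assms(4) by (intro that[of a b c]) (auto simp: t)
  qed
qed

lemma area2_open_segment:
  assumes "y \<in> open_segment x z" "area2 x z w > 0"
  shows "area2 x y w > 0" "area2 y z w > 0"
proof -
  obtain s where s: "0 < s" "s < 1" "y = (1 - s) *\<^sub>R x + s *\<^sub>R z"
    using assms(1) by (auto simp: in_segment)
  have "area2 x y w = area2 w x y" by (metis area2_rotate)
  also have "\<dots> = s * area2 w x z" using area2_affine[of "1 - s" s w x x z] by (simp add: s)
  also have "area2 w x z = area2 x z w" by (metis area2_rotate)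
  finally show "area2 x y w > 0" using s assms(2) by simp
  have "area2 y z w = area2 z w y" by (metis area2_rotate)
  also have "\<dots> = (1 - s) * area2 z w x" using area2_affine[of "1 - s" s z w x z] by (simp add: s)
  also have "area2 z w x = area2 x z w" by (metis area2_rotate)
  finally show "area2 y z w > 0" using s assms(2) by simp
qed

text \<open>If the middle vertex \<open>y\<close> of a degenerate triangle lies between \<open>x\<close> and \<open>z\<close>, the neighbour
  \<open>xzw\<close> across the long side is nondegenerate by \<open>uniq\<close>, and flipping \<open>xz\<close> to \<open>yw\<close> removes one
  degenerate triangle.\<close>

lemma resolve_degenerate:
  assumes inj: "inj_on X V"
    and edges: "\<And>u v y. (u, v) \<in># B \<Longrightarrow> y \<in> V \<Longrightarrow> X y \<notin> open_segment (X u) (X v)"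
    and uniq: "\<And>t t'. corners t \<subseteq> V \<Longrightarrow> corners t' \<subseteq> V \<Longrightarrow> proper t \<Longrightarrow> proper t' \<Longrightarrow>
      tarea X t = 0 \<Longrightarrow> tarea X t' = 0 \<Longrightarrow> corners t = corners t'"
  shows "spans \<tau> B \<Longrightarrow> (\<forall>t\<in>#\<tau>. cyc t \<and> corners t \<subseteq> V \<and> tarea X t \<ge> 0) \<Longrightarrow>
    \<exists>\<tau>'. spans \<tau>' B \<and> size \<tau>' = size \<tau> \<and> (\<forall>t\<in>#\<tau>'. cyc t \<and> corners t \<subseteq> V \<and> tarea X t > 0)"
proof (induction "size (filter_mset (\<lambda>t. tarea X t = 0) \<tau>)" arbitrary: \<tau> rule: less_induct)
  case less
  show ?case
  proof (cases "\<exists>t1\<in>#\<tau>. tarea X t1 = 0")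
    case False
    then show ?thesis using less.prems by (intro exI[of _ \<tau>]) force
  next
    case True
    then obtain t1 where t1: "t1 \<in># \<tau>" "tarea X t1 = 0" by blast
    have cyc1: "cyc t1" "corners t1 \<subseteq> V" using less.prems t1 by blast+
    obtain x y z where xyz: "(z, x) \<in> sides t1" "corners t1 = {x, y, z}" "proper (x, y, z)"
      "X y \<in> open_segment (X x) (X z)" "\<And>\<phi>. circulation \<phi> t1 = circulation \<phi> (z, x, y)"
      "cyc t1 = cyc (z, x, y)"
      using degenerate_middle[OF t1(2) inj cyc1(2) cyc_proper[OF cyc1(1)]] by metis
    have "y \<in> V" using xyz cyc1 by auto
    \<comment> \<open>The long side has \<open>y\<close> in its interior, which \<open>edges\<close>
      forbids for boundary edges; hence there is a triple on its other side.\<close>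
    then have nB: "(x, z) \<notin># B" "(z, x) \<notin># B"
      using edges xyz(4) open_segment_commute by metis+
    have "\<And>t. t \<in># \<tau> \<Longrightarrow> proper t" using less.prems(2) cyc_proper by blast
    from spans_neighbour[OF less.prems(1) this t1(1) xyz(1) nB]
    obtain t2 where t2: "t2 \<in># \<tau>" "(x, z) \<in> sides t2" by auto
    obtain w where w: "\<And>\<phi>. circulation \<phi> t2 = circulation \<phi> (x, z, w)" "corners t2 = {x, z, w}"
      "cyc t2 = cyc (x, z, w)" "\<And>X. tarea X t2 = tarea X (x, z, w)"
      using sides_third[OF t2(2)] by metis
    have cyc2: "cyc t2" "corners t2 \<subseteq> V" "tarea X t2 \<ge> 0" using less.prems t2 by blast+
    \<comment> \<open>If \<open>w\<close> were \<open>y\<close>, the two triples would be reverses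
      of each other, and a triple and its reverse are never both \<open>cyc\<close>.\<close>
    have wy: "w \<noteq> y" using cyc1(1) cyc2(1) unfolding xyz(6) w(3) by auto
    have "corners t1 \<noteq> corners t2" using wy xyz(2,3) w(2) by auto
    then have pos2: "tarea X t2 > 0"
      using uniq[OF cyc1(2) cyc2(2) cyc_proper[OF cyc1(1)] cyc_proper[OF cyc2(1)] t1(2)] cyc2(3)
      by force
    then have "t1 \<noteq> t2" using t1(2) by auto
    then obtain \<sigma> where \<sigma>: "\<tau> = add_mset t1 (add_mset t2 \<sigma>)"
      using t1(1) t2(1) by (metis insert_DiffM insert_noteq_member)
    define \<tau>' where "\<tau>' = add_mset (x, y, w) (add_mset (y, z, w) \<sigma>)"
    have "spans \<tau>' B"
      unfolding \<tau>'_def using less.prems(1) spans_flip[OF _ xyz(5) w(1)] by (simp add: \<sigma>)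
    moreover have new: "tarea X (x, y, w) > 0" "tarea X (y, z, w) > 0"
      using area2_open_segment[OF xyz(4)] pos2 w(4) by auto
    \<comment> \<open>On the label circle \<open>y\<close> lies on the arc from \<open>x\<close> to
      \<open>z\<close> and \<open>w\<close> on the arc from \<open>z\<close> to \<open>x\<close>, so
      the four labels are in the cyclic order \<open>x, y, z, w\<close>.\<close>
    moreover have "cyc (x, y, w)" "cyc (y, z, w)"
      using cyc1(1) cyc2(1) unfolding xyz(6) w(3) by auto
    moreover have "corners (x, y, w) \<subseteq> V" "corners (y, z, w) \<subseteq> V"
      using cyc1(2) cyc2(2) xyz(2) w(2) by auto
    ultimately have "\<forall>t\<in>#\<tau>'. cyc t \<and> corners t \<subseteq> V \<and> tarea X t \<ge> 0"
      using less.prems(2) by (auto simp: \<tau>'_def \<sigma>)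
    moreover have "size (filter_mset (\<lambda>t. tarea X t = 0) \<tau>') < size (filter_mset (\<lambda>t. tarea X t = 0) \<tau>)"
      using new pos2 t1(2) by (simp add: \<tau>'_def \<sigma>)
    ultimately obtain \<tau>'' where "spans \<tau>'' B" "size \<tau>'' = size \<tau>'"
      "\<forall>t\<in>#\<tau>''. cyc t \<and> corners t \<subseteq> V \<and> tarea X t > 0"
      using less.hyps[of \<tau>'] \<open>spans \<tau>' B\<close> by auto
    moreover have "size \<tau>' = size \<tau>" by (simp add: \<tau>'_def \<sigma>)
    ultimately show ?thesis by auto
  qed
qed

text \<open>The triangle on the boundary edge from \<open>a\<close> to \<open>c\<close> is split at
  \<open>m\<close>; the two copies of the edge between \<open>m\<close> and \<open>w\<close>
  cancel.\<close>

lemma spans_subdivide: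
  assumes "spans (add_mset t \<sigma>) (add_mset (a, c) B)" "\<And>\<phi>. circulation \<phi> t = circulation \<phi> (a, c, w)"
  shows "spans (add_mset (a, m, w) (add_mset (m, c, w) \<sigma>)) (add_mset (a, m) (add_mset (m, c) B))"
  unfolding spans_def
proof (intro allI impI)
  fix \<phi> assume \<phi>: "skew \<phi>"
  then have "\<phi> w m = - \<phi> m w" unfolding skew_def by blast
  moreover have "(\<Sum>t\<in>#add_mset t \<sigma>. circulation \<phi> t) = (\<Sum>e\<in>#add_mset (a, c) B. \<phi> (fst e) (snd e))"
    using assms(1) \<phi> unfolding spans_def by blast
  ultimately show "(\<Sum>t\<in>#add_mset (a, m, w) (add_mset (m, c, w) \<sigma>). circulation \<phi> t)
      = (\<Sum>e\<in>#add_mset (a, m) (add_mset (m, c) B). \<phi> (fst e) (snd e))"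
    by (simp add: assms(2))
qed

text \<open>Fixing the number of triples leaves finitely many candidate chains; this is what keeps a
  union of closed conditions, one per chain, closed in \<open>carve_step\<close>.\<close>

lemma finite_bounded_triples:
  assumes "finite V"
  shows "finite {\<tau> :: triple multiset. size \<tau> = k \<and> (\<forall>t\<in>#\<tau>. corners t \<subseteq> V)}"
proof (rule finite_subset)
  show "finite (mset ` {ts. set ts \<subseteq> V \<times> V \<times> V \<and> length ts = k})"
    using assms by (intro finite_imageI finite_lists_length_eq) auto
  show "{\<tau> :: triple multiset. size \<tau> = k \<and> (\<forall>t\<in>#\<tau>. corners t \<subseteq> V)} \<subseteq>
      mset ` {ts. set ts \<subseteq> V \<times> V \<times> V \<and> length ts = k}"
  proof
    fix \<tau> :: "triple multiset"
    assume *: "\<tau> \<in> {\<tau>. size \<tau> = k \<and> (\<forall>t\<in>#\<tau>. corners t \<subseteq> V)}"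
    obtain ts where ts: "mset ts = \<tau>" using ex_mset by blast
    moreover have "t \<in> V \<times> V \<times> V" if "t \<in># \<tau>" for t
      using * that by (cases t) auto
    moreover have "length ts = k" using * ts by auto
    ultimately show "\<tau> \<in> mset ` {ts. set ts \<subseteq> V \<times> V \<times> V \<and> length ts = k}"
      by (intro image_eqI[of _ _ ts]) auto
  qed
qed

section \<open>Triangles with one moving vertex\<close>

lemma tarea_upd: "m \<notin> corners t \<Longrightarrow> tarea (X(m := x)) t = tarea X t"
  by (cases t) auto

lemma tarea_upd_mem:
  assumes "proper t" "m \<in> corners t"
  obtains u v where "corners t = {m, u, v}" "u \<noteq> m" "v \<noteq> m" "u \<noteq> v"
    "\<And>X x. tarea (X(m := x)) t = area2 (X u) (X v) x"
proof -
  obtain a b c where t: "t = (a, b, c)" by (cases t) auto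
  have p: "a \<noteq> b" "b \<noteq> c" "c \<noteq> a" using assms by (auto simp: t)
  consider "m = a" | "m = b" | "m = c" using assms by (auto simp: t)
  then show thesis
  proof cases
    case 1 then show ?thesis using p by (intro that[of b c]) (auto simp: t area2_rotate)
  next
    case 2 then show ?thesis using p by (intro that[of c a]) (auto simp: t area2_rotate[symmetric])
  next
    case 3 then show ?thesis using p by (intro that[of a b]) (auto simp: t)
  qed
qed

lemma area2_centroid:
  "area2 a b ((a + b + c) / 3) = area2 a b c / 3"
  "area2 b c ((a + b + c) / 3) = area2 a b c / 3"
  "area2 c a ((a + b + c) / 3) = area2 a b c / 3"
  by (simp_all add: area2_alt field_simps)

text \<open>Two common points put \<open>u, v, u', v'\<close> on one line. The conclusion has the
  form that general position refutes unless the two pairs coincide.\<close>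

lemma lines_meet_once:
  assumes "u \<noteq> v" "x \<noteq> x'" "area2 u v x = 0" "area2 u v x' = 0" "area2 u' v' x = 0" "area2 u' v' x' = 0"
    "u' \<noteq> v'"
  shows "area2 u v u' = 0 \<and> area2 u v v' = 0"
proof -
  have "collinear {u, v, x, x'}" using assms by (subst collinear_triples) (auto simp: collinear_iff_area2)
  then have 1: "collinear {x, x', u, v}" by (simp add: insert_commute)
  have "collinear {u', v', x, x'}" using assms by (subst collinear_triples) (auto simp: collinear_iff_area2)
  then have 2: "collinear {x, x', u', v'}" by (simp add: insert_commute)
  have "collinear {x, x', w}" if "w \<in> {u, v, u', v'}" for w
    using that by (auto intro: collinear_subset[OF 1] collinear_subset[OF 2])
  then have *: "collinear {x, x', u, v, u', v'}"
    by (subst collinear_triples[OF assms(2)]) blast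
  have "collinear {u, v, u'}" "collinear {u, v, v'}"
    by (rule collinear_subset[OF *]; blast)+
  then show ?thesis by (simp add: collinear_iff_area2)
qed

section \<open>Cutting a triangle off a polygon\<close>

text \<open>The three areas add up to \<open>area2 a b c\<close>, so this is the interior of a
  counterclockwise triangle and empty otherwise.\<close>

definition open_tri :: "complex \<Rightarrow> complex \<Rightarrow> complex \<Rightarrow> complex set" where
  "open_tri a b c = {x. area2 a b x > 0 \<and> area2 b c x > 0 \<and> area2 c a x > 0}"

lemma continuous_tarea: "continuous_on UNIV (\<lambda>x. tarea (X(m := x)) t)"
proof -
  have "continuous_on UNIV (\<lambda>x. (X(m := x)) a)" for a
    by (cases "a = m") (auto intro: continuous_intros)
  then show ?thesis by (cases t) (simp add: continuous_on_area2 del: fun_upd_apply)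
qed

lemma open_tarea_pos: "open {x. \<forall>t\<in>#\<tau>. tarea (X(m := x)) t > 0}"
proof -
  have "open {x. tarea (X(m := x)) t > 0}" for t
    by (intro open_Collect_less continuous_tarea continuous_intros)
  moreover have "{x. \<forall>t\<in>#\<tau>. tarea (X(m := x)) t > 0} = (\<Inter>t\<in>set_mset \<tau>. {x. tarea (X(m := x)) t > 0})"
    by auto
  ultimately show ?thesis by (simp add: open_INT)
qed

lemma closed_tarea_nonneg: "closed {x. \<forall>t\<in>#\<tau>. tarea (X(m := x)) t \<ge> 0}"
proof -
  have "closed {x. tarea (X(m := x)) t \<ge> 0}" for t
    by (intro closed_Collect_le continuous_tarea continuous_intros)
  moreover have "{x. \<forall>t\<in>#\<tau>. tarea (X(m := x)) t \<ge> 0} = (\<Inter>t\<in>set_mset \<tau>. {x. tarea (X(m := x)) t \<ge> 0})"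
    by auto
  ultimately show ?thesis by (simp add: closed_INT)
qed

text \<open>These are the positions in which a moving vertex can make two different triangles
  degenerate at once. In general position two different pairs span different lines, which meet at
  most once.\<close>

lemma finite_double_lines:
  assumes "finite V" "\<And>t. corners t \<subseteq> V \<Longrightarrow> proper t \<Longrightarrow> tarea X t \<noteq> 0" "inj_on X V"
  shows "finite {x. \<exists>u\<in>V. \<exists>v\<in>V. \<exists>u'\<in>V. \<exists>v'\<in>V. u \<noteq> v \<and> u' \<noteq> v' \<and> {u, v} \<noteq> {u', v'} \<and>
    area2 (X u) (X v) x = 0 \<and> area2 (X u') (X v') x = 0}" (is "finite ?F")
proof -
  define S where "S u v u' v' = {x. u \<noteq> v \<and> u' \<noteq> v' \<and> {u, v} \<noteq> {u', v'} \<and>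
    area2 (X u) (X v) x = 0 \<and> area2 (X u') (X v') x = 0}" for u v u' v'
  have "finite (S u v u' v')" if V: "u \<in> V" "v \<in> V" "u' \<in> V" "v' \<in> V" for u v u' v'
  proof -
    have "x = x'" if "x \<in> S u v u' v'" "x' \<in> S u v u' v'" for x x'
    proof (rule ccontr)
      assume "x \<noteq> x'"
      have uv: "u \<noteq> v" "u' \<noteq> v'" using that by (auto simp: S_def)
      then have "X u \<noteq> X v" "X u' \<noteq> X v'" using V assms(3) by (auto simp: inj_on_def)
      with that \<open>x \<noteq> x'\<close> have *: "area2 (X u) (X v) (X u') = 0 \<and> area2 (X u) (X v) (X v') = 0"
        using lines_meet_once[of "X u" "X v" x x' "X u'" "X v'"] by (auto simp: S_def)
      have "u' \<in> {u, v}" using assms(2)[of "(u, v, u')"] * V uv by auto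
      moreover have "v' \<in> {u, v}" using assms(2)[of "(u, v, v')"] * V uv by auto
      ultimately have "{u, v} = {u', v'}" using uv by auto
      then show False using that(1) by (auto simp: S_def)
    qed
    then show ?thesis by (metis finite.simps is_singletonI' is_singleton_def)
  qed
  then have "finite (\<Union>u\<in>V. \<Union>v\<in>V. \<Union>u'\<in>V. \<Union>v'\<in>V. S u v u' v')"
    using assms(1) by simp
  moreover have "?F \<subseteq> (\<Union>u\<in>V. \<Union>v\<in>V. \<Union>u'\<in>V. \<Union>v'\<in>V. S u v u' v')"
  proof
    fix x assume "x \<in> ?F"
    then obtain u v u' v' where V: "u \<in> V" "v \<in> V" "u' \<in> V" "v' \<in> V" and uv:
      "u \<noteq> v \<and> u' \<noteq> v' \<and> {u, v} \<noteq> {u', v'} \<and>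
        area2 (X u) (X v) x = 0 \<and> area2 (X u') (X v') x = 0"
      by (elim CollectE bexE)
    have "x \<in> S u v u' v'" unfolding S_def using uv by (rule CollectI)
    with V show "x \<in> (\<Union>u\<in>V. \<Union>v\<in>V. \<Union>u'\<in>V. \<Union>v'\<in>V. S u v u' v')" by (intro UN_I)
  qed
  ultimately show ?thesis by (rule rev_finite_subset)
qed

text \<open>The positions of the new vertex in the open triangle that admit a positive chain form an open
  set, nonempty near the edge. By \<open>resolve_degenerate\<close> this set is also closed in the complement of the
  finite set of points on two lines, which is still connected. The apex \<open>b\<close> is a limit of such
  positions, and general position makes the limiting areas positive.\<close>

lemma carve_step:
  fixes X :: "nat \<Rightarrow> complex"
  assumes V: "finite V" "m \<notin> V" "a \<in> V" "c \<in> V" "a \<noteq> c" and inj: "inj_on X V"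
    and \<tau>: "spans \<tau> (add_mset (a, c) B)" "\<And>t. t \<in># \<tau> \<Longrightarrow> cyc t \<and> corners t \<subseteq> V \<and> tarea X t > 0"
    and B: "\<And>u v. (u, v) \<in># B \<Longrightarrow> u \<in> V \<and> v \<in> V" "(c, a) \<notin># B"
    and m: "\<And>w. w \<in> V \<Longrightarrow> cyc (a, c, w) \<Longrightarrow> cyc (a, m, w) \<and> cyc (m, c, w)"
    and b: "area2 (X a) (X c) b > 0"
    and avoid: "\<And>u v. (u, v) \<in># B \<Longrightarrow> closed_segment (X u) (X v) \<inter> open_tri (X a) (X c) b = {}"
    and avoid': "\<And>v. v \<in> V \<Longrightarrow> X v \<notin> open_tri (X a) (X c) b"
    and gp: "\<And>t. corners t \<subseteq> insert m V \<Longrightarrow> proper t \<Longrightarrow> tarea (X(m := b)) t \<noteq> 0"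
  shows "\<exists>\<tau>'. spans \<tau>' (add_mset (a, m) (add_mset (m, c) B)) \<and> size \<tau>' = size \<tau> + 1 \<and>
    (\<forall>t\<in>#\<tau>'. cyc t \<and> corners t \<subseteq> insert m V \<and> tarea (X(m := b)) t > 0)"
proof -
  define B' where "B' = add_mset (a, m) (add_mset (m, c) B)"
  define U' where "U' = open_tri (X a) (X c) b"
  have U'_iff: "x \<in> U' \<longleftrightarrow> area2 (X a) (X c) x > 0 \<and> area2 (X c) b x > 0 \<and> area2 b (X a) x > 0" for x
    by (simp add: U'_def open_tri_def)
  have gpV: "tarea X t \<noteq> 0" if "corners t \<subseteq> V" "proper t" for t
  proof -
    have "m \<notin> corners t" "corners t \<subseteq> insert m V" using that V(2) by auto
    then show ?thesis using gp[of t] that tarea_upd[of m t X b] by simp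
  qed
  define F where "F = {x. \<exists>u\<in>V. \<exists>v\<in>V. \<exists>u'\<in>V. \<exists>v'\<in>V. u \<noteq> v \<and> u' \<noteq> v' \<and> {u, v} \<noteq> {u', v'} \<and>
    area2 (X u) (X v) x = 0 \<and> area2 (X u') (X v') x = 0}"
  have F: "finite F" unfolding F_def by (rule finite_double_lines[OF V(1) gpV inj])
  define T where "T = {\<tau>'. spans \<tau>' B' \<and> size \<tau>' = size \<tau> + 1 \<and> (\<forall>t\<in>#\<tau>'. cyc t \<and> corners t \<subseteq> insert m V)}"
  have finT: "finite T"
    by (rule finite_subset[OF _ finite_bounded_triples[of "insert m V" "size \<tau> + 1"]])
      (auto simp: T_def V(1))
  \<comment> \<open>The candidates in \<open>T\<close> do not depend on the position
    \<open>x\<close>, so each of them contributes an open set to \<open>G\<close> and a closed set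
    to \<open>G'\<close>.\<close>
  define G where "G = (\<Union>\<tau>'\<in>T. {x. \<forall>t\<in>#\<tau>'. tarea (X(m := x)) t > 0})"
  define G' where "G' = (\<Union>\<tau>'\<in>T. {x. \<forall>t\<in>#\<tau>'. tarea (X(m := x)) t \<ge> 0})"
  have "open G" unfolding G_def by (intro open_UN ballI open_tarea_pos)
  have "closed G'" unfolding G'_def by (intro closed_UN finT closed_tarea_nonneg ballI)
  have "G \<subseteq> G'" unfolding G_def G'_def by force
  define H where "H = U' - F"
  have U'_eq: "U' = {x. area2 (X a) (X c) x > 0} \<inter> {x. area2 (X c) b x > 0} \<inter> {x. area2 b (X a) x > 0}"
    by (auto simp: U'_def open_tri_def)
  have openU: "open U'" unfolding U'_eq by (intro open_Int open_area2_pos)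
  have "connected U'" unfolding U'_eq by (intro convex_connected convex_Int convex_area2_pos)
  then have connH: "connected H"
    unfolding H_def by (intro connected_open_delete_finite openU F) auto
  \<comment> \<open>The two new boundary edges run inside the triangle, where \<open>avoid'\<close>
    admits no vertex; this gives the hypothesis \<open>edges\<close> of
    \<open>resolve_degenerate\<close> for them.\<close>
  have seg: "open_segment (X a) x \<subseteq> U'" "open_segment x (X c) \<subseteq> U'" if "x \<in> U'" for x
  proof -
    have "area2 (X c) b (X a) = area2 (X a) (X c) b" "area2 b (X a) (X c) = area2 (X a) (X c) b"
      by (metis area2_rotate)+
    then have *: "area2 (X c) b (X a) > 0" "area2 b (X a) (X c) > 0" using b by simp_all
    show "open_segment (X a) x \<subseteq> U'"
      using that * by (auto simp: in_segment U'_iff area2_affine add_pos_pos)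
    show "open_segment x (X c) \<subseteq> U'"
      using that * by (auto simp: in_segment U'_iff area2_affine add_pos_pos)
  qed
  have GH: "x \<in> G" if "x \<in> H" "x \<in> G'" for x
  proof -
    let ?Y = "X(m := x)"
    let ?V = "insert m V"
    have x: "x \<in> U'" "x \<notin> F" using that by (auto simp: H_def)
    have Xx: "X v \<noteq> x" if "v \<in> V" for v using avoid'[OF that] x(1) by (auto simp: U'_def)
    have injY: "inj_on ?Y ?V"
      using inj Xx V(2) by (auto simp: inj_on_def)
    have edges: "?Y y \<notin> open_segment (?Y u) (?Y v)" if "(u, v) \<in># B'" "y \<in> ?V" for u v y
    proof
      assume *: "?Y y \<in> open_segment (?Y u) (?Y v)"
      have uv: "(u, v) \<in># B \<or> (u = a \<and> v = m) \<or> (u = m \<and> v = c)" using that(1) by (auto simp: B'_def)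
      have am: "a \<noteq> m" "c \<noteq> m" using V by auto
      show False
      proof (cases "(u, v) \<in># B")
        case True
        then have uvV: "u \<in> V" "v \<in> V" "u \<noteq> m" "v \<noteq> m" using B(1) V(2) by blast+
        show False
        proof (cases "y = m")
          case True
          then have "x \<in> closed_segment (X u) (X v)" using * uvV by (simp add: open_segment_def)
          then show False using avoid[OF \<open>(u, v) \<in># B\<close>] x(1) by (auto simp: U'_def)
        next
          case False
          then have yo: "X y \<in> open_segment (X u) (X v)" "y \<in> V" using * uvV that by auto
          have "collinear {X u, X y, X v}"
            using yo(1) by (intro between_imp_collinear) (auto simp: between_mem_segment open_segment_def)
          then have "tarea X (u, y, v) = 0" by (simp add: collinear_iff_area2)
          moreover have "proper (u, y, v)" using yo(1) by (auto simp: open_segment_def)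
          ultimately show False using gpV[of "(u, y, v)"] uvV yo(2) by auto
        qed
      next
        case False
        then have "open_segment (?Y u) (?Y v) \<subseteq> U'" "x \<notin> open_segment (?Y u) (?Y v)"
          using uv am seg[OF x(1)] by (auto simp: open_segment_def)
        then show False using * that(2) avoid' by (cases "y = m") (auto simp: U'_def)
      qed
    qed
    \<comment> \<open>Only triples through \<open>m\<close> can degenerate, and such a triple puts
      \<open>x\<close> on the line of its other two corners. Two different ones would put
      \<open>x\<close> into \<open>F\<close>.\<close>
    have m_corner: "m \<in> corners t" if "corners t \<subseteq> ?V" "proper t" "tarea ?Y t = 0" for t
    proof (rule ccontr)
      assume "m \<notin> corners t"
      then have "corners t \<subseteq> V" "tarea X t = 0" using that tarea_upd[of m t X x] by auto
      then show False using gpV that(2) by blast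
    qed
    have uniq: "corners t = corners t'"
      if t: "corners t \<subseteq> ?V" "proper t" "tarea ?Y t = 0" and t': "corners t' \<subseteq> ?V" "proper t'" "tarea ?Y t' = 0" for t t'
    proof (rule ccontr)
      assume ne: "corners t \<noteq> corners t'"
      have "m \<in> corners t" by (rule m_corner[OF t])
      then obtain u v where uv: "corners t = {m, u, v}" "u \<noteq> m" "v \<noteq> m" "u \<noteq> v"
        "\<And>X x. tarea (X(m := x)) t = area2 (X u) (X v) x" using tarea_upd_mem[OF t(2)] by metis
      have "m \<in> corners t'" by (rule m_corner[OF t'])
      then obtain u' v' where uv': "corners t' = {m, u', v'}" "u' \<noteq> m" "v' \<noteq> m" "u' \<noteq> v'"
        "\<And>X x. tarea (X(m := x)) t' = area2 (X u') (X v') x" using tarea_upd_mem[OF t'(2)] by metis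
      have inV: "u \<in> V" "v \<in> V" "u' \<in> V" "v' \<in> V" using uv uv' t(1) t'(1) by auto
      have "{u, v} \<noteq> {u', v'}" using ne uv(1) uv'(1) by auto
      moreover have "area2 (X u) (X v) x = 0" "area2 (X u') (X v') x = 0" using t(3) t'(3) uv(5) uv'(5) by auto
      ultimately have "x \<in> F" unfolding F_def using inV uv(4) uv'(4) by blast
      then show False using x by simp
    qed
    obtain \<tau>' where \<tau>': "\<tau>' \<in> T" "\<forall>t\<in>#\<tau>'. tarea ?Y t \<ge> 0" using \<open>x \<in> G'\<close> by (auto simp: G'_def)
    then have "spans \<tau>' B'" "\<forall>t\<in>#\<tau>'. cyc t \<and> corners t \<subseteq> ?V \<and> tarea ?Y t \<ge> 0" by (auto simp: T_def)
    from resolve_degenerate[OF injY edges uniq this]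
    obtain \<tau>'' where "spans \<tau>'' B'" "size \<tau>'' = size \<tau>'"
      "\<forall>t\<in>#\<tau>''. cyc t \<and> corners t \<subseteq> ?V \<and> tarea ?Y t > 0" by blast
    then have "\<tau>'' \<in> T" "\<forall>t\<in>#\<tau>''. tarea ?Y t > 0" using \<tau>'(1) by (auto simp: T_def)
    then show ?thesis unfolding G_def by blast
  qed
  have "H \<inter> G \<noteq> {}"
  proof -
    have pr: "\<And>t. t \<in># \<tau> \<Longrightarrow> proper t" using \<tau>(2) cyc_proper by blast
    have "(c, a) \<notin># add_mset (a, c) B" using V(5) B(2) by simp
    from spans_boundary_triple[OF \<tau>(1) pr V(5) _ this]
    obtain t where t: "t \<in># \<tau>" "(a, c) \<in> sides t" by auto
    obtain w where w: "\<And>\<phi>. circulation \<phi> t = circulation \<phi> (a, c, w)" "corners t = {a, c, w}"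
      "cyc t = cyc (a, c, w)" "\<And>X. tarea X t = tarea X (a, c, w)"
      using sides_third[OF t(2)] by metis
    obtain \<sigma> where \<sigma>: "\<tau> = add_mset t \<sigma>" using t(1) by (metis insert_DiffM)
    define \<tau>' where "\<tau>' = add_mset (a, m, w) (add_mset (m, c, w) \<sigma>)"
    have sp: "spans \<tau>' B'" unfolding \<tau>'_def B'_def
      by (rule spans_subdivide[OF \<tau>(1)[unfolded \<sigma>] w(1)])
    have wV: "w \<in> V" "cyc (a, c, w)" using \<tau>(2)[OF t(1)] w by auto
    then have "\<tau>' \<in> T"
      using \<tau>(2) m[OF wV] V sp by (auto simp: T_def \<tau>'_def \<sigma>)
    \<comment> \<open>\<open>N\<close> collects the conditions that hold at the midpoint of
      \<open>a\<close> and \<open>c\<close>. The remaining one, \<open>S\<close>, fails there but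
      holds arbitrarily close to it.\<close>
    define N where "N = {x. area2 (X c) (X w) x > 0} \<inter> {x. area2 (X w) (X a) x > 0} \<inter> {x. area2 (X c) b x > 0} \<inter> {x. area2 b (X a) x > 0}"
    define S where "S = {x. area2 (X a) (X c) x > 0}"
    have posw: "area2 (X a) (X c) (X w) > 0" using \<tau>(2)[OF t(1)] w(4)[of X] by simp
    have mid: "midpoint (X a) (X c) = (1/2) *\<^sub>R X a + (1/2) *\<^sub>R X c"
      by (simp add: midpoint_def scaleR_add_right)
    have area_mid: "area2 p q (midpoint (X a) (X c)) = (area2 p q (X a) + area2 p q (X c)) / 2" for p q
      unfolding mid by (subst area2_affine) auto
    have rot: "area2 (X c) (X w) (X a) > 0" "area2 (X w) (X a) (X c) > 0"
      "area2 (X c) b (X a) > 0" "area2 b (X a) (X c) > 0"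
      using posw b by (metis area2_rotate)+
    have "midpoint (X a) (X c) \<in> N" unfolding N_def using rot by (simp add: area_mid)
    moreover have "midpoint (X a) (X c) \<in> closure S"
    proof -
      have "open_segment (midpoint (X a) (X c)) b \<subseteq> S"
        using b by (auto simp: S_def in_segment area2_affine area_mid)
      moreover have "midpoint (X a) (X c) \<noteq> b" using b area_mid[of "X a" "X c"] by auto
      ultimately show ?thesis
        using closure_mono[of "open_segment (midpoint (X a) (X c)) b" S] by (auto simp: closure_open_segment)
    qed
    moreover have openN: "open N" unfolding N_def by (intro open_Int open_area2_pos)
    ultimately have ne: "N \<inter> S \<noteq> {}" using open_Int_closure_eq_empty[OF openN, of S] by blast
    have "open (N \<inter> S)" unfolding S_def by (intro open_Int openN open_area2_pos)
    \<comment> \<open>A nonempty open set is infinite, so it has a point outside the finite set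
      \<open>F\<close>.\<close>
    then have "infinite (N \<inter> S)" using ne finite_imp_not_open by blast
    then obtain x where x: "x \<in> N" "x \<in> S" "x \<notin> F" using F by (meson IntD1 IntD2 finite_subset subsetI)
    have "x \<in> H" using x by (auto simp: H_def U'_iff N_def S_def)
    moreover have "tarea (X(m := x)) t' > 0" if t': "t' \<in># \<tau>'" for t'
    proof -
      consider "t' = (a, m, w)" | "t' = (m, c, w)" | "t' \<in># \<sigma>" using t' by (auto simp: \<tau>'_def)
      then show ?thesis
      proof cases
        case 1
        then show ?thesis using x wV V area2_rotate[of "X a" x "X w"] by (auto simp: N_def)
      next
        case 2
        then show ?thesis using x wV V area2_rotate[of "X c" "X w" x] by (auto simp: N_def)
      next
        case 3
        then have "corners t' \<subseteq> V" "tarea X t' > 0" using \<tau>(2) \<sigma> by auto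
        moreover from this have "m \<notin> corners t'" using V(2) by blast
        ultimately show ?thesis using tarea_upd[of m t' X x] by simp
      qed
    qed
    then have "x \<in> G" using \<open>\<tau>' \<in> T\<close> unfolding G_def by blast
    ultimately show ?thesis by blast
  qed
  moreover have "H \<inter> G = H \<inter> G'" using GH \<open>G \<subseteq> G'\<close> by blast
  moreover have "openin (top_of_set H) (H \<inter> G)" using \<open>open G\<close> by auto
  moreover have "closedin (top_of_set H) (H \<inter> G')" using \<open>closed G'\<close> by (rule closedin_closed_Int)
  ultimately have "H \<subseteq> G" using connH unfolding connected_clopen by (metis inf.order_iff inf_commute)
  have "b \<in> closure H"
  proof -
    define g where "g = (X a + X c + b) / 3"
    have g: "g \<in> U'" using area2_centroid[where a = "X a" and b = "X c" and c = b] b by (simp add: U'_iff g_def)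
    then have "b \<noteq> g" by (auto simp: U'_iff)
    have "open_segment b g \<subseteq> U'"
      using g b by (auto simp: in_segment U'_iff area2_affine add_pos_pos)
    then have "closure (open_segment b g) \<subseteq> closure U'" by (rule closure_mono)
    then have "b \<in> closure U'" using \<open>b \<noteq> g\<close> by (auto simp: closure_open_segment)
    moreover have "U' \<subseteq> closure H"
    proof -
      have "closure (- F) = UNIV" using F by (simp add: closure_complement empty_interior_finite)
      then show ?thesis using open_Int_closure_subset[OF openU, of "- F"] by (simp add: H_def Diff_eq)
    qed
    ultimately show ?thesis using closure_minimal[of U' "closure H"] by auto
  qed
  moreover have "closure H \<subseteq> G'" using \<open>H \<subseteq> G\<close> \<open>G \<subseteq> G'\<close> \<open>closed G'\<close> by (intro closure_minimal) auto
  ultimately have "b \<in> G'" by blast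
  then obtain \<tau>' where \<tau>': "\<tau>' \<in> T" "\<forall>t\<in>#\<tau>'. tarea (X(m := b)) t \<ge> 0" by (auto simp: G'_def)
  have "cyc t \<and> corners t \<subseteq> insert m V \<and> tarea (X(m := b)) t > 0" if t: "t \<in># \<tau>'" for t
  proof -
    have *: "cyc t" "corners t \<subseteq> insert m V" using \<tau>'(1) t by (simp_all add: T_def)
    moreover have "tarea (X(m := b)) t \<noteq> 0" by (rule gp[OF *(2) cyc_proper[OF *(1)]])
    moreover have "tarea (X(m := b)) t \<ge> 0" using \<tau>'(2) t by blast
    ultimately show ?thesis by simp
  qed
  then show ?thesis using \<tau>'(1) unfolding B'_def T_def by blast
qed

text \<open>Label \<open>2 * i\<close> is the \<open>i\<close>-th hull vertex, \<open>2 * i + 1\<close> the inner point assigned to the hull edge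
  from \<open>2 * i\<close> to \<open>nx n i\<close>.\<close>

definition nx :: "nat \<Rightarrow> nat \<Rightarrow> nat" where
  "nx n i = (2 * i + 2) mod (2 * n)"

lemma nx_less: "i < n \<Longrightarrow> nx n i < 2 * n"
  by (simp add: nx_def)

lemma nx_Suc: "Suc i < n \<Longrightarrow> nx n i = 2 * i + 2"
  by (simp add: nx_def)

lemma nx_last: "i < n \<Longrightarrow> \<not> Suc i < n \<Longrightarrow> nx n i = 0"
proof -
  assume "i < n" "\<not> Suc i < n"
  then have "2 * i + 2 = 2 * n" by simp
  then show ?thesis unfolding nx_def by simp
qed

lemma nx_cases:
  assumes "i < n"
  obtains "Suc i < n" "nx n i = 2 * i + 2" | "Suc i = n" "nx n i = 0"
  using assms nx_Suc[of i n] nx_last[of i n] by linarith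

lemma nx_mod: "nx n i = 2 * (Suc i mod n)"
  unfolding nx_def by (metis add_2_eq_Suc' mult_Suc_right mult_mod_right add.commute)

lemma odd_neq_nx: "2 * i + 1 \<noteq> nx n j"
  unfolding nx_mod by (metis dvd_triv_left odd_two_times_div_two_succ even_plus_one_iff)

section \<open>The boundary of the partly cut hull\<close>

lemma sum_mset_sum_nested:
  assumes "finite A"
  shows "(\<Sum>e\<in>#(\<Sum>i\<in>A. M i). f e) = (\<Sum>i\<in>A. \<Sum>e\<in>#M i. f e :: int)"
  using assms by induction auto

definition carved_edges :: "nat \<Rightarrow> nat \<Rightarrow> nat \<Rightarrow> (nat \<times> nat) multiset" where
  "carved_edges n k i =
     (if i < k then {#(2 * i, 2 * i + 1), (2 * i + 1, nx n i)#} else {#(2 * i, nx n i)#})"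

definition carved_boundary :: "nat \<Rightarrow> nat \<Rightarrow> (nat \<times> nat) multiset" where
  "carved_boundary n k = (\<Sum>i<n. carved_edges n k i)"

lemma sum_boundary_0:
  "(\<Sum>e\<in>#carved_boundary n 0. \<phi> (fst e) (snd e)) = (\<Sum>i<n. \<phi> (2 * i) (nx n i) :: int)"
  unfolding carved_boundary_def sum_mset_sum_nested[OF finite_lessThan]
  by (simp add: carved_edges_def)

text \<open>The start of the induction is the fan of triangles from hull vertex 0. Its inner spokes
  cancel in pairs; a partial fan has one spoke left over, the last summand in
  \<open>tele\<close>.\<close>

lemma fan_spans:
  assumes "n \<ge> 3"
  shows "spans (\<Sum>i\<in>{1..<n - 1}. {#(0, 2 * i, 2 * i + 2)#}) (carved_boundary n 0)"
  unfolding spans_def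
proof (intro allI impI)
  fix \<phi> assume \<phi>: "skew \<phi>"
  have tele: "(\<Sum>i\<in>{1..<m}. \<phi> 0 (2 * i) + \<phi> (2 * i) (2 * i + 2) + \<phi> (2 * i + 2) 0)
      = (\<Sum>i<m. \<phi> (2 * i) (2 * i + 2)) + \<phi> (2 * m) 0" if "m \<ge> 1" for m
    using that
  proof (induction m rule: dec_induct)
    case base
    have "\<phi> 2 0 = - \<phi> 0 2" using \<phi> unfolding skew_def by blast
    then show ?case by (simp add: numeral_2_eq_2)
  next
    case (step m)
    have "\<phi> (2 * m) 0 = - \<phi> 0 (2 * m)" using \<phi> unfolding skew_def by blast
    then show ?case using step by simp
  qed
  obtain l where l: "n = Suc l" "l \<ge> 1" using assms by (cases n) auto
  have "(\<Sum>t\<in>#(\<Sum>i\<in>{1..<n - 1}. {#(0, 2 * i, 2 * i + 2)#}). circulation \<phi> t)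
      = (\<Sum>i\<in>{1..<l}. \<phi> 0 (2 * i) + \<phi> (2 * i) (2 * i + 2) + \<phi> (2 * i + 2) 0)"
    by (simp add: sum_mset_sum_nested l)
  also have "\<dots> = (\<Sum>i<l. \<phi> (2 * i) (2 * i + 2)) + \<phi> (2 * l) 0"
    by (rule tele[OF l(2)])
  also have "\<dots> = (\<Sum>i<n. \<phi> (2 * i) (nx n i))"
    by (simp add: l nx_Suc nx_last)
  finally show "(\<Sum>t\<in>#(\<Sum>i\<in>{1..<n - 1}. {#(0, 2 * i, 2 * i + 2)#}). circulation \<phi> t)
      = (\<Sum>e\<in>#carved_boundary n 0. \<phi> (fst e) (snd e))"
    by (simp add: sum_boundary_0)
qed

lemma carved_boundary_remove:
  assumes "k < n"
  defines "B \<equiv> \<Sum>i\<in>{..<n} - {k}. carved_edges n k i"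
  shows "carved_boundary n k = add_mset (2 * k, nx n k) B"
    and "carved_boundary n (Suc k) = add_mset (2 * k, 2 * k + 1) (add_mset (2 * k + 1, nx n k) B)"
proof -
  show "carved_boundary n k = add_mset (2 * k, nx n k) B"
    unfolding carved_boundary_def B_def
    by (subst sum.remove[of _ k]) (use assms(1) in \<open>auto simp: carved_edges_def\<close>)
  have "B = (\<Sum>i\<in>{..<n} - {k}. carved_edges n (Suc k) i)"
    unfolding B_def by (intro sum.cong) (auto simp: carved_edges_def)
  then show "carved_boundary n (Suc k) = add_mset (2 * k, 2 * k + 1) (add_mset (2 * k + 1, nx n k) B)"
    unfolding carved_boundary_def
    by (subst sum.remove[of _ k]) (use assms(1) in \<open>auto simp: carved_edges_def\<close>)
qed

text \<open>One \<open>carve_step\<close> for each hull edge. By \<open>disj\<close>, the boundary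
  edges and vertices that belong to the other hull edges, cut or still uncut, stay out of the
  triangle that is being cut off.\<close>

lemma positive_triangulation_exists:
  fixes X :: "nat \<Rightarrow> complex"
  assumes n: "n \<ge> 3"
    and convex: "\<And>i w. i < n \<Longrightarrow> w < 2 * n \<Longrightarrow> w \<noteq> 2 * i \<Longrightarrow> w \<noteq> nx n i \<Longrightarrow>
      area2 (X (2 * i)) (X (nx n i)) (X w) > 0"
    and gp: "\<And>t. corners t \<subseteq> {..<2 * n} \<Longrightarrow> proper t \<Longrightarrow> tarea X t \<noteq> 0"
    and disj: "\<And>i j. i < n \<Longrightarrow> j < n \<Longrightarrow> i \<noteq> j \<Longrightarrow>
      convex hull {X (2 * j), X (2 * j + 1), X (nx n j)} \<inter>
      open_tri (X (2 * i)) (X (nx n i)) (X (2 * i + 1)) = {}"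
  shows "\<exists>\<tau>. spans \<tau> (carved_boundary n n) \<and>
    (\<forall>t\<in>#\<tau>. cyc t \<and> corners t \<subseteq> {..<2 * n} \<and> tarea X t > 0)"
proof -
  have inj: "inj_on X {..<2 * n}"
    using n gp by (intro inj_on_general_position) auto
  define V where "V k = {2 * i |i. i < n} \<union> {2 * i + 1 |i. i < k}" for k
  have V_sub: "V k \<subseteq> {..<2 * n}" if "k \<le> n" for k using that by (auto simp: V_def)
  have V_even: "2 * i \<in> V k" if "i < n" for i k using that by (auto simp: V_def)
  have nxV: "nx n i \<in> V k" if "i < n" for i k
    using that V_even[of "i + 1" k] V_even[of 0 k] by (cases rule: nx_cases) auto
  have "\<exists>\<tau>. spans \<tau> (carved_boundary n k) \<and> (\<forall>t\<in>#\<tau>. cyc t \<and> corners t \<subseteq> V k \<and> tarea X t > 0)"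
    if "k \<le> n" for k
    using that
  proof (induction k)
    case 0
    let ?\<tau> = "\<Sum>i\<in>{1..<n - 1}. {#(0::nat, 2 * i, 2 * i + 2)#}"
    have "cyc t \<and> corners t \<subseteq> V 0 \<and> tarea X t > 0" if t: "t \<in># ?\<tau>" for t
    proof -
      obtain i where i: "1 \<le> i" "i < n - 1" "t = (0, 2 * i, 2 * i + 2)"
        using t by (auto simp: set_mset_sum)
      have "nx n i = 2 * i + 2" using i by (intro nx_Suc) auto
      then have "area2 (X (2 * i)) (X (2 * i + 2)) (X 0) > 0"
        using convex[of i 0] i by auto
      then have "tarea X t > 0" by (simp add: i area2_rotate)
      moreover have "0 \<in> V 0" "2 * i \<in> V 0" "2 * i + 2 \<in> V 0"
        using V_even[of 0] V_even[of i] V_even[of "i + 1"] i by auto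
      ultimately show ?thesis using i by auto
    qed
    then show ?case using fan_spans[OF n] by blast
  next
    case (Suc k)
    then have k: "k < n" by simp
    obtain \<tau> where \<tau>: "spans \<tau> (carved_boundary n k)"
      "\<And>t. t \<in># \<tau> \<Longrightarrow> cyc t \<and> corners t \<subseteq> V k \<and> tarea X t > 0" using Suc by auto
    define B where "B = (\<Sum>i\<in>{..<n} - {k}. carved_edges n k i)"
    note bd = carved_boundary_remove[OF k, folded B_def]
    have VS: "V (Suc k) = insert (2 * k + 1) (V k)" by (auto simp: V_def less_Suc_eq)
    have mV: "2 * k + 1 \<notin> V k" unfolding V_def by auto presburger
    have edgeB: "\<exists>i<n. i \<noteq> k \<and> (u, v) \<in># carved_edges n k i" if "(u, v) \<in># B" for u v
      using that by (auto simp: B_def set_mset_sum)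
    \<comment> \<open>The update of \<open>X\<close> changes nothing; it gives the goal the shape of
      \<open>carve_step\<close> with \<open>b\<close> as the final position of the new
      vertex.\<close>
    have "\<exists>\<tau>'. spans \<tau>' (add_mset (2 * k, 2 * k + 1) (add_mset (2 * k + 1, nx n k) B)) \<and>
        size \<tau>' = size \<tau> + 1 \<and>
        (\<forall>t\<in>#\<tau>'. cyc t \<and> corners t \<subseteq> insert (2 * k + 1) (V k) \<and>
          tarea (X(2 * k + 1 := X (2 * k + 1))) t > 0)"
    proof (rule carve_step)
      show "finite (V k)" using V_sub[of k] k finite_subset by auto
      show "2 * k + 1 \<notin> V k" by (rule mV)
      show "2 * k \<in> V k" "nx n k \<in> V k" using V_even nxV k by auto
      show "2 * k \<noteq> nx n k" using k n by (cases rule: nx_cases) auto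
      show "inj_on X (V k)" using inj V_sub[of k] k inj_on_subset by (metis less_or_eq_imp_le)
      show "spans \<tau> (add_mset (2 * k, nx n k) B)" using \<tau>(1) bd(1) by simp
      show "cyc t \<and> corners t \<subseteq> V k \<and> tarea X t > 0" if "t \<in># \<tau>" for t using \<tau>(2) that .
      show "u \<in> V k \<and> v \<in> V k" if uv: "(u, v) \<in># B" for u v
      proof -
        obtain i where "i < n" "i \<noteq> k" "(u, v) \<in># carved_edges n k i" using edgeB[OF uv] by auto
        moreover have "2 * i + 1 \<in> V k" if "i < k" using that by (auto simp: V_def)
        ultimately show ?thesis using V_even nxV by (auto simp: carved_edges_def split: if_splits)
      qed
      \<comment> \<open>Two hull edges that are reverses of each other exist only in a polygon with
        two vertices.\<close>
      show "(nx n k, 2 * k) \<notin># B"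
      proof
        assume "(nx n k, 2 * k) \<in># B"
        then obtain i where i: "i < n" "i \<noteq> k" "(nx n k, 2 * k) \<in># carved_edges n k i"
          using edgeB by blast
        have "nx n k \<noteq> 2 * i + 1" using nxV[OF k, of 0] unfolding V_def by auto presburger
        moreover have "2 * k \<noteq> 2 * i + 1" by presburger
        ultimately have "nx n k = 2 * i" "nx n i = 2 * k"
          using i(3) by (auto simp: carved_edges_def split: if_splits)
        then show False using i k n
          by (cases rule: nx_cases[OF k]; cases rule: nx_cases[OF i(1)]) auto
      qed
      \<comment> \<open>In the cyclic order \<open>2 * k + 1\<close> is the only label between
        \<open>2 * k\<close> and \<open>nx n k\<close>, so \<open>w\<close> is not in this
        gap.\<close>
      show "cyc (2 * k, 2 * k + 1, w) \<and> cyc (2 * k + 1, nx n k, w)"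
        if "w \<in> V k" "cyc (2 * k, nx n k, w)" for w
      proof -
        have "w < 2 * n" "w \<noteq> 2 * k + 1" using that V_sub[of k] k mV by auto
        then show ?thesis using that(2) k by (cases rule: nx_cases[OF k]) auto
      qed
      show "area2 (X (2 * k)) (X (nx n k)) (X (2 * k + 1)) > 0"
        using convex[of k "2 * k + 1"] k mV nxV[OF k, of k] by fastforce
      let ?U = "open_tri (X (2 * k)) (X (nx n k)) (X (2 * k + 1))"
      show "closed_segment (X u) (X v) \<inter> ?U = {}" if uv: "(u, v) \<in># B" for u v
      proof -
        obtain i where i: "i < n" "i \<noteq> k" "(u, v) \<in># carved_edges n k i" using edgeB[OF uv] by auto
        then have "{u, v} \<subseteq> {2 * i, 2 * i + 1, nx n i}"
          by (auto simp: carved_edges_def split: if_splits)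
        then have "closed_segment (X u) (X v) \<subseteq> convex hull {X (2 * i), X (2 * i + 1), X (nx n i)}"
          unfolding segment_convex_hull by (intro hull_mono) auto
        then show ?thesis using disj[OF k i(1)] i(2) by blast
      qed
      show "X v \<notin> ?U" if v: "v \<in> V k" for v
      proof -
        have "(\<exists>i<n. v = 2 * i) \<or> (\<exists>i<k. v = 2 * i + 1)" using v by (auto simp: V_def)
        then obtain i where i: "i < n" "v = 2 * i \<or> v = 2 * i + 1 \<and> i \<noteq> k"
          using k by (metis less_trans nat_neq_iff)
        show ?thesis
        proof (cases "i = k")
          case True
          then show ?thesis using i by (simp add: open_tri_def)
        next
          case False
          then have "X v \<in> convex hull {X (2 * i), X (2 * i + 1), X (nx n i)}"
            using i by (intro hull_inc) auto
          then show ?thesis using disj[OF k i(1)] False by blast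
        qed
      qed
      show "tarea (X(2 * k + 1 := X (2 * k + 1))) t \<noteq> 0"
        if "corners t \<subseteq> insert (2 * k + 1) (V k)" "proper t" for t
      proof -
        have "corners t \<subseteq> {..<2 * n}" using that V_sub[of "Suc k"] k VS by auto
        then show ?thesis using gp that by simp
      qed
    qed
    then show ?case unfolding bd(2) VS by auto
  qed
  from this[of n] show ?thesis using V_sub[of n] by (meson dual_order.refl order.trans)
qed

section \<open>Positive chains bounded by a convex polygon are triangulations\<close>

text \<open>The signed crossing of an edge with a ray from a point \<open>x\<close>: the ends of the edge are on the
  sides \<open>f\<close> and \<open>g\<close> of the line of the ray, and \<open>s\<close> tells on which side of the edge \<open>x\<close> is.\<close>

definition crossing :: "real \<Rightarrow> real \<Rightarrow> real \<Rightarrow> int" where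
  "crossing f g s = (if f \<le> 0 \<and> 0 < g \<and> s > 0 then 1 else if g \<le> 0 \<and> 0 < f \<and> s < 0 then - 1 else 0)"

text \<open>In both clauses of \<open>crossing\<close> a vertex on the line of the ray belongs to
  the nonpositive side, so a passage through such a vertex is neither lost nor counted
  twice.\<close>

lemma crossing_skew: "crossing g f (- s) = - crossing f g s"
  by (auto simp: crossing_def)

text \<open>Here \<open>p, q, r\<close> are the areas that \<open>x\<close> forms with the sides
  \<open>uv, vw, wu\<close>, hence the barycentric weights of \<open>w, u, v\<close>, and
  \<open>zero\<close> says that \<open>x\<close> is on the line of the ray. The boundary of a
  counterclockwise triangle then crosses the ray with total 1 if \<open>x\<close> is inside and 0
  otherwise.\<close>

lemma crossing_triangle:
  assumes nz: "p \<noteq> 0" "q \<noteq> 0" "r \<noteq> 0" and pos: "p + q + r > 0"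
    and zero: "gu * q + gv * r + gw * p = 0" and g: "\<not> (gu = 0 \<and> gv = 0 \<and> gw = 0)"
  shows "crossing gu gv p + crossing gv gw q + crossing gw gu r =
    (if p > 0 \<and> q > 0 \<and> r > 0 then 1 else 0)"
proof -
  \<comment> \<open>With the signs of the three products known, the case distinction is linear in
    \<open>A, B, C\<close>.\<close>
  have signs: "(x > 0 \<longrightarrow> y > 0 \<longrightarrow> x * y > 0) \<and> (x > 0 \<longrightarrow> y < 0 \<longrightarrow> x * y < 0) \<and>
      (x < 0 \<longrightarrow> y > 0 \<longrightarrow> x * y < 0) \<and> (x \<le> 0 \<longrightarrow> y > 0 \<longrightarrow> x * y \<le> 0) \<and> (x \<le> 0 \<longrightarrow> y < 0 \<longrightarrow> x * y \<ge> 0)"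
    for x y :: real
    by (simp add: mult_pos_pos mult_pos_neg mult_neg_pos mult_nonpos_nonneg mult_nonpos_nonpos)
  define A B C where "A = gu * q" and "B = gv * r" and "C = gw * p"
  note s = signs[of gu q, folded A_def] signs[of gv r, folded B_def] signs[of gw p, folded C_def]
  have z: "A + B + C = 0" using zero by (simp add: A_def B_def C_def)
  show ?thesis
    using nz pos g s z unfolding crossing_def by (smt (verit))
qed

text \<open>Barycentric coordinates of \<open>x\<close> with denominators cleared, evaluated under
  the affine function \<open>area2 a b\<close>.\<close>

lemma barycentric:
  "area2 a b x * area2 u v w = area2 a b u * area2 v w x + area2 a b v * area2 w u x + area2 a b w * area2 u v x"
  by (simp add: area2_alt algebra_simps)

lemma barycentric_point:
  "area2 u v w *\<^sub>R x = area2 v w x *\<^sub>R u + area2 w u x *\<^sub>R v + area2 u v x *\<^sub>R w"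
  by (simp add: complex_eq_iff area2_alt algebra_simps)

fun ttri :: "(nat \<Rightarrow> complex) \<Rightarrow> triple \<Rightarrow> complex set" where
  "ttri X (u, v, w) = open_tri (X u) (X v) (X w)"

fun ctri :: "(nat \<Rightarrow> complex) \<Rightarrow> triple \<Rightarrow> complex set" where
  "ctri X (u, v, w) =
     {x. area2 (X u) (X v) x \<ge> 0 \<and> area2 (X v) (X w) x \<ge> 0 \<and> area2 (X w) (X u) x \<ge> 0}"

lemma open_open_tri: "open (open_tri a b c)"
proof -
  have "open_tri a b c = {x. area2 a b x > 0} \<inter> {x. area2 b c x > 0} \<inter> {x. area2 c a x > 0}"
    by (auto simp: open_tri_def)
  then show ?thesis by (simp add: open_Int open_area2_pos)
qed

lemma convex_open_tri: "convex (open_tri a b c)"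
proof -
  have "open_tri a b c = {x. area2 a b x > 0} \<inter> {x. area2 b c x > 0} \<inter> {x. area2 c a x > 0}"
    by (auto simp: open_tri_def)
  then show ?thesis by (simp add: convex_Int convex_area2_pos)
qed

lemma centroid_in_open_tri: "area2 a b c > 0 \<Longrightarrow> (a + b + c) / 3 \<in> open_tri a b c"
  using area2_centroid[where a = a and b = b and c = c] by (simp add: open_tri_def)

lemma corner_in_closure_open_tri:
  assumes "area2 a b c > 0"
  shows "a \<in> closure (open_tri a b c)"
proof -
  define g where "g = (a + b + c) / 3"
  have g: "g \<in> open_tri a b c" using centroid_in_open_tri[OF assms] by (simp add: g_def)
  then have "a \<noteq> g" by (auto simp: open_tri_def)
  have "area2 b c a > 0" using assms by (metis area2_rotate)
  then have "open_segment a g \<subseteq> open_tri a b c"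
    using g by (auto simp: in_segment open_tri_def area2_affine add_pos_pos)
  then have "closure (open_segment a g) \<subseteq> closure (open_tri a b c)" by (rule closure_mono)
  then show ?thesis using \<open>a \<noteq> g\<close> by (auto simp: closure_open_segment)
qed

lemma open_tri_rotate: "open_tri b c a = open_tri a b c"
  by (auto simp: open_tri_def)

lemma corners_in_closure:
  assumes "tarea X t > 0" "p \<in> corners t"
  shows "X p \<in> closure (ttri X t)"
proof -
  obtain u v w where t: "t = (u, v, w)" by (cases t) auto
  have "area2 (X u) (X v) (X w) > 0" "area2 (X v) (X w) (X u) > 0" "area2 (X w) (X u) (X v) > 0"
    using assms(1) unfolding t tarea.simps by (metis area2_rotate)+
  from this[THEN corner_in_closure_open_tri] show ?thesis
    using assms(2) by (auto simp: t open_tri_rotate)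
qed

lemma closed_ctri: "closed (ctri X t)"
proof (cases t)
  case (fields u v w)
  have "ctri X t = {x. area2 (X u) (X v) x \<ge> 0} \<inter> {x. area2 (X v) (X w) x \<ge> 0} \<inter> {x. area2 (X w) (X u) x \<ge> 0}"
    by (auto simp: fields)
  then show ?thesis by (simp only:) (intro closed_Int closed_Collect_le continuous_intros)
qed

lemma ttri_subset_ctri: "ttri X t \<subseteq> ctri X t"
  by (cases t) (auto simp: open_tri_def)

lemma tarea_pos_proper: "tarea X t > 0 \<Longrightarrow> proper t"
  by (cases t) auto

lemma open_ttri: "open (ttri X t)"
  by (cases t) (simp add: open_open_tri)

lemma corner_first:
  assumes "p \<in> corners t"
  obtains v w where "corners t = {p, v, w}" "sides t = {(p, v), (v, w), (w, p)}"
    "\<And>X. tarea X t = tarea X (p, v, w)" "\<And>X. ctri X t = ctri X (p, v, w)" "proper t = proper (p, v, w)"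
proof -
  obtain a b c where t: "t = (a, b, c)" by (cases t) auto
  consider "p = a" | "p = b" | "p = c" using assms by (auto simp: t)
  then show thesis
  proof cases
    case 1 show ?thesis by (rule that[of b c]) (auto simp: t 1)
  next
    case 2 show ?thesis by (rule that[of c a]) (auto simp: t 2 area2_rotate)
  next
    case 3 show ?thesis by (rule that[of a b]) (auto simp: t 3 area2_rotate[symmetric])
  qed
qed

text \<open>Both \<open>v - u\<close> and \<open>w - u\<close> are orthogonal to \<open>a\<close>,
  hence parallel. The real and imaginary parts of \<open>a\<close> are treated separately because
  either of them may vanish.\<close>

lemma area2_zero_of_inner:
  assumes "a \<noteq> 0" "a \<bullet> u = \<beta>" "a \<bullet> v = \<beta>" "a \<bullet> w = \<beta>"
  shows "area2 u v w = 0"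
proof -
  have 1: "Re a * (Re v - Re u) + Im a * (Im v - Im u) = 0" "Re a * (Re w - Re u) + Im a * (Im w - Im u) = 0"
    using assms by (simp_all add: inner_complex_def algebra_simps)
  have "Re a * area2 u v w = (Re a * (Re v - Re u)) * (Im w - Im u) - (Im v - Im u) * (Re a * (Re w - Re u))"
    by (simp add: area2_alt algebra_simps)
  also have "Re a * (Re v - Re u) = - Im a * (Im v - Im u)" using 1 by simp
  also have "Re a * (Re w - Re u) = - Im a * (Im w - Im u)" using 1 by simp
  finally have 2: "Re a * area2 u v w = 0" by (simp add: algebra_simps)
  have "Im a * area2 u v w = (Re v - Re u) * (Im a * (Im w - Im u)) - (Im a * (Im v - Im u)) * (Re w - Re u)"
    by (simp add: area2_alt algebra_simps)
  also have "Im a * (Im v - Im u) = - Re a * (Re v - Re u)" using 1 by simp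
  also have "Im a * (Im w - Im u) = - Re a * (Re w - Re u)" using 1 by simp
  finally have "Im a * area2 u v w = 0" by (simp add: algebra_simps)
  with 2 assms(1) show ?thesis by (auto simp: complex_eq_iff)
qed

lemma open_segments_collinear:
  assumes "y \<in> open_segment a b" "y \<in> open_segment a c"
  shows "area2 a b c = 0"
proof -
  have "collinear {a, y, b}" "collinear {a, y, c}"
    using assms by (auto intro!: between_imp_collinear simp: between_mem_segment open_segment_def)
  then have "collinear {b, a, y}" "collinear {a, y, c}" by (simp_all add: insert_commute)
  then have "collinear {b, a, c}"
    using assms collinear_3_trans[of b a y c] by (auto simp: open_segment_def)
  then show ?thesis by (simp add: collinear_iff_area2[symmetric] insert_commute)
qed

lemma inner_le_closure:
  assumes "\<And>x. x \<in> S \<Longrightarrow> a \<bullet> x \<le> \<beta>" "x \<in> closure S"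
  shows "a \<bullet> x \<le> (\<beta>::real)"
proof -
  have "closure S \<subseteq> {x. a \<bullet> x \<le> \<beta>}" using assms(1) by (intro closure_minimal closed_halfspace_le) auto
  then show ?thesis using assms(2) by auto
qed

lemma segment_level:
  assumes "y \<in> open_segment u v" "a \<bullet> u \<le> \<beta>" "a \<bullet> v \<le> \<beta>" "a \<bullet> y = (\<beta>::real)"
  shows "a \<bullet> u = \<beta>" "a \<bullet> v = \<beta>"
proof -
  obtain s where s: "0 < s" "s < 1" "y = (1 - s) *\<^sub>R u + s *\<^sub>R v" using assms(1) by (auto simp: in_segment)
  have e: "(1 - s) * (\<beta> - a \<bullet> u) + s * (\<beta> - a \<bullet> v) = 0"
    using assms(4) by (simp add: s(3) inner_add_right algebra_simps)
  have "(1 - s) * (\<beta> - a \<bullet> u) \<ge> 0" "s * (\<beta> - a \<bullet> v) \<ge> 0" using s assms by auto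
  with e have "(1 - s) * (\<beta> - a \<bullet> u) = 0" "s * (\<beta> - a \<bullet> v) = 0" by linarith+
  then show "a \<bullet> u = \<beta>" "a \<bullet> v = \<beta>" using s by auto
qed

definition edge_set :: "(nat \<Rightarrow> complex) \<Rightarrow> triple multiset \<Rightarrow> complex set set" where
  "edge_set X \<tau> = {closed_segment (X u) (X v) |u v. \<exists>t\<in>#\<tau>. (u, v) \<in> sides t}"

text \<open>The right-hand side refers to labels only. This is what makes the edge sets of one chain
  compatible under two different labellings.\<close>

lemma closed_segment_in_edge_set:
  assumes inj: "inj_on X I" and \<tau>: "\<And>t. t \<in># \<tau> \<Longrightarrow> corners t \<subseteq> I" and uv: "u \<in> I" "v \<in> I"
  shows "closed_segment (X u) (X v) \<in> edge_set X \<tau> \<longleftrightarrow> (\<exists>t\<in>#\<tau>. (u, v) \<in> sides t \<or> (v, u) \<in> sides t)"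
proof
  assume "closed_segment (X u) (X v) \<in> edge_set X \<tau>"
  then obtain u' v' t where t: "t \<in># \<tau>" "(u', v') \<in> sides t"
    "closed_segment (X u) (X v) = closed_segment (X u') (X v')" by (auto simp: edge_set_def)
  moreover have "u' \<in> corners t" "v' \<in> corners t" using t(2) by (cases t; auto)+
  then have "u' \<in> I" "v' \<in> I" using \<tau>[OF t(1)] by auto
  ultimately have "(u = u' \<and> v = v') \<or> (u = v' \<and> v = u')"
    using inj uv by (auto simp: closed_segment_eq doubleton_eq_iff inj_on_def)
  then show "\<exists>t\<in>#\<tau>. (u, v) \<in> sides t \<or> (v, u) \<in> sides t" using t by blast
next
  assume "\<exists>t\<in>#\<tau>. (u, v) \<in> sides t \<or> (v, u) \<in> sides t"
  then show "closed_segment (X u) (X v) \<in> edge_set X \<tau>"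
    unfolding edge_set_def using closed_segment_commute by blast
qed

text \<open>This is instantiated for both point sets with the same chain. \<open>c\<close> runs once
  around the convex boundary, with \<open>cn\<close> closing it up, and \<open>used\<close> will
  prevent points from hiding inside a triangle.\<close>

locale positive_chain =
  fixes X :: "nat \<Rightarrow> complex" and c :: "nat \<Rightarrow> nat" and n :: nat and \<tau> :: "triple multiset" and I :: "nat set"
  assumes n: "n \<ge> 3" and fin: "finite I" and cI: "\<And>i. i < n \<Longrightarrow> c i \<in> I" and cn: "c n = c 0"
    and cinj: "inj_on c {..<n}"
    and gp: "\<And>t. corners t \<subseteq> I \<Longrightarrow> proper t \<Longrightarrow> tarea X t \<noteq> 0"
    and \<tau>I: "\<And>t. t \<in># \<tau> \<Longrightarrow> corners t \<subseteq> I"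
    and \<tau>pos: "\<And>t. t \<in># \<tau> \<Longrightarrow> tarea X t > 0"
    and spans: "spans \<tau> (\<Sum>i<n. {#(c i, c (Suc i))#})"
    and conv: "\<And>i w. i < n \<Longrightarrow> w \<in> I \<Longrightarrow> w \<noteq> c i \<Longrightarrow> w \<noteq> c (Suc i) \<Longrightarrow>
      area2 (X (c i)) (X (c (Suc i))) (X w) > 0"
    and used: "\<And>p. p \<in> I \<Longrightarrow> \<exists>t\<in>#\<tau>. p \<in> corners t"
begin

lemma c_neq: "i < n \<Longrightarrow> j < n \<Longrightarrow> i \<noteq> j \<Longrightarrow> c i \<noteq> c j"
  using cinj by (auto simp: inj_on_def)

lemma inj: "inj_on X I"
proof (rule inj_on_general_position[OF fin _ gp])
  have "c ` {..<n} \<subseteq> I" using cI by auto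
  then have "card (c ` {..<n}) \<le> card I" by (rule card_mono[OF fin])
  then show "card I \<ge> 3" using n by (simp add: card_image[OF cinj])
qed

definition generic :: "complex \<Rightarrow> bool" where
  "generic x \<longleftrightarrow> (\<forall>u\<in>I. \<forall>v\<in>I. u \<noteq> v \<longrightarrow> area2 (X u) (X v) x \<noteq> 0)"

definition inside_hull :: "complex \<Rightarrow> bool" where
  "inside_hull x \<longleftrightarrow> (\<forall>i<n. area2 (X (c i)) (X (c (Suc i))) x > 0)"

text \<open>Finitely many lines form a null set, which contains no nonempty open set.\<close>

lemma generic_exists:
  assumes "open S" "S \<noteq> {}"
  shows "\<exists>x\<in>S. generic x"
proof (rule ccontr)
  assume no: "\<not> ?thesis"
  let ?P = "{(u, v). u \<in> I \<and> v \<in> I \<and> u \<noteq> v}"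
  have "?P \<subseteq> I \<times> I" by auto
  then have "finite ?P" using fin by (meson finite_SigmaI finite_subset)
  moreover have "negligible {x. area2 (X u) (X v) x = 0}" if "(u, v) \<in> ?P" for u v
    using that inj by (intro negligible_area2_zero) (auto simp: inj_on_def)
  ultimately have "negligible (\<Union>(u, v)\<in>?P. {x. area2 (X u) (X v) x = 0})"
    by (intro negligible_Union) auto
  moreover have "S \<subseteq> (\<Union>(u, v)\<in>?P. {x. area2 (X u) (X v) x = 0})"
    using no unfolding generic_def by blast
  ultimately show False using assms open_not_negligible negligible_subset by blast
qed

lemma conv_ge: "i < n \<Longrightarrow> w \<in> I \<Longrightarrow> area2 (X (c i)) (X (c (Suc i))) (X w) \<ge> 0"
  using conv[of i w] by (cases "w = c i \<or> w = c (Suc i)") auto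

text \<open>The ray from \<open>x\<close> is the one pointing away from \<open>c 0\<close>, so that it crosses the convex
  polygon only where the sign of \<open>g\<close> changes along \<open>c 1, \<dots>, c (n - 1)\<close>.\<close>

lemma depth_one:
  assumes gen: "generic x" and ins: "inside_hull x"
  shows "(\<Sum>t\<in>#\<tau>. if x \<in> ttri X t then 1 else 0 :: int) = 1"
proof -
  define g where "g u = area2 (X (c 0)) x (X u)" for u
  define \<phi> where "\<phi> u v = crossing (g u) (g v) (area2 (X u) (X v) x)" for u v
  have "skew \<phi>"
    unfolding skew_def \<phi>_def using crossing_skew area2_swap by metis
  then have eq: "(\<Sum>t\<in>#\<tau>. circulation \<phi> t) = (\<Sum>i<n. \<phi> (c i) (c (Suc i)))"
    using spans unfolding spans_def by (auto simp: sum_mset_sum_nested)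
  have g0: "g u \<noteq> 0" if "u \<in> I" "u \<noteq> c 0" for u
  proof -
    have "area2 (X (c 0)) (X u) x \<noteq> 0" using gen that cI[of 0] n unfolding generic_def by auto
    then show ?thesis unfolding g_def using area2_swap23[of "X (c 0)" x "X u"] by auto
  qed
  have "circulation \<phi> t = (if x \<in> ttri X t then 1 else 0)" if t: "t \<in># \<tau>" for t
  proof -
    obtain u v w where uvw: "t = (u, v, w)" by (cases t) auto
    have I: "u \<in> I" "v \<in> I" "w \<in> I" using \<tau>I[OF t] by (auto simp: uvw)
    have p: "u \<noteq> v" "v \<noteq> w" "w \<noteq> u" using tarea_pos_proper[OF \<tau>pos[OF t]] by (auto simp: uvw)
    have "circulation \<phi> t = (if area2 (X u) (X v) x > 0 \<and> area2 (X v) (X w) x > 0 \<and> area2 (X w) (X u) x > 0 then 1 else 0)"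
      unfolding uvw circulation.simps \<phi>_def
    proof (rule crossing_triangle)
      show "area2 (X u) (X v) x \<noteq> 0" "area2 (X v) (X w) x \<noteq> 0" "area2 (X w) (X u) x \<noteq> 0"
        using gen I p by (auto simp: generic_def)
      show "area2 (X u) (X v) x + area2 (X v) (X w) x + area2 (X w) (X u) x > 0"
        using \<tau>pos[OF t] by (simp add: uvw area2_split)
      show "g u * area2 (X v) (X w) x + g v * area2 (X w) (X u) x + g w * area2 (X u) (X v) x = 0"
        by (simp add: g_def area2_alt algebra_simps)
      show "\<not> (g u = 0 \<and> g v = 0 \<and> g w = 0)" using g0 I p by metis
    qed
    then show ?thesis by (simp add: uvw open_tri_def)
  qed
  then have "(\<Sum>t\<in>#\<tau>. if x \<in> ttri X t then 1 else 0 :: int) = (\<Sum>t\<in>#\<tau>. circulation \<phi> t)"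
    by (intro arg_cong[where f = sum_mset] image_mset_cong) auto
  also have "\<dots> = (\<Sum>i<n. \<phi> (c i) (c (Suc i)))" by (rule eq)
  \<comment> \<open>Since \<open>x\<close> is to the left of every hull edge, only the positive
    clause of \<open>crossing\<close> can apply.\<close>
  also have "\<dots> = (\<Sum>i<n. of_bool (g (c i) \<le> 0 \<and> 0 < g (c (Suc i))))"
    using ins unfolding inside_hull_def by (intro sum.cong) (auto simp: \<phi>_def crossing_def not_less)
  also have "\<dots> = 1"
  proof -
    have c01: "area2 (X (c 0)) (X (c 1)) x > 0" using ins n unfolding inside_hull_def by auto
    have g00: "g (c 0) = 0" by (simp add: g_def)
    have g1: "g (c 1) < 0"
      using c01 area2_swap23[of "X (c 0)" x "X (c 1)"] by (simp add: g_def)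
    have "Suc (n - 1) = n" "n - 1 < n" using n by simp_all
    then have "area2 (X (c (n - 1))) (X (c 0)) x > 0"
      using ins cn unfolding inside_hull_def by metis
    then have gl: "g (c (n - 1)) > 0" unfolding g_def by (metis area2_rotate)
    have mono: "g (c (Suc i)) > 0" if i: "1 \<le> i" "Suc i < n" "g (c i) > 0" for i
    proof -
      have i2: "i \<ge> 2" using i g1 by (cases "i = 1") auto
      have a: "area2 (X (c 0)) (X (c 1)) (X (c i)) > 0" "area2 (X (c 0)) (X (c 1)) (X (c (Suc i))) > 0"
        using conv[of 0 "c i"] conv[of 0 "c (Suc i)"] cI c_neq i i2 n by auto
      have "area2 (X (c i)) (X (c (Suc i))) (X (c 0)) > 0"
        using conv[of i "c 0"] cI c_neq i n by auto
      then have b: "area2 (X (c 0)) (X (c i)) (X (c (Suc i))) > 0" by (metis area2_rotate)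
      \<comment> \<open>This is the Grassmann-Pluecker relation for the directions from
        \<open>c 0\<close> to \<open>c 1\<close>, \<open>x\<close>, \<open>c i\<close> and
        \<open>c (Suc i)\<close>. It shows that \<open>g\<close> stays positive once it is
        positive.\<close>
      have "area2 (X (c 0)) (X (c 1)) (X (c i)) * g (c (Suc i)) =
          area2 (X (c 0)) (X (c 1)) x * area2 (X (c 0)) (X (c i)) (X (c (Suc i))) +
          area2 (X (c 0)) (X (c 1)) (X (c (Suc i))) * g (c i)"
        by (simp add: g_def area2_alt algebra_simps)
      also have "\<dots> > 0" using a b c01 i by (simp add: add_pos_pos)
      finally show ?thesis using a by (simp add: zero_less_mult_iff)
    qed
    have "(\<Sum>i<m. of_bool (g (c i) \<le> 0 \<and> 0 < g (c (Suc i))) :: int) = of_bool (g (c m) > 0)"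
      if "1 \<le> m" "m < n" for m
      using that
    proof (induction m rule: dec_induct)
      case base
      then show ?case using g00 g1 by simp
    next
      case (step m)
      then show ?case using mono[of m] by (auto simp: of_bool_def)
    qed
    from this[of "n - 1"] have "(\<Sum>i<n - 1. of_bool (g (c i) \<le> 0 \<and> 0 < g (c (Suc i))) :: int) = 1"
      using n gl by simp
    \<comment> \<open>The last edge returns to \<open>c 0\<close>, where \<open>g\<close> is 0 and
      not positive, so it adds nothing.\<close>
    moreover have "{..<n} = insert (n - 1) {..<n - 1}" using n by auto
    ultimately show ?thesis using n cn g00 by simp
  qed
  finally show ?thesis .
qed

text \<open>On an open triangle the area over a hull edge is a positive combination of its
  nonnegative values at the corners. They are not all 0, since at most two corners are ends of that
  edge.\<close>

lemma ttri_inside_hull: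
  assumes "t \<in># \<tau>" "x \<in> ttri X t"
  shows "inside_hull x"
  unfolding inside_hull_def
proof (intro allI impI)
  fix i assume i: "i < n"
  obtain u v w where uvw: "t = (u, v, w)" by (cases t) auto
  have I: "u \<in> I" "v \<in> I" "w \<in> I" using \<tau>I[OF assms(1)] by (auto simp: uvw)
  have p: "u \<noteq> v" "v \<noteq> w" "w \<noteq> u" using tarea_pos_proper[OF \<tau>pos[OF assms(1)]] by (auto simp: uvw)
  let ?f = "\<lambda>w. area2 (X (c i)) (X (c (Suc i))) w"
  have ge: "?f (X u) \<ge> 0" "?f (X v) \<ge> 0" "?f (X w) \<ge> 0" using conv_ge i I by auto
  have x: "area2 (X v) (X w) x > 0" "area2 (X w) (X u) x > 0" "area2 (X u) (X v) x > 0"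
    using assms(2) by (auto simp: uvw open_tri_def)
  have "?f (X u) > 0 \<or> ?f (X v) > 0 \<or> ?f (X w) > 0" using conv[OF i] I p by metis
  then have "?f (X u) * area2 (X v) (X w) x + ?f (X v) * area2 (X w) (X u) x + ?f (X w) * area2 (X u) (X v) x > 0"
    using mult_nonneg_nonneg[OF ge(1) less_imp_le[OF x(1)]] mult_nonneg_nonneg[OF ge(2) less_imp_le[OF x(2)]]
      mult_nonneg_nonneg[OF ge(3) less_imp_le[OF x(3)]]
      mult_pos_pos[OF _ x(1)] mult_pos_pos[OF _ x(2)] mult_pos_pos[OF _ x(3)]
    by (smt (verit))
  then have "?f x * area2 (X u) (X v) (X w) > 0"
    using barycentric[of "X (c i)" "X (c (Suc i))" x "X u" "X v" "X w"] by simp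
  then show "?f x > 0" using \<tau>pos[OF assms(1)] by (simp add: uvw zero_less_mult_iff)
qed

text \<open>Overlapping open triangles share an open set, hence a generic point, which would have
  depth at least two.\<close>

lemma ttri_disjoint:
  assumes "t1 \<in># \<tau>" "t2 \<in># \<tau>" "t1 \<noteq> t2"
  shows "ttri X t1 \<inter> ttri X t2 = {}"
proof (rule ccontr)
  assume "ttri X t1 \<inter> ttri X t2 \<noteq> {}"
  then obtain x where x: "x \<in> ttri X t1" "x \<in> ttri X t2" "generic x"
    using generic_exists[of "ttri X t1 \<inter> ttri X t2"] by (auto simp: open_Int open_ttri)
  obtain \<sigma> where \<sigma>: "\<tau> = add_mset t1 (add_mset t2 \<sigma>)"
    using assms by (metis insert_DiffM insert_noteq_member)
  have "(\<Sum>t\<in>#\<sigma>. if x \<in> ttri X t then 1 else 0 :: int) \<ge> (\<Sum>t\<in>#\<sigma>. 0)"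
    by (intro sum_mset_mono) auto
  then have "(\<Sum>t\<in>#\<tau>. if x \<in> ttri X t then 1 else 0 :: int) \<ge> 2" using x by (simp add: \<sigma>)
  then show False using depth_one[OF x(3) ttri_inside_hull[OF assms(1) x(1)]] by simp
qed

text \<open>Generic points inside the hull have depth one. The union of the closed triangles is
  closed, so it contains the whole open hull; a boundary point is reached along the segment from an
  inner point.\<close>

lemma covering:
  assumes "\<And>i. i < n \<Longrightarrow> area2 (X (c i)) (X (c (Suc i))) y \<ge> 0"
  shows "\<exists>t\<in>#\<tau>. y \<in> ctri X t"
proof -
  define K where "K = (\<Union>t\<in>set_mset \<tau>. ctri X t)"
  have "closed K" unfolding K_def by (intro closed_UN ballI closed_ctri) simp
  define H where "H = {x. inside_hull x}"
  have "H = (\<Inter>i<n. {x. area2 (X (c i)) (X (c (Suc i))) x > 0})"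
    unfolding H_def inside_hull_def by auto
  then have "open H" by (simp add: open_INT open_area2_pos)
  have HK: "H \<subseteq> K"
  proof (rule ccontr)
    assume "\<not> H \<subseteq> K"
    then obtain x where x: "x \<in> H - K" "generic x"
      using generic_exists[of "H - K"] \<open>open H\<close> \<open>closed K\<close> by (auto simp: open_Diff)
    then have "(\<Sum>t\<in>#\<tau>. if x \<in> ttri X t then 1 else 0 :: int) > 0"
      using depth_one[OF x(2)] by (simp add: H_def)
    then obtain t where "t \<in># \<tau>" "x \<in> ttri X t" using sum_mset_pos_ex by (force split: if_splits)
    then show False using x ttri_subset_ctri[of X t] unfolding K_def by blast
  qed
  obtain t0 where t0: "t0 \<in># \<tau>" using used[OF cI[of 0]] n by auto
  have "ttri X t0 \<noteq> {}"
    using \<tau>pos[OF t0] centroid_in_open_tri by (cases t0) force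
  then obtain z where z: "z \<in> ttri X t0" by auto
  then have zH: "inside_hull z" using ttri_inside_hull t0 by blast
  have "open_segment y z \<subseteq> H"
    using zH assms by (auto simp: H_def inside_hull_def in_segment area2_affine intro!: add_nonneg_pos)
  then have "closure (open_segment y z) \<subseteq> K"
    using HK \<open>closed K\<close> by (intro closure_minimal) auto
  moreover have "z \<in> K" using HK zH by (auto simp: H_def)
  ultimately have "y \<in> K" by (cases "y = z") (auto simp: closure_open_segment)
  then show ?thesis by (auto simp: K_def)
qed

text \<open>By general position a further point would lie in the open triangle. It is a corner of
  another triangle by \<open>used\<close>, and that one would overlap the first.\<close>

lemma empty_triangle:
  assumes "t \<in># \<tau>" "p \<in> I" "X p \<in> ctri X t"
  shows "p \<in> corners t"
proof (rule ccontr)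
  assume np: "p \<notin> corners t"
  obtain u v w where uvw: "t = (u, v, w)" by (cases t) auto
  have I: "u \<in> I" "v \<in> I" "w \<in> I" using \<tau>I[OF assms(1)] by (auto simp: uvw)
  have p: "u \<noteq> v" "v \<noteq> w" "w \<noteq> u" using tarea_pos_proper[OF \<tau>pos[OF assms(1)]] by (auto simp: uvw)
  have "area2 (X u) (X v) (X p) \<noteq> 0" "area2 (X v) (X w) (X p) \<noteq> 0" "area2 (X w) (X u) (X p) \<noteq> 0"
    using gp[of "(u, v, p)"] gp[of "(v, w, p)"] gp[of "(w, u, p)"] I p np assms(2) by (auto simp: uvw)
  then have "X p \<in> ttri X t" using assms(3) by (auto simp: uvw open_tri_def)
  moreover obtain t' where t': "t' \<in># \<tau>" "p \<in> corners t'" using used[OF assms(2)] by auto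
  moreover have "X p \<in> closure (ttri X t')" using corners_in_closure t' \<tau>pos by blast
  ultimately have "ttri X t \<inter> ttri X t' \<noteq> {}"
    using open_Int_closure_eq_empty[OF open_ttri, of X t "ttri X t'"] by blast
  then show False using ttri_disjoint[OF assms(1) t'(1)] t' np by auto
qed

lemma sides_sub: "t \<in># \<tau> \<Longrightarrow> (u, v) \<in> sides t \<Longrightarrow> u \<in> I \<and> v \<in> I \<and> u \<noteq> v"
  using \<tau>I[of t] tarea_pos_proper[OF \<tau>pos[of t]] by (cases t) auto

text \<open>Edges with a common end would be collinear. Otherwise they belong to disjoint open
  triangles, and a separating line would contain the crossing point and with it both edges, against
  general position.\<close>

lemma edges_not_crossing:
  assumes t: "t1 \<in># \<tau>" "(u, v) \<in> sides t1" "t2 \<in># \<tau>" "(u', v') \<in> sides t2" and ne: "{u, v} \<noteq> {u', v'}"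
  shows "open_segment (X u) (X v) \<inter> open_segment (X u') (X v') = {}"
proof (rule ccontr)
  assume "open_segment (X u) (X v) \<inter> open_segment (X u') (X v') \<noteq> {}"
  then obtain y where y: "y \<in> open_segment (X u) (X v)" "y \<in> open_segment (X u') (X v')" by auto
  note s = sides_sub[OF t(1,2)] sides_sub[OF t(3,4)]
  have share: False if "y \<in> open_segment (X a) (X b)" "y \<in> open_segment (X a) (X d)" "a \<in> I" "b \<in> I" "d \<in> I"
    "a \<noteq> b" "a \<noteq> d" "b \<noteq> d" for a b d
    using open_segments_collinear[OF that(1,2)] gp[of "(a, b, d)"] that by auto
  show False
  proof (cases "{u, v} \<inter> {u', v'} = {}")
    case False
    then consider "u = u'" | "u = v'" | "v = u'" | "v = v'" by auto
    then show False
      using share[of u v v'] share[of u v u'] share[of v u v'] share[of v u u'] s ne y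
      by cases (auto simp: open_segment_commute)
  next
    case True
    have "t1 \<noteq> t2"
    proof
      assume "t1 = t2"
      then show False using t(2,4) True by (cases t1) auto
    qed
    then have disj: "ttri X t1 \<inter> ttri X t2 = {}" using ttri_disjoint t by blast
    have ne: "ttri X t \<noteq> {}" if "t \<in># \<tau>" for t
      using \<tau>pos[OF that] centroid_in_open_tri by (cases t) force
    have cx: "convex (ttri X t)" for t by (cases t) (simp add: convex_open_tri)
    obtain a \<beta> where a: "a \<noteq> 0" "\<And>x. x \<in> ttri X t1 \<Longrightarrow> a \<bullet> x \<le> \<beta>" "\<And>x. x \<in> ttri X t2 \<Longrightarrow> a \<bullet> x \<ge> \<beta>"
      using separating_hyperplane_sets[OF cx cx ne[OF t(1)] ne[OF t(3)] disj] by blast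
    have cl: "X u \<in> closure (ttri X t1)" "X v \<in> closure (ttri X t1)"
      "X u' \<in> closure (ttri X t2)" "X v' \<in> closure (ttri X t2)"
      using t \<tau>pos by (auto intro!: corners_in_closure; (cases t1; cases t2; auto)[1])+
    have le: "a \<bullet> X u \<le> \<beta>" "a \<bullet> X v \<le> \<beta>" using inner_le_closure[OF a(2)] cl by auto
    have ge: "(- a) \<bullet> X u' \<le> - \<beta>" "(- a) \<bullet> X v' \<le> - \<beta>"
      using inner_le_closure[of "ttri X t2" "- a" "- \<beta>"] a(3) cl by auto
    obtain r where r: "0 < r" "r < 1" "y = (1 - r) *\<^sub>R X u + r *\<^sub>R X v" using y(1) by (auto simp: in_segment)
    have "a \<bullet> y \<le> \<beta>"
      using le r by (simp add: inner_add_right convex_bound_le)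
    moreover obtain r' where r': "0 < r'" "r' < 1" "y = (1 - r') *\<^sub>R X u' + r' *\<^sub>R X v'" using y(2) by (auto simp: in_segment)
    have "(- a) \<bullet> y \<le> - \<beta>"
      using ge r'(1,2) convex_bound_le[of "(- a) \<bullet> X u'" "- \<beta>" "(- a) \<bullet> X v'" "1 - r'" r'] unfolding r'(3) by (simp add: inner_add_right)
    ultimately have ay: "a \<bullet> y = \<beta>" "(- a) \<bullet> y = - \<beta>" by auto
    have "area2 (X u) (X v) (X u') = 0"
    proof (rule area2_zero_of_inner[OF a(1)])
      show "a \<bullet> X u = \<beta>" "a \<bullet> X v = \<beta>" by (rule segment_level[OF y(1) le ay(1)])+
      show "a \<bullet> X u' = \<beta>" using segment_level(1)[OF y(2) ge ay(2)] by simp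
    qed
    then show False using gp[of "(u, v, u')"] s True by auto
  qed
qed

lemma triangulation: "triangulation_of (X ` I) (edge_set X \<tau>)"
proof -
  have rel: "rel_interior (closed_segment (X u) (X v)) = open_segment (X u) (X v)"
    if "u \<in> I" "v \<in> I" "u \<noteq> v" for u v
    using that inj by (auto simp: rel_interior_closed_segment inj_on_def)
  have "noncrossing_edges (X ` I) (edge_set X \<tau>)"
    unfolding noncrossing_edges_def
  proof
    show "edge_set X \<tau> \<subseteq> point_edges (X ` I)"
    proof
      fix s assume "s \<in> edge_set X \<tau>"
      then obtain u v t where uv: "t \<in># \<tau>" "(u, v) \<in> sides t" "s = closed_segment (X u) (X v)" by (auto simp: edge_set_def)
      have "u \<in> I \<and> v \<in> I \<and> u \<noteq> v" using sides_sub uv by blast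
      moreover then have "X u \<noteq> X v" using inj by (auto simp: inj_on_def)
      ultimately show "s \<in> point_edges (X ` I)" unfolding point_edges_def uv(3) by blast
    qed
    show "pairwise (\<lambda>s t. \<not> crosses s t) (edge_set X \<tau>)"
    proof (rule pairwiseI)
      fix e f assume ef: "e \<in> edge_set X \<tau>" "f \<in> edge_set X \<tau>" "e \<noteq> f"
      obtain u v t where 1: "t \<in># \<tau>" "(u, v) \<in> sides t" "e = closed_segment (X u) (X v)"
        using ef(1) by (auto simp: edge_set_def)
      obtain u' v' t' where 2: "t' \<in># \<tau>" "(u', v') \<in> sides t'" "f = closed_segment (X u') (X v')"
        using ef(2) by (auto simp: edge_set_def)
      have "{u, v} \<noteq> {u', v'}" using ef(3) 1 2 by (auto simp: doubleton_eq_iff closed_segment_commute)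
      then show "\<not> crosses e f"
        using edges_not_crossing[OF 1(1,2) 2(1,2)] rel sides_sub[OF 1(1,2)] sides_sub[OF 2(1,2)]
        by (simp add: crosses_def 1(3) 2(3))
    qed
  qed
  moreover have "T' = edge_set X \<tau>" if T': "noncrossing_edges (X ` I) T'" "edge_set X \<tau> \<subseteq> T'" for T'
  proof (rule ccontr)
    assume "T' \<noteq> edge_set X \<tau>"
    then obtain s where s: "s \<in> T'" "s \<notin> edge_set X \<tau>" using T'(2) by blast
    then obtain p q where pq: "p \<in> I" "q \<in> I" "X p \<noteq> X q" "s = closed_segment (X p) (X q)"
      using T'(1) by (auto simp: noncrossing_edges_def point_edges_def)
    then have "p \<noteq> q" by auto
    \<comment> \<open>A point \<open>y\<close> of the new edge outside \<open>K\<close> is so close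
      to \<open>p\<close> that any triangle containing \<open>y\<close> also contains
      \<open>p\<close>. The edge leaves this empty triangle through the side opposite to
      \<open>p\<close>, which it therefore crosses.\<close>
    define K where "K = (\<Union>t\<in>{t. t \<in># \<tau> \<and> X p \<notin> ctri X t}. ctri X t)"
    have "closed K" unfolding K_def by (intro closed_UN ballI closed_ctri) simp
    moreover have "X p \<notin> K" by (auto simp: K_def)
    moreover have "X p \<in> closure (open_segment (X p) (X q))" using pq by (simp add: closure_open_segment)
    ultimately have "(- K) \<inter> open_segment (X p) (X q) \<noteq> {}"
      using open_Int_closure_eq_empty[of "- K" "open_segment (X p) (X q)"] by (auto simp: open_Compl)
    then obtain y where y: "y \<in> open_segment (X p) (X q)" "y \<notin> K" by auto
    obtain r where r: "0 < r" "r < 1" "y = (1 - r) *\<^sub>R X p + r *\<^sub>R X q" using y(1) by (auto simp: in_segment)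
    have "area2 (X (c i)) (X (c (Suc i))) y \<ge> 0" if "i < n" for i
      using conv_ge[OF that pq(1)] conv_ge[OF that pq(2)] r by (simp add: area2_affine)
    from covering[OF this] obtain t where t: "t \<in># \<tau>" "y \<in> ctri X t" by auto
    then have "X p \<in> ctri X t" using y(2) unfolding K_def by blast
    then have "p \<in> corners t" using empty_triangle t pq by blast
    from corner_first[OF this] obtain v w where vw: "corners t = {p, v, w}" "sides t = {(p, v), (v, w), (w, p)}"
      "\<And>X. tarea X t = tarea X (p, v, w)" "\<And>X. ctri X t = ctri X (p, v, w)" "proper t = proper (p, v, w)" by metis
    have I: "v \<in> I" "w \<in> I" "p \<noteq> v" "v \<noteq> w" "w \<noteq> p"
      using \<tau>I[OF t(1)] tarea_pos_proper[OF \<tau>pos[OF t(1)]] vw by auto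
    have "closed_segment (X p) (X v) \<in> edge_set X \<tau>" "closed_segment (X w) (X p) \<in> edge_set X \<tau>" and vwe: "closed_segment (X v) (X w) \<in> edge_set X \<tau>"
      using t(1) vw(2) unfolding edge_set_def by blast+
    then have qvw: "q \<noteq> v" "q \<noteq> w" using s(2) pq(4) by (auto simp: closed_segment_commute)
    let ?D = "area2 (X p) (X v) (X w)"
    have D: "?D > 0" "area2 (X v) (X w) (X p) = ?D"
      using \<tau>pos[OF t(1)] vw(3)[of X] area2_rotate by auto
    have nz: "area2 (X p) (X v) (X q) \<noteq> 0" "area2 (X w) (X p) (X q) \<noteq> 0"
      using gp[of "(p, v, q)"] gp[of "(w, p, q)"] I pq qvw \<open>p \<noteq> q\<close> by auto
    have "area2 (X p) (X v) y \<ge> 0" "area2 (X w) (X p) y \<ge> 0" using t(2) unfolding vw(4) by auto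
    then have pos: "area2 (X p) (X v) (X q) > 0" "area2 (X w) (X p) (X q) > 0"
      using nz r by (auto simp: area2_affine zero_le_mult_iff)
    have "X q \<notin> ctri X t" using empty_triangle[OF t(1) pq(2)] vw(1) qvw \<open>p \<noteq> q\<close> by auto
    then have neg: "area2 (X v) (X w) (X q) < 0" using pos unfolding vw(4) by auto
    \<comment> \<open>Along the segment from \<open>p\<close> to \<open>q\<close> the area over
      \<open>vw\<close> changes affinely from \<open>?D\<close> to a negative value;
      \<open>l\<close> is the parameter of its zero.\<close>
    define l where "l = ?D / (?D - area2 (X v) (X w) (X q))"
    have l: "0 < l" "l < 1" using D(1) neg by (auto simp: l_def field_simps)
    define z where "z = (1 - l) *\<^sub>R X p + l *\<^sub>R X q"
    have zpq: "z \<in> open_segment (X p) (X q)" using l pq(3) by (auto simp: in_segment z_def)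
    have "l * (?D - area2 (X v) (X w) (X q)) = ?D" using D(1) neg by (simp add: l_def)
    moreover have "area2 (X v) (X w) z = (1 - l) * ?D + l * area2 (X v) (X w) (X q)"
      by (simp add: z_def area2_affine D(2))
    ultimately have z0: "area2 (X v) (X w) z = 0" by (simp add: algebra_simps)
    have zpos: "area2 (X p) (X v) z > 0" "area2 (X w) (X p) z > 0"
      using pos l by (simp_all add: z_def area2_affine)
    have sum: "area2 (X p) (X v) z + area2 (X w) (X p) z = ?D"
      using area2_split[of "X p" "X v" z "X w"] z0 by simp
    have "?D *\<^sub>R z = area2 (X w) (X p) z *\<^sub>R X v + area2 (X p) (X v) z *\<^sub>R X w"
      using barycentric_point[of "X p" "X v" "X w" z] z0 by simp
    then have "(1 / ?D) *\<^sub>R (?D *\<^sub>R z) = (1 / ?D) *\<^sub>R (area2 (X w) (X p) z *\<^sub>R X v + area2 (X p) (X v) z *\<^sub>R X w)" by simp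
    then have "z = (area2 (X w) (X p) z / ?D) *\<^sub>R X v + (area2 (X p) (X v) z / ?D) *\<^sub>R X w"
      using D(1) by (simp add: scaleR_add_right)
    moreover have "area2 (X w) (X p) z / ?D = 1 - area2 (X p) (X v) z / ?D" using sum D(1) by (simp add: field_simps)
    moreover have "0 < area2 (X p) (X v) z / ?D" "area2 (X p) (X v) z / ?D < 1"
      using zpos sum D(1) by (auto simp: field_simps)
    ultimately have "z \<in> open_segment (X v) (X w)"
      using I inj unfolding in_segment by (auto simp: inj_on_def)
    then have "crosses s (closed_segment (X v) (X w))"
      using zpq rel[OF pq(1,2) \<open>p \<noteq> q\<close>] rel[OF I(1,2,4)] by (auto simp: crosses_def pq(4))
    moreover have "s \<noteq> closed_segment (X v) (X w)" using vwe s(2) by auto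
    ultimately show False
      using T' vwe s(1) unfolding noncrossing_edges_def pairwise_def by blast
  qed
  ultimately show ?thesis unfolding triangulation_of_def by blast
qed

end

section \<open>Assigning inner points to hull edges\<close>

text \<open>A bijection of minimal product: after a transposition of two values, all other factors
  agree and cancel because they are positive.\<close>

lemma exchange_optimal_bijection:
  fixes l :: "nat \<Rightarrow> 'a \<Rightarrow> real"
  assumes S: "finite S" "card S = n" and pos: "\<And>i s. i < n \<Longrightarrow> s \<in> S \<Longrightarrow> l i s > 0"
  obtains b where "bij_betw b {..<n} S"
    "\<And>i j. i < n \<Longrightarrow> j < n \<Longrightarrow> i \<noteq> j \<Longrightarrow> l i (b i) * l j (b j) \<le> l i (b j) * l j (b i)"
proof -
  \<comment> \<open>Extensional functions keep the set of candidates finite.\<close>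
  define Bs where "Bs = {b \<in> {..<n} \<rightarrow>\<^sub>E S. bij_betw b {..<n} S}"
  define w where "w b = (\<Prod>k<n. l k (b k))" for b
  have "finite Bs" unfolding Bs_def using S by (simp add: finite_PiE)
  moreover have "Bs \<noteq> {}"
  proof -
    obtain b where b: "bij_betw b {..<n} S" using S ex_bij_betw_nat_finite[of S] by (auto simp: atLeast0LessThan)
    then have "bij_betw (restrict b {..<n}) {..<n} S" by (subst bij_betw_cong[of _ _ b]) auto
    moreover from this have "restrict b {..<n} \<in> {..<n} \<rightarrow>\<^sub>E S" by (auto simp: bij_betw_def)
    ultimately show ?thesis unfolding Bs_def by blast
  qed
  ultimately obtain b where b: "b \<in> Bs" "\<And>b'. b' \<in> Bs \<Longrightarrow> w b \<le> w b'"
    using ex_min_if_finite[of "w ` Bs"] by (auto simp: not_less)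
  have bij: "bij_betw b {..<n} S" using b(1) by (simp add: Bs_def)
  then have bS: "b k \<in> S" if "k < n" for k using that by (auto simp: bij_betw_def)
  show thesis
  proof (rule that[OF bij])
    fix i j assume ij: "i < n" "j < n" "i \<noteq> j"
    define b' where "b' = b \<circ> Transposition.transpose i j"
    have "bij_betw (Transposition.transpose i j) {..<n} {..<n}" using ij by simp
    then have "bij_betw b' {..<n} S" unfolding b'_def using bij bij_betw_trans by blast
    moreover have "b' k = undefined" if "\<not> k < n" for k
      using that ij b(1) by (auto simp: b'_def Bs_def Transposition.transpose_def PiE_iff extensional_def)
    ultimately have "b' \<in> Bs" by (auto simp: Bs_def bij_betw_def PiE_iff extensional_def)
    then have le: "w b \<le> w b'" by (rule b(2))
    define R where "R = (\<Prod>k\<in>{..<n} - {i} - {j}. l k (b k))"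
    have "R > 0" unfolding R_def using pos bS by (intro prod_pos) auto
    have 1: "w b = l i (b i) * (l j (b j) * R)"
      unfolding w_def R_def using ij by (simp add: prod.remove[of "{..<n}" i] prod.remove[of "{..<n} - {i}" j])
    have "(\<Prod>k\<in>{..<n} - {i} - {j}. l k (b' k)) = R"
      unfolding R_def by (intro prod.cong) (auto simp: b'_def Transposition.transpose_def)
    then have 2: "w b' = l i (b j) * (l j (b i) * R)"
      unfolding w_def using ij by (simp add: prod.remove[of "{..<n}" i] prod.remove[of "{..<n} - {i}" j] b'_def)
    have "l i (b i) * l j (b j) * R \<le> l i (b j) * l j (b i) * R" using le 1 2 by (simp add: mult.assoc)
    then show "l i (b i) * l j (b j) \<le> l i (b j) * l j (b i)" using \<open>R > 0\<close> by simp
  qed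
qed

text \<open>\<open>h\<close> is nonnegative at \<open>a'\<close> and \<open>c'\<close>, where
  \<open>l'\<close> vanishes, and at \<open>b'\<close> by the exchange inequality. It is 0 at
  \<open>b\<close>, nonpositive at \<open>a\<close> and \<open>c\<close> and not 0 at both of them,
  hence negative on the open triangle.\<close>

lemma exchange_triangles_disjoint:
  fixes a c b a' c' b' :: complex
  defines "l \<equiv> area2 a c" and "l' \<equiv> area2 a' c'"
  assumes "l b > 0" "l' b > 0" "l b' \<ge> 0" "l a' \<ge> 0" "l c' \<ge> 0" "l' a \<ge> 0" "l' c \<ge> 0" "l' a > 0 \<or> l' c > 0"
    and "l b * l' b' \<le> l b' * l' b"
  shows "convex hull {a', b', c'} \<inter> open_tri a c b = {}"
proof -
  \<comment> \<open>The line \<open>h = 0\<close> through the apex \<open>b\<close> separates the two triangles.\<close>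
  define h where "h x = l x * l' b - l' x * l b" for x
  have aff: "h (s *\<^sub>R x + t *\<^sub>R y) = s * h x + t * h y" if "s + t = 1" for s t x y
    using that by (simp add: h_def l_def l'_def area2_affine algebra_simps)
  have "convex {x. h x \<ge> 0}" unfolding convex_def by (auto simp: aff)
  moreover have "l' a' = 0" "l' c' = 0" by (simp_all add: l'_def)
  then have "{a', b', c'} \<subseteq> {x. h x \<ge> 0}"
    using assms by (auto simp: h_def mult.commute)
  ultimately have "convex hull {a', b', c'} \<subseteq> {x. h x \<ge> 0}" by (rule hull_minimal[rotated])
  moreover have "h x < 0" if x: "x \<in> open_tri a c b" for x
  proof -
    have p: "area2 a c x > 0" "area2 c b x > 0" "area2 b a x > 0" using x by (auto simp: open_tri_def)
    have l0: "l a = 0" "l c = 0" by (simp_all add: l_def)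
    have "l' x * l b = l' a * area2 c b x + l' c * area2 b a x + l' b * area2 a c x"
      unfolding l'_def l_def by (rule barycentric)
    then have "h x * l b = - ((l' a * area2 c b x + l' c * area2 b a x) * l b)"
      by (simp add: h_def l_def algebra_simps)
    moreover have "l' a * area2 c b x + l' c * area2 b a x > 0"
      using assms(8-10) p by (auto intro: add_pos_nonneg add_nonneg_pos)
    ultimately have "h x * l b < 0" using assms(3) by simp
    then show ?thesis using assms(3) by (simp add: mult_less_0_iff)
  qed
  ultimately show ?thesis by force
qed

lemma positive_labelling:
  fixes Q :: "complex set" and q :: "nat \<Rightarrow> complex"
  assumes n: "n \<ge> 3" and Q: "finite Q" "card Q = 2 * n"
    and gp: "\<And>a b c. a \<in> Q \<Longrightarrow> b \<in> Q \<Longrightarrow> c \<in> Q \<Longrightarrow> a \<noteq> b \<Longrightarrow> b \<noteq> c \<Longrightarrow> c \<noteq> a \<Longrightarrow> area2 a b c \<noteq> 0"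
    and q: "inj_on q {..<n}" "q ` {..<n} \<subseteq> Q"
    and conv: "\<And>i x. i < n \<Longrightarrow> x \<in> Q \<Longrightarrow> x \<noteq> q i \<Longrightarrow> x \<noteq> q (Suc i mod n) \<Longrightarrow>
      area2 (q i) (q (Suc i mod n)) x > 0"
  obtains X \<tau> where "bij_betw X {..<2 * n} Q" "\<And>i. i < n \<Longrightarrow> X (2 * i) = q i"
    "\<And>i w. i < n \<Longrightarrow> w < 2 * n \<Longrightarrow> w \<noteq> 2 * i \<Longrightarrow> w \<noteq> nx n i \<Longrightarrow>
      area2 (X (2 * i)) (X (nx n i)) (X w) > 0"
    "\<And>t. corners t \<subseteq> {..<2 * n} \<Longrightarrow> proper t \<Longrightarrow> tarea X t \<noteq> 0"
    "spans \<tau> (carved_boundary n n)"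
    "\<And>t. t \<in># \<tau> \<Longrightarrow> cyc t \<and> corners t \<subseteq> {..<2 * n} \<and> tarea X t > 0"
proof -
  define S where "S = Q - q ` {..<n}"
  \<comment> \<open>Areas replace distances: the lengths of the hull edges enter the product of
    every assignment equally.\<close>
  define l where "l i = area2 (q i) (q (Suc i mod n))" for i
  have mod: "Suc i mod n < n" for i using n by simp
  have S: "finite S" "card S = n"
    using Q q by (simp_all add: S_def card_Diff_subset card_image)
  have lpos: "l i s > 0" if "i < n" "s \<in> S" for i s
  proof -
    have "s \<in> Q" "s \<noteq> q i" "s \<noteq> q (Suc i mod n)" using that mod[of i] by (auto simp: S_def)
    then show ?thesis using conv[OF that(1)] by (simp add: l_def)
  qed
  obtain b where b: "bij_betw b {..<n} S"
    "\<And>i j. i < n \<Longrightarrow> j < n \<Longrightarrow> i \<noteq> j \<Longrightarrow> l i (b i) * l j (b j) \<le> l i (b j) * l j (b i)"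
    using exchange_optimal_bijection[OF S, of l] lpos by metis
  define X where "X m = (if even m then q (m div 2) else b (m div 2))" for m
  have Xe: "X (2 * i) = q i" and Xo: "X (2 * i + 1) = b i" for i by (simp_all add: X_def)
  have Xn: "X (nx n i) = q (Suc i mod n)" for i by (simp add: nx_mod Xe)
  have bS: "b i \<in> S" if "i < n" for i using b(1) that by (auto simp: bij_betw_def)
  have surj: "Q \<subseteq> X ` {..<2 * n}"
  proof
    fix x assume "x \<in> Q"
    then consider i where "i < n" "x = q i" | "x \<in> S" by (auto simp: S_def)
    then show "x \<in> X ` {..<2 * n}"
    proof cases
      case 1
      then show ?thesis by (intro image_eqI[of _ _ "2 * i"]) (auto simp: Xe)
    next
      case 2
      then obtain i where "i < n" "x = b i" using b(1) by (auto simp: bij_betw_def)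
      then show ?thesis by (intro image_eqI[of _ _ "2 * i + 1"]) (auto simp: X_def)
    qed
  qed
  have XQ: "X m \<in> Q" if "m < 2 * n" for m
    using that q(2) bS[of "m div 2"] by (auto simp: X_def S_def less_mult_imp_div_less)
  then have img: "X ` {..<2 * n} = Q" using surj by auto
  then have inj: "inj_on X {..<2 * n}" using Q by (intro eq_card_imp_inj_on) auto
  have bij: "bij_betw X {..<2 * n} Q" using inj img by (simp add: bij_betw_def)
  have gpX: "tarea X t \<noteq> 0" if t: "corners t \<subseteq> {..<2 * n}" "proper t" for t
  proof -
    obtain u v w where uvw: "t = (u, v, w)" by (cases t) auto
    then show ?thesis using t gp[OF XQ XQ XQ, of u v w] inj by (auto simp: inj_on_def)
  qed
  have nxl: "nx n i < 2 * n" for i using mod[of i] by (simp add: nx_mod)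
  have convX: "area2 (X (2 * i)) (X (nx n i)) (X w) > 0"
    if "i < n" "w < 2 * n" "w \<noteq> 2 * i" "w \<noteq> nx n i" for i w
  proof -
    have "X w \<noteq> X (2 * i)" "X w \<noteq> X (nx n i)"
      using inj that nxl[of i] by (auto simp: inj_on_def)
    then show ?thesis using conv[OF that(1) XQ[OF that(2)]] by (simp add: Xe Xn)
  qed
  have lge: "l i (q j) \<ge> 0" if "i < n" "j < n" for i j
    using conv[of i "q j"] q(2) that by (cases "q j = q i \<or> q j = q (Suc i mod n)") (auto simp: l_def)
  have "convex hull {X (2 * j), X (2 * j + 1), X (nx n j)} \<inter>
      open_tri (X (2 * i)) (X (nx n i)) (X (2 * i + 1)) = {}"
    if ij: "i < n" "j < n" "i \<noteq> j" for i j
    unfolding Xe Xo Xn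
  proof (rule exchange_triangles_disjoint)
    show "area2 (q i) (q (Suc i mod n)) (b i) > 0" "area2 (q j) (q (Suc j mod n)) (b i) > 0"
      "area2 (q i) (q (Suc i mod n)) (b j) \<ge> 0"
      using lpos bS ij by (fastforce simp: l_def)+
    show "area2 (q i) (q (Suc i mod n)) (q j) \<ge> 0" "area2 (q i) (q (Suc i mod n)) (q (Suc j mod n)) \<ge> 0"
      "area2 (q j) (q (Suc j mod n)) (q i) \<ge> 0" "area2 (q j) (q (Suc j mod n)) (q (Suc i mod n)) \<ge> 0"
      using lge ij mod by (auto simp: l_def)
    \<comment> \<open>If both areas vanished, hull edges \<open>i\<close> and \<open>j\<close> would
      have the same two ends, which is impossible for \<open>n \<ge> 3\<close>.\<close>
    show "area2 (q j) (q (Suc j mod n)) (q i) > 0 \<or> area2 (q j) (q (Suc j mod n)) (q (Suc i mod n)) > 0"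
    proof (rule ccontr)
      assume no: "\<not> ?thesis"
      have "q k \<in> {q j, q (Suc j mod n)}" if "\<not> area2 (q j) (q (Suc j mod n)) (q k) > 0" "k < n" for k
        using conv[OF ij(2), of "q k"] q(2) that by auto
      then have "q i \<in> {q j, q (Suc j mod n)}" "q (Suc i mod n) \<in> {q j, q (Suc j mod n)}"
        using no ij mod by auto
      then have "i \<in> {j, Suc j mod n}" "Suc i mod n \<in> {j, Suc j mod n}"
        using q(1) ij mod by (auto simp: inj_on_def)
      then have "i = Suc j mod n" "Suc i mod n = j \<or> Suc i mod n = i" using ij by auto
      then show False using ij n by (auto simp: mod_Suc split: if_splits)
    qed
    show "area2 (q i) (q (Suc i mod n)) (b i) * area2 (q j) (q (Suc j mod n)) (b j)
      \<le> area2 (q i) (q (Suc i mod n)) (b j) * area2 (q j) (q (Suc j mod n)) (b i)"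
      using b(2)[OF ij] by (simp add: l_def)
  qed
  from positive_triangulation_exists[OF n convX gpX this]
  obtain \<tau> where "spans \<tau> (carved_boundary n n)"
    "\<forall>t\<in>#\<tau>. cyc t \<and> corners t \<subseteq> {..<2 * n} \<and> tarea X t > 0" by blast
  then show thesis using that[of X \<tau>] bij Xe convX gpX by blast
qed

text \<open>Against the cyclic order of the labels, hence counterclockwise in both point sets: these
  triangles fill the gap between the cut polygon and its hull.\<close>

definition ears :: "nat \<Rightarrow> triple multiset" where
  "ears n = (\<Sum>i<n. {#(2 * i, nx n i, 2 * i + 1)#})"

lemma mem_ears: "t \<in># ears n \<longleftrightarrow> (\<exists>i<n. t = (2 * i, nx n i, 2 * i + 1))"
  by (auto simp: ears_def set_mset_sum)

text \<open>The two inner sides of each ear cancel against the boundary path through its inner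
  point, leaving the hull edge. The indices modulo \<open>n\<close> close the polygon in the form
  required by \<open>positive_chain\<close>.\<close>

lemma spans_with_ears:
  assumes "spans \<tau> (carved_boundary n n)"
  shows "spans (\<tau> + ears n) (\<Sum>i<n. {#(2 * (i mod n), 2 * (Suc i mod n))#})"
  unfolding spans_def
proof (intro allI impI)
  fix \<phi> assume \<phi>: "skew \<phi>"
  have "(\<Sum>t\<in>#\<tau>. circulation \<phi> t) = (\<Sum>e\<in>#carved_boundary n n. \<phi> (fst e) (snd e))"
    using assms \<phi> unfolding spans_def by blast
  also have "\<dots> = (\<Sum>i<n. \<phi> (2 * i) (2 * i + 1) + \<phi> (2 * i + 1) (nx n i))"
    unfolding carved_boundary_def sum_mset_sum_nested[OF finite_lessThan]
    by (intro sum.cong) (auto simp: carved_edges_def)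
  finally have 1: "(\<Sum>t\<in>#\<tau>. circulation \<phi> t) = \<dots>" .
  have 2: "(\<Sum>t\<in>#ears n. circulation \<phi> t) = (\<Sum>i<n. \<phi> (2 * i) (nx n i) + \<phi> (nx n i) (2 * i + 1) + \<phi> (2 * i + 1) (2 * i))"
    by (simp add: ears_def sum_mset_sum_nested)
  have "\<phi> (2 * i) (2 * i + 1) + \<phi> (2 * i + 1) (nx n i) +
      (\<phi> (2 * i) (nx n i) + \<phi> (nx n i) (2 * i + 1) + \<phi> (2 * i + 1) (2 * i)) = \<phi> (2 * i) (nx n i)" for i
  proof -
    have "\<phi> (2 * i + 1) (2 * i) = - \<phi> (2 * i) (2 * i + 1)" "\<phi> (nx n i) (2 * i + 1) = - \<phi> (2 * i + 1) (nx n i)"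
      using \<phi> unfolding skew_def by blast+
    then show ?thesis by simp
  qed
  then have "(\<Sum>t\<in>#\<tau> + ears n. circulation \<phi> t) = (\<Sum>i<n. \<phi> (2 * i) (nx n i))"
    by (simp only: image_mset_union sum_mset.union 1 2 sum.distrib[symmetric])
  also have "\<dots> = (\<Sum>e\<in>#(\<Sum>i<n. {#(2 * (i mod n), 2 * (Suc i mod n))#}). \<phi> (fst e) (snd e))"
    unfolding sum_mset_sum_nested[OF finite_lessThan] by (intro sum.cong) (auto simp: nx_mod)
  finally show "(\<Sum>t\<in>#\<tau> + ears n. circulation \<phi> t) = \<dots>" .
qed

lemma positive_chain_with_ears:
  fixes X :: "nat \<Rightarrow> complex"
  assumes n: "n \<ge> 3"
    and conv: "\<And>i w. i < n \<Longrightarrow> w < 2 * n \<Longrightarrow> w \<noteq> 2 * i \<Longrightarrow> w \<noteq> nx n i \<Longrightarrow>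
      area2 (X (2 * i)) (X (nx n i)) (X w) > 0"
    and gp: "\<And>t. corners t \<subseteq> {..<2 * n} \<Longrightarrow> proper t \<Longrightarrow> tarea X t \<noteq> 0"
    and \<tau>: "spans \<tau> (carved_boundary n n)"
    and pos: "\<And>t. t \<in># \<tau> \<Longrightarrow> corners t \<subseteq> {..<2 * n} \<and> tarea X t > 0"
  shows "positive_chain X (\<lambda>i. 2 * (i mod n)) n (\<tau> + ears n) {..<2 * n}"
proof
  have mod: "i mod n < n" for i using n by simp
  show "n \<ge> 3" "finite {..<2 * n}" by (simp_all add: n)
  show "2 * (i mod n) \<in> {..<2 * n}" for i using mod[of i] by simp
  show "2 * (n mod n) = 2 * (0 mod n)" by simp
  show "inj_on (\<lambda>i. 2 * (i mod n)) {..<n}" by (auto simp: inj_on_def)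
  show "tarea X t \<noteq> 0" if "corners t \<subseteq> {..<2 * n}" "proper t" for t by (rule gp[OF that])
  show "corners t \<subseteq> {..<2 * n}" if "t \<in># \<tau> + ears n" for t
  proof (cases "t \<in># \<tau>")
    case False
    then show ?thesis using that nx_less by (auto simp: mem_ears)
  qed (use pos in blast)
  show "tarea X t > 0" if t: "t \<in># \<tau> + ears n" for t
  proof (cases "t \<in># \<tau>")
    case False
    then obtain i where "i < n" "t = (2 * i, nx n i, 2 * i + 1)" using t by (auto simp: mem_ears)
    then show ?thesis using conv[of i "2 * i + 1"] odd_neq_nx[of i n i] by auto
  qed (use pos in blast)
  show "spans (\<tau> + ears n) (\<Sum>i<n. {#(2 * (i mod n), 2 * (Suc i mod n))#})"
    by (rule spans_with_ears[OF \<tau>])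
  show "area2 (X (2 * (i mod n))) (X (2 * (Suc i mod n))) (X w) > 0"
    if "i < n" "w \<in> {..<2 * n}" "w \<noteq> 2 * (i mod n)" "w \<noteq> 2 * (Suc i mod n)" for i w
    using conv[of i w] that by (simp add: nx_mod)
  \<comment> \<open>The ear over hull edge \<open>p div 2\<close> has \<open>p\<close> as a corner,
    so the ears alone use every label.\<close>
  show "\<exists>t\<in>#\<tau> + ears n. p \<in> corners t" if p: "p \<in> {..<2 * n}" for p
  proof -
    have i: "p div 2 < n" "p = 2 * (p div 2) \<or> p = 2 * (p div 2) + 1" using p by auto
    have "(2 * (p div 2), nx n (p div 2), 2 * (p div 2) + 1) \<in># \<tau> + ears n" using i(1) by (auto simp: mem_ears)
    moreover have "p \<in> corners (2 * (p div 2), nx n (p div 2), 2 * (p div 2) + 1)" using i(2) by auto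
    ultimately show ?thesis by blast
  qed
qed

section \<open>The order type of the double circle\<close>

lemma area2_midpoints:
  "area2 (midpoint p p') (midpoint q q') (midpoint s s') =
    (area2 p q s + area2 p q s' + area2 p q' s + area2 p q' s' +
     area2 p' q s + area2 p' q s' + area2 p' q' s + area2 p' q' s') / 8"
  by (simp add: midpoint_def area2_alt field_simps)

text \<open>The product of sines of half the central angles lets the sign of an inscribed triangle
  be read off factor by factor.\<close>

lemma area2_circle:
  "area2 (z + of_real r * cis \<alpha>) (z + of_real r * cis \<beta>) (z + of_real r * cis \<gamma>) =
    4 * r\<^sup>2 * (sin ((\<beta> - \<alpha>) / 2) * sin ((\<gamma> - \<beta>) / 2) * sin ((\<gamma> - \<alpha>) / 2))"
proof -
  define x y where "x = (\<beta> - \<alpha>) / 2" and "y = (\<gamma> - \<beta>) / 2"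
  have e: "\<gamma> - \<beta> = 2 * y" "\<beta> - \<alpha> = 2 * x" "\<gamma> - \<alpha> = 2 * (x + y)" "(\<gamma> - \<alpha>) / 2 = x + y"
    by (simp_all add: x_def y_def field_simps)
  have "area2 (z + of_real r * cis \<alpha>) (z + of_real r * cis \<beta>) (z + of_real r * cis \<gamma>) =
      r\<^sup>2 * ((cos \<beta> - cos \<alpha>) * (sin \<gamma> - sin \<alpha>) - (sin \<beta> - sin \<alpha>) * (cos \<gamma> - cos \<alpha>))"
    by (simp add: area2_alt power2_eq_square algebra_simps)
  also have "(cos \<beta> - cos \<alpha>) * (sin \<gamma> - sin \<alpha>) - (sin \<beta> - sin \<alpha>) * (cos \<gamma> - cos \<alpha>) =
      sin (\<gamma> - \<beta>) + sin (\<beta> - \<alpha>) - sin (\<gamma> - \<alpha>)"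
    by (simp add: sin_diff algebra_simps)
  also have "\<dots> = sin (2 * y) + sin (2 * x) - sin (2 * (x + y))"
    by (simp only: e)
  also have "\<dots> = 4 * (sin x * sin y * sin (x + y))"
  proof -
    have "cos x * cos x = 1 - sin x * sin x" "cos y * cos y = 1 - sin y * sin y"
      using sin_cos_squared_add[of x] sin_cos_squared_add[of y] by (simp_all add: power2_eq_square)
    then show ?thesis
      unfolding sin_double sin_add cos_add by algebra
  qed
  finally show ?thesis
    by (simp only: x_def[symmetric] y_def[symmetric] e(4) mult.assoc mult.left_commute[of _ 4])
qed

lemma sorted_rotation:
  assumes "cyc t"
  obtains a b c where "a < b" "b < c" "corners t = {a, b, c}" "\<And>X. tarea X t = area2 (X a) (X b) (X c)"
proof -
  obtain u v w where t: "t = (u, v, w)" by (cases t) auto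
  from assms consider "u < v" "v < w" | "v < w" "w < u" | "w < u" "u < v" by (auto simp: t)
  then show thesis
  proof cases
    case 1 then show ?thesis by (rule that[of u v w]) (auto simp: t)
  next
    case 2 then show ?thesis by (rule that[of v w u]) (auto simp: t intro: area2_rotate[symmetric])
  next
    case 3 then show ?thesis by (rule that[of w u v]) (auto simp: t intro: area2_rotate)
  qed
qed

text \<open>A condition on the set of labels. A \<open>cyc\<close> triple satisfying it is, up to
  rotation, the reverse of a member of \<open>ears n\<close>.\<close>

definition ear :: "nat \<Rightarrow> triple \<Rightarrow> bool" where
  "ear n t \<longleftrightarrow> (\<exists>i<n. corners t = {2 * i, 2 * i + 1, nx n i})"

text \<open>Label \<open>m\<close> will stand for the midpoint of the polygon vertices
  \<open>m div 2\<close> and \<open>Suc m div 2\<close>, which are equal for even \<open>m\<close>.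
  A triple that is no ear admits a choice of three distinct polygon vertices, one per label; index
  \<open>n\<close> is vertex 0 again.\<close>

lemma not_ear_choice:
  assumes n: "n \<ge> 3" and abc: "a < b" "b < c" "c < 2 * n" and ne: "\<not> (\<exists>i<n. {a, b, c} = {2 * i, 2 * i + 1, nx n i})"
  shows "\<exists>i\<in>{a div 2, Suc a div 2}. \<exists>j\<in>{b div 2, Suc b div 2}. \<exists>k\<in>{c div 2, Suc c div 2}.
    i < j \<and> j < k \<and> k < i + n"
proof -
  have 1: "\<not> (even a \<and> b = a + 1 \<and> c = a + 2)"
  proof
    assume *: "even a \<and> b = a + 1 \<and> c = a + 2"
    then obtain i where i: "a = 2 * i" by blast
    then have "nx n i = 2 * i + 2" "i < n" using abc * by (auto simp: nx_def)
    then show False using ne * i by auto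
  qed
  have 2: "\<not> (a = 0 \<and> b = 2 * n - 2 \<and> c = 2 * n - 1)"
  proof
    assume *: "a = 0 \<and> b = 2 * n - 2 \<and> c = 2 * n - 1"
    then have "nx n (n - 1) = 0" "n - 1 < n" using abc by (auto intro: nx_last)
    moreover from this have "{a, b, c} = {2 * (n - 1), 2 * (n - 1) + 1, nx n (n - 1)}"
      using * abc by auto
    ultimately show False using ne by blast
  qed
  show ?thesis
  proof (cases "Suc c div 2 < a div 2 + n")
    case True
    \<comment> \<open>The outer indices are taken as far apart as possible; only the middle one has
      to be found.\<close>
    have "a div 2 < b div 2 \<and> b div 2 < Suc c div 2 \<or> a div 2 < Suc b div 2 \<and> Suc b div 2 < Suc c div 2"
    proof (cases "a div 2 < b div 2")
      case True
      moreover have "b div 2 < Suc c div 2" using abc(2) by linarith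
      ultimately show ?thesis by blast
    next
      case False
      then have ab: "a = 2 * (a div 2)" "b = a + 1" using abc(1) by linarith+
      then have "even a" by (metis dvd_triv_left)
      then have "c \<noteq> a + 2" using 1 ab(2) by blast
      then have "c \<ge> a + 3" using ab(2) abc(2) by linarith
      then show ?thesis using ab by linarith
    qed
    with True show ?thesis by blast
  next
    case False
    \<comment> \<open>The extreme outer indices are now 0 and \<open>n\<close>, the same vertex, so
      one of them has to move inwards.\<close>
    then have c: "c = 2 * n - 1" "c div 2 = n - 1" "Suc c div 2 = n" and a: "a = 0 \<or> a = 1"
      using abc by linarith+
    consider "b < 2 * n - 2" | "b = 2 * n - 2" using abc c by linarith
    then show ?thesis
    proof cases
      case 1
      then have "0 < b div 2 \<and> b div 2 < n - 1 \<or> 0 < Suc b div 2 \<and> Suc b div 2 < n - 1"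
        using n abc by linarith
      then obtain j where j: "j \<in> {b div 2, Suc b div 2}" "0 < j" "j < n - 1" by blast
      have "a div 2 = 0" "n - 1 < 0 + n" using a n by auto
      then show ?thesis using c(2) j(2,3)
        by (intro bexI[of _ "a div 2", OF bexI[of _ j, OF bexI[of _ "c div 2"]]] j(1)) auto
    next
      case b: 2
      then have "a = 1" using a 2 c by blast
      then have "Suc a div 2 = 1" by simp
      moreover have "b div 2 = n - 1" using b by linarith
      moreover have "1 < n - 1" "n - 1 < n" "n < 1 + n" using n by linarith+
      ultimately show ?thesis using c(3)
        by (intro bexI[of _ "Suc a div 2", OF bexI[of _ "b div 2", OF bexI[of _ "Suc c div 2"]]]) auto
    qed
  qed
qed

lemma eight_terms_pos:
  fixes f :: "'a \<Rightarrow> 'a \<Rightarrow> 'a \<Rightarrow> real"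
  assumes ge: "\<And>i j k. i \<in> {i0, i1} \<Longrightarrow> j \<in> {j0, j1} \<Longrightarrow> k \<in> {k0, k1} \<Longrightarrow> f i j k \<ge> 0"
    and ijk: "i \<in> {i0, i1}" "j \<in> {j0, j1}" "k \<in> {k0, k1}" "f i j k > 0"
  shows "f i0 j0 k0 + f i0 j0 k1 + f i0 j1 k0 + f i0 j1 k1 + f i1 j0 k0 + f i1 j0 k1 + f i1 j1 k0 + f i1 j1 k1 > 0"
proof -
  have "f i0 j0 k0 \<ge> 0" "f i0 j0 k1 \<ge> 0" "f i0 j1 k0 \<ge> 0" "f i0 j1 k1 \<ge> 0"
    "f i1 j0 k0 \<ge> 0" "f i1 j0 k1 \<ge> 0" "f i1 j1 k0 \<ge> 0" "f i1 j1 k1 \<ge> 0"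
    by (rule ge; simp)+
  then show ?thesis using ijk by (elim insertE emptyE; hypsubst; linarith)
qed

text \<open>The limit \<open>\<epsilon> \<rightarrow> 0\<close> of the double circle, where the inner points are midpoints and exactly the
  ears degenerate. The area is multi-affine, hence an average over triples of polygon vertices.\<close>

lemma skipped_midpoints_pos:
  fixes P :: "nat \<Rightarrow> complex"
  defines "L m \<equiv> midpoint (P (m div 2)) (P (Suc m div 2))"
  assumes n: "n \<ge> 3" and P: "\<And>i j k. i \<le> j \<Longrightarrow> j \<le> k \<Longrightarrow> k \<le> i + n \<Longrightarrow> area2 (P i) (P j) (P k) \<ge> 0"
      "\<And>i j k. i < j \<Longrightarrow> j < k \<Longrightarrow> k < i + n \<Longrightarrow> area2 (P i) (P j) (P k) > 0"
    and t: "cyc t" "corners t \<subseteq> {..<2 * n}" "\<not> ear n t"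
  shows "tarea L t > 0"
proof -
  obtain a b c where abc: "a < b" "b < c" "corners t = {a, b, c}" "\<And>X. tarea X t = area2 (X a) (X b) (X c)"
    using sorted_rotation[OF t(1)] by metis
  have c: "c < 2 * n" using abc t(2) by auto
  obtain i j k where ijk: "i \<in> {a div 2, Suc a div 2}" "j \<in> {b div 2, Suc b div 2}" "k \<in> {c div 2, Suc c div 2}"
    "i < j" "j < k" "k < i + n"
    using not_ear_choice[OF n abc(1,2) c] t(3) abc(3) unfolding ear_def by metis
  define f where "f i j k = area2 (P i) (P j) (P k)" for i j k
  have ge: "f i j k \<ge> 0" if "i \<in> {a div 2, Suc a div 2}" "j \<in> {b div 2, Suc b div 2}" "k \<in> {c div 2, Suc c div 2}" for i j k
    using that abc(1,2) c unfolding f_def by (intro P) auto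
  have gt: "f i j k > 0" unfolding f_def using P(2) ijk by blast
  have "tarea L t = (f (a div 2) (b div 2) (c div 2) + f (a div 2) (b div 2) (Suc c div 2) +
      f (a div 2) (Suc b div 2) (c div 2) + f (a div 2) (Suc b div 2) (Suc c div 2) +
      f (Suc a div 2) (b div 2) (c div 2) + f (Suc a div 2) (b div 2) (Suc c div 2) +
      f (Suc a div 2) (Suc b div 2) (c div 2) + f (Suc a div 2) (Suc b div 2) (Suc c div 2)) / 8"
    unfolding abc(4) L_def f_def by (rule area2_midpoints)
  also have "\<dots> > 0"
    using eight_terms_pos[where f = f, OF ge ijk(1-3) gt] by simp
  finally show ?thesis .
qed

lemma cyc_same_corners:
  assumes "cyc t" "cyc t'" "corners t = corners t'"
  shows "tarea X t = tarea X t'"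
proof -
  obtain a b c where 1: "a < b" "b < c" "corners t = {a, b, c}" "\<And>X. tarea X t = area2 (X a) (X b) (X c)"
    using sorted_rotation[OF assms(1)] by metis
  obtain a' b' c' where 2: "a' < b'" "b' < c'" "corners t' = {a', b', c'}" "\<And>X. tarea X t' = area2 (X a') (X b') (X c')"
    using sorted_rotation[OF assms(2)] by metis
  have "sorted_list_of_set {a, b, c} = sorted_list_of_set {a', b', c'}" using assms(3) 1(3) 2(3) by simp
  then have "[a, b, c] = [a', b', c']" using 1(1,2) 2(1,2) by simp
  then show ?thesis using 1(4) 2(4) by simp
qed

lemma ear_area:
  assumes "n \<ge> 3" "cyc t" "ear n t"
  obtains i where "i < n" "\<And>X. tarea X t = - area2 (X (2 * i)) (X (nx n i)) (X (2 * i + 1))"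
proof -
  obtain i where i: "i < n" "corners t = {2 * i, 2 * i + 1, nx n i}" using assms(3) by (auto simp: ear_def)
  have "cyc (2 * i, 2 * i + 1, nx n i)" using i(1) assms(1) by (cases rule: nx_cases) auto
  then have "tarea X t = - area2 (X (2 * i)) (X (nx n i)) (X (2 * i + 1))" for X
    using cyc_same_corners[OF assms(2), of "(2 * i, 2 * i + 1, nx n i)" X] i(2)
      area2_swap23[of "X (2 * i)" "X (2 * i + 1)" "X (nx n i)"] by simp
  then show thesis using that i(1) by blast
qed

text \<open>The segment lies on the line where the inner product with the unit normal
  \<open>u\<close>, measured from \<open>z\<close>, is \<rho>, and the point is at level
  \<open>(1 - s) * \<rho>\<close>. The midpoint attains the distance, and Cauchy-Schwarz bounds it
  from below.\<close>

lemma infdist_midpoint_segment: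
  fixes z p q u :: complex
  assumes u: "norm u = 1" "midpoint p q - z = \<rho> *\<^sub>R u" "(p - z) \<bullet> u = \<rho>" "(q - z) \<bullet> u = \<rho>"
    and s: "0 \<le> s" and \<rho>: "\<rho> > 0"
  shows "infdist ((1 - s) *\<^sub>R midpoint p q + s *\<^sub>R z) (closed_segment p q) = s * \<rho>"
proof -
  define a where "a = (1 - s) *\<^sub>R midpoint p q + s *\<^sub>R z"
  have az: "a - z = (1 - s) *\<^sub>R (midpoint p q - z)" by (simp add: a_def algebra_simps)
  then have au: "(a - z) \<bullet> u = (1 - s) * \<rho>" using u(1) by (simp add: u(2) dot_square_norm)
  have "midpoint p q - a = s *\<^sub>R (midpoint p q - z)" by (simp add: a_def algebra_simps)
  then have "dist a (midpoint p q) = s * \<rho>"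
    using u s \<rho> by (simp add: dist_norm norm_minus_commute[of a])
  moreover have "midpoint p q \<in> closed_segment p q" by simp
  ultimately have "infdist a (closed_segment p q) \<le> s * \<rho>" by (metis infdist_le)
  moreover have "s * \<rho> \<le> dist a y" if "y \<in> closed_segment p q" for y
  proof -
    obtain t where t: "y = (1 - t) *\<^sub>R p + t *\<^sub>R q" using \<open>y \<in> closed_segment p q\<close> by (auto simp: in_segment)
    have "y - z = (1 - t) *\<^sub>R (p - z) + t *\<^sub>R (q - z)" by (simp add: t algebra_simps)
    then have "(y - z) \<bullet> u = (1 - t) * \<rho> + t * \<rho>"
      by (simp only: inner_add_left inner_scaleR_left u(3,4))
    then have "(y - z) \<bullet> u = \<rho>" by (simp add: algebra_simps)
    then have "(y - a) \<bullet> u = s * \<rho>" using au by (simp add: inner_diff_left algebra_simps)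
    moreover have "(y - a) \<bullet> u \<le> norm (y - a) * norm u" by (rule norm_cauchy_schwarz)
    ultimately show ?thesis using u(1) by (simp add: dist_norm norm_minus_commute)
  qed
  then have "s * \<rho> \<le> infdist a (closed_segment p q)"
    unfolding infdist_def by (auto intro!: cINF_greatest)
  ultimately show ?thesis by (simp add: a_def)
qed

section \<open>The regular polygon and its inner points\<close>

locale regular_polygon =
  fixes n :: nat and z :: complex and r \<theta> :: real and P :: "nat \<Rightarrow> complex"
  assumes n: "n \<ge> 3" and r: "r > 0"
    and P: "\<And>i. P i = z + of_real r * cis (\<theta> + 2 * pi * real i / real n)"
begin

lemma P_periodic: "P (i + n) = P i"
proof -
  have "\<theta> + 2 * pi * real (i + n) / real n = \<theta> + 2 * pi * real i / real n + 2 * pi"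
    using n by (simp add: field_simps)
  moreover have "cis (x + 2 * pi) = cis x" for x by (simp add: cis.ctr)
  ultimately show ?thesis by (simp only: P)
qed

lemma P_nx:
  assumes "i < n"
  shows "P (nx n i div 2) = P (Suc i)"
  using P_periodic[of 0] by (cases rule: nx_cases[OF assms]) auto

lemma area2_P:
  "area2 (P i) (P j) (P k) = 4 * r\<^sup>2 * (sin (pi * (real j - real i) / real n) *
    sin (pi * (real k - real j) / real n) * sin (pi * (real k - real i) / real n))"
proof -
  have "(\<theta> + 2 * pi * real b / real n - (\<theta> + 2 * pi * real a / real n)) / 2 = pi * (real b - real a) / real n" for a b
    using n by (simp add: field_simps)
  then show ?thesis unfolding P area2_circle by simp
qed

lemma sin_step_nonneg:
  assumes "a \<le> b" "b \<le> a + n"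
  shows "sin (pi * (real b - real a) / real n) \<ge> 0"
proof -
  define x where "x = (real b - real a) / real n"
  have "0 \<le> x" "x \<le> 1" unfolding x_def using assms n by simp_all
  then have "0 \<le> pi * x" "pi * x \<le> pi * 1" by (simp, intro mult_left_mono) auto
  then show ?thesis using sin_ge_zero[of "pi * x"] by (simp add: x_def)
qed

lemma sin_step_pos:
  assumes "a < b" "b < a + n"
  shows "sin (pi * (real b - real a) / real n) > 0"
proof -
  define x where "x = (real b - real a) / real n"
  have "0 < x" "x < 1" unfolding x_def using assms n by simp_all
  then have "0 < pi * x" "pi * x < pi * 1" by (simp, intro mult_strict_left_mono) auto
  then show ?thesis using sin_gt_zero[of "pi * x"] by (simp add: x_def)
qed

lemma area2_P_nonneg: "i \<le> j \<Longrightarrow> j \<le> k \<Longrightarrow> k \<le> i + n \<Longrightarrow> area2 (P i) (P j) (P k) \<ge> 0"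
  unfolding area2_P by (intro mult_nonneg_nonneg sin_step_nonneg) auto

lemma area2_P_pos: "i < j \<Longrightarrow> j < k \<Longrightarrow> k < i + n \<Longrightarrow> area2 (P i) (P j) (P k) > 0"
  unfolding area2_P using r by (intro mult_pos_pos sin_step_pos) auto

lemma area2_P_center: "area2 (P i) (P (Suc i)) z > 0"
proof -
  have "area2 (z + of_real r * cis a) (z + of_real r * cis b) z = r\<^sup>2 * sin (b - a)" for a b
    by (simp add: area2_alt sin_diff power2_eq_square algebra_simps)
  then have "area2 (P i) (P (Suc i)) z = r\<^sup>2 * sin ((\<theta> + 2 * pi * real (Suc i) / real n) - (\<theta> + 2 * pi * real i / real n))"
    unfolding P by blast
  also have "(\<theta> + 2 * pi * real (Suc i) / real n) - (\<theta> + 2 * pi * real i / real n) = 2 * pi / real n"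
    using n by (simp add: field_simps)
  finally have "area2 (P i) (P (Suc i)) z = r\<^sup>2 * sin (2 * pi / real n)" .
  moreover have "sin (2 * pi / real n) > 0" using n by (intro sin_gt_zero) (auto simp: field_simps)
  ultimately show ?thesis using r by simp
qed

text \<open>The apothem, that is, the distance from the centre to the sides.\<close>

definition \<rho> where "\<rho> = r * cos (pi / real n)"

lemma \<rho>_pos: "\<rho> > 0"
proof -
  have "cos (pi / real n) > 0" using n by (intro cos_gt_zero_pi) (auto simp: field_simps intro: less_le_trans[of _ 0])
  then show ?thesis using r by (simp add: \<rho>_def)
qed

text \<open>Parametrised by the fraction of the way from the midpoint to the centre, so that the
  limit \<open>s = 0\<close> is included.\<close>

definition shifted :: "real \<Rightarrow> nat \<Rightarrow> complex" where
  "shifted s i = (1 - s) *\<^sub>R midpoint (P i) (P (Suc i)) + s *\<^sub>R z"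

lemma inner_points_shifted:
  assumes "0 < s" "s \<le> 1"
  shows "inner_points n z P (s * \<rho>) (shifted s)"
  unfolding inner_points_def
proof (intro allI impI conjI)
  fix i
  show "shifted s i \<in> closed_segment z (midpoint (P i) (P (Suc i)))"
    unfolding in_segment shifted_def using assms by (intro exI[of _ "1 - s"]) auto
  \<comment> \<open>\<gamma> is the direction from the centre to the midpoint of the side, and
    \<delta> is half the angle under which the side is seen.\<close>
  define \<gamma> where "\<gamma> = \<theta> + (2 * real i + 1) * pi / real n"
  define \<delta> where "\<delta> = pi / real n"
  have a: "P i - z = of_real r * cis (\<gamma> - \<delta>)" "P (Suc i) - z = of_real r * cis (\<gamma> + \<delta>)"
    unfolding P \<gamma>_def \<delta>_def using n by (auto intro!: arg_cong[where f = cis] simp: field_simps)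
  show "infdist (shifted s i) (closed_segment (P i) (P (Suc i))) = s * \<rho>"
    unfolding shifted_def
  proof (rule infdist_midpoint_segment[where u = "cis \<gamma>"])
    have "midpoint (P i) (P (Suc i)) - z = (1 / 2) *\<^sub>R ((P i - z) + (P (Suc i) - z))"
      by (simp add: midpoint_def complex_eq_iff)
    also have "\<dots> = \<rho> *\<^sub>R cis \<gamma>"
      unfolding a
      by (simp add: complex_eq_iff \<rho>_def \<delta>_def[symmetric] cos_add cos_diff sin_add sin_diff algebra_simps)
    finally show "midpoint (P i) (P (Suc i)) - z = \<rho> *\<^sub>R cis \<gamma>" .
    have "cos \<gamma> * cos \<gamma> + sin \<gamma> * sin \<gamma> = 1"
      using sin_cos_squared_add[of \<gamma>] by (simp add: power2_eq_square)
    moreover have "(of_real r * cis x) \<bullet> cis y = r * cos (x - y)" for x y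
      by (simp add: inner_complex_def cos_diff algebra_simps)
    ultimately show "(P i - z) \<bullet> cis \<gamma> = \<rho>" "(P (Suc i) - z) \<bullet> cis \<gamma> = \<rho>"
      unfolding a by (simp_all add: \<rho>_def \<delta>_def)
  qed (use assms \<rho>_pos in auto)
qed

text \<open>The roots of unity sum to 0, so the centre is the average of the vertices.\<close>

lemma center_in_hull: "z \<in> convex hull (P ` {..<n})"
proof -
  have bij: "bij_betw (\<lambda>k. cis (2 * pi * real k / real n)) {..<n} {w. w ^ n = 1}"
    using n by (intro Complex.bij_betw_roots_unity) simp
  have "(\<Sum>i<n. cis (2 * pi * real i / real n)) = \<Sum>{w. w ^ n = 1}"
    by (rule sum.reindex_bij_betw[OF bij])
  also have "\<dots> = 0" using n by (intro sum_roots_unity) auto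
  finally have "(\<Sum>i<n. cis (2 * pi * real i / real n)) = 0" .
  then have 0: "(\<Sum>i<n. of_real r * cis (\<theta> + 2 * pi * real i / real n)) = 0"
    by (simp add: cis_mult[symmetric] sum_distrib_left[symmetric])
  have "(\<Sum>i<n. (1 / real n) *\<^sub>R P i) \<in> convex hull (P ` {..<n})"
    using n by (intro convex_sum) (auto intro: hull_inc)
  also have "(\<Sum>i<n. (1 / real n) *\<^sub>R P i) = (1 / real n) *\<^sub>R (\<Sum>i<n. P i)"
    by (simp add: scaleR_sum_right)
  also have "(\<Sum>i<n. P i) = real n *\<^sub>R z" unfolding P sum.distrib 0 by (simp add: scaleR_conv_of_real)
  finally show ?thesis using n by simp
qed

lemma area_shifted_pos:
  assumes "s > 0"
  shows "area2 (P i) (P (Suc i)) (shifted s i) > 0"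
proof -
  have "midpoint (P i) (P (Suc i)) = (1 / 2) *\<^sub>R P i + (1 / 2) *\<^sub>R P (Suc i)"
    by (simp add: midpoint_def scaleR_add_right)
  then have "area2 (P i) (P (Suc i)) (midpoint (P i) (P (Suc i))) = 0"
    using area2_affine[of "1/2" "1/2" "P i" "P (Suc i)" "P i" "P (Suc i)"] by simp
  then show ?thesis unfolding shifted_def using area2_P_center[of i] assms by (simp add: area2_affine)
qed

end

text \<open>The order type is constant down to distance 0, so signs may be read off at arbitrarily
  small \<open>s\<close>. Triples that are no ears inherit theirs from \<open>s = 0\<close> by
  continuity; ears degenerate there and are computed directly.\<close>

lemma double_circle_configuration:
  assumes n: "n \<ge> 3" and D: "double_circle n D"
  obtains Y where "bij_betw Y {..<2 * n} D"
    "\<And>i w. i < n \<Longrightarrow> w < 2 * n \<Longrightarrow> w \<noteq> 2 * i \<Longrightarrow> w \<noteq> nx n i \<Longrightarrow> area2 (Y (2 * i)) (Y (nx n i)) (Y w) > 0"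
    "\<And>t. cyc t \<Longrightarrow> corners t \<subseteq> {..<2 * n} \<Longrightarrow> \<not> ear n t \<Longrightarrow> tarea Y t > 0"
    "\<And>t. corners t \<subseteq> {..<2 * n} \<Longrightarrow> proper t \<Longrightarrow> tarea Y t \<noteq> 0"
    "\<And>i. i < n \<Longrightarrow> Y (2 * i + 1) \<in> convex hull ((\<lambda>i. Y (2 * i)) ` {..<n})"
proof -
  obtain z P \<epsilon> A where reg: "regular_ngon n z P" and eps: "\<epsilon> > 0" and inner: "inner_points n z P \<epsilon> A"
    and ot: "\<And>\<epsilon>' A'. 0 < \<epsilon>' \<Longrightarrow> \<epsilon>' < \<epsilon> \<Longrightarrow> inner_points n z P \<epsilon>' A' \<Longrightarrow>
        same_order_type {..<2 * n} (double_family n P A) (double_family n P A')"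
    and Deq: "D = P ` {..<n} \<union> A ` {..<n}"
    using D unfolding double_circle_def by blast
  obtain r \<theta> where r: "r > 0" "\<And>i. P i = z + of_real r * cis (\<theta> + 2 * pi * real i / real n)"
    using reg unfolding regular_ngon_def by blast
  interpret regular_polygon n z r \<theta> P by unfold_locales (use n r in auto)
  \<comment> \<open>Translates the interleaved labels into the numbering of
    \<open>double_family\<close>, which lists all hull vertices first.\<close>
  define \<kappa> where "\<kappa> m = (if even m then m div 2 else n + m div 2)" for m :: nat
  have \<kappa>: "\<kappa> m < 2 * n" if "m < 2 * n" for m using that by (auto simp: \<kappa>_def)
  define Y where "Y m = (if even m then P (m div 2) else A (m div 2))" for m
  define Ys where "Ys s m = (if even m then P (m div 2) else shifted s (m div 2))" for s m
  have fam: "double_family n P B (\<kappa> m) = (if even m then P (m div 2) else B (m div 2))" if "m < 2 * n" for B m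
    using that by (auto simp: double_family_def \<kappa>_def)
  have sgn_eq: "sgn (tarea Y t) = sgn (tarea (Ys s) t)"
    if t: "corners t \<subseteq> {..<2 * n}" and s: "0 < s" "s \<le> 1" "s * \<rho> < \<epsilon>" for t s
  proof -
    obtain a b c where abc: "t = (a, b, c)" by (cases t) auto
    have m: "a < 2 * n" "b < 2 * n" "c < 2 * n" using t by (auto simp: abc)
    have "same_order_type {..<2 * n} (double_family n P A) (double_family n P (shifted s))"
      using s \<rho>_pos by (intro ot[OF _ _ inner_points_shifted]) auto
    then have "orientation (double_family n P A (\<kappa> a)) (double_family n P A (\<kappa> b)) (double_family n P A (\<kappa> c)) =
       orientation (double_family n P (shifted s) (\<kappa> a)) (double_family n P (shifted s) (\<kappa> b)) (double_family n P (shifted s) (\<kappa> c))"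
      using \<kappa> m unfolding same_order_type_def by blast
    then show ?thesis unfolding fam[OF m(1)] fam[OF m(2)] fam[OF m(3)] sgn_area2 abc by (simp add: Y_def Ys_def)
  qed
  \<comment> \<open>The bound 1 keeps the points within the segments to the centre; the factor 2
    makes \<open>s * \<rho>\<close> strictly smaller than \<epsilon>.\<close>
  define s0 where "s0 = min 1 (\<epsilon> / (2 * \<rho>))"
  have s0: "s0 > 0" using eps \<rho>_pos by (simp add: s0_def)
  have s0': "s \<le> 1" "s * \<rho> < \<epsilon>" if "0 < s" "s \<le> s0" for s
  proof -
    show "s \<le> 1" using that by (simp add: s0_def)
    have "s \<le> \<epsilon> / (2 * \<rho>)" using that by (simp add: s0_def)
    then have "s * \<rho> \<le> \<epsilon> / 2" using \<rho>_pos by (simp add: field_simps)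
    then show "s * \<rho> < \<epsilon>" using eps by simp
  qed
  have pos: "tarea Y t > 0" if t: "cyc t" "corners t \<subseteq> {..<2 * n}" "\<not> ear n t" for t
  proof -
    have "Ys 0 = (\<lambda>m. midpoint (P (m div 2)) (P (Suc m div 2)))"
      by (auto simp: Ys_def shifted_def elim!: oddE)
    then have 0: "tarea (Ys 0) t > 0"
      using skipped_midpoints_pos[of n P, OF n area2_P_nonneg area2_P_pos t] by simp
    have "continuous_on UNIV (\<lambda>s. Ys s m)" for m
      by (cases "even m") (auto simp: Ys_def shifted_def intro!: continuous_intros)
    then have "continuous_on UNIV (\<lambda>s. tarea (Ys s) t)"
      by (cases t) (simp add: continuous_on_area2)
    then have "open {s. tarea (Ys s) t > 0}" by (intro open_Collect_less continuous_intros)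
    then obtain d where d: "d > 0" "\<And>s. dist s 0 < d \<Longrightarrow> tarea (Ys s) t > 0"
      using 0 unfolding open_dist by auto
    define s where "s = min (d / 2) s0"
    have s: "0 < s" "s \<le> s0" "s < d" using d(1) s0 by (auto simp: s_def)
    then have "tarea (Ys s) t > 0" using d(2)[of s] by simp
    then show ?thesis using sgn_eq[OF t(2) s(1) s0'[OF s(1,2)]] by (metis sgn_greater)
  qed
  have earpos: "area2 (Y (2 * i)) (Y (nx n i)) (Y (2 * i + 1)) > 0" if i: "i < n" for i
  proof -
    have nxe: "even (nx n i)" using i by (cases rule: nx_cases) auto
    have "sgn (tarea Y (2 * i, nx n i, 2 * i + 1)) = sgn (tarea (Ys s0) (2 * i, nx n i, 2 * i + 1))"
      using i nx_less[OF i] s0 s0'[OF s0] by (intro sgn_eq) auto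
    moreover have "tarea (Ys s0) (2 * i, nx n i, 2 * i + 1) > 0"
      using area_shifted_pos[OF s0, of i] nxe P_nx[OF i] by (simp add: Ys_def)
    ultimately show ?thesis by (simp add: sgn_if split: if_splits)
  qed
  have gp: "tarea Y t \<noteq> 0" if t: "corners t \<subseteq> {..<2 * n}" "proper t" for t
  proof -
    have *: "tarea Y t \<noteq> 0" if t: "cyc t" "corners t \<subseteq> {..<2 * n}" for t
    proof (cases "ear n t")
      case True
      then show ?thesis using ear_area[OF n \<open>cyc t\<close> True] earpos by (metis less_irrefl neg_equal_0_iff_equal)
    next
      case False
      then show ?thesis using pos[OF t] by simp
    qed
    obtain a b c where abc: "t = (a, b, c)" by (cases t) auto
    have "cyc (a, b, c) \<or> cyc (a, c, b)" using t(2) by (auto simp: abc)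
    then show ?thesis
      using *[of "(a, b, c)"] *[of "(a, c, b)"] t(1) area2_swap23[of "Y a" "Y b" "Y c"] by (auto simp: abc)
  qed
  have "area2 (Y (2 * i)) (Y (nx n i)) (Y w) > 0"
    if w: "i < n" "w < 2 * n" "w \<noteq> 2 * i" "w \<noteq> nx n i" for i w
  proof (cases "w = 2 * i + 1")
    case False
    have "cyc (2 * i, nx n i, w)" using w False by (cases rule: nx_cases[OF w(1)]) auto
    moreover have "\<not> ear n (2 * i, nx n i, w)"
    proof
      assume "ear n (2 * i, nx n i, w)"
      then obtain j where j: "j < n" "{2 * i, nx n i, w} = {2 * j, 2 * j + 1, nx n j}" by (auto simp: ear_def)
      have wj: "w = 2 * j + 1"
      proof -
        have "2 * j + 1 \<in> {2 * i, nx n i, w}" using j(2) by blast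
        moreover have "2 * j + 1 \<noteq> nx n i" using odd_neq_nx[of j n i] by simp
        moreover have "2 * j + 1 \<noteq> 2 * i" by presburger
        ultimately show ?thesis by blast
      qed
      have "2 * i \<noteq> 2 * j + 1" by presburger
      moreover have "nx n i \<noteq> 2 * j + 1" using odd_neq_nx[of j n i] by simp
      moreover have "2 * i \<in> {2 * j, 2 * j + 1, nx n j}" "nx n i \<in> {2 * j, 2 * j + 1, nx n j}"
        using j(2) by blast+
      ultimately have "2 * i \<in> {2 * j, nx n j}" "nx n i \<in> {2 * j, nx n j}" by blast+
      moreover have "i \<noteq> j" using wj False by auto
      ultimately show False using w(1) j(1) n
        by (cases rule: nx_cases[OF w(1)]; cases rule: nx_cases[OF j(1)]) auto
    qed
    moreover have "corners (2 * i, nx n i, w) \<subseteq> {..<2 * n}" using w nx_less[OF w(1)] by auto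
    ultimately show ?thesis using pos[of "(2 * i, nx n i, w)"] by simp
  qed (use earpos w in simp)
  moreover have "bij_betw Y {..<2 * n} D"
    unfolding bij_betw_def
  proof
    show "inj_on Y {..<2 * n}" using n by (intro inj_on_general_position gp) auto
    show "Y ` {..<2 * n} = D"
    proof
      show "Y ` {..<2 * n} \<subseteq> D" unfolding Deq Y_def by (auto simp: less_mult_imp_div_less)
      show "D \<subseteq> Y ` {..<2 * n}"
      proof
        fix x assume "x \<in> D"
        then obtain i where i: "i < n" "x = P i \<or> x = A i" by (auto simp: Deq)
        then have "x = Y (2 * i) \<or> x = Y (2 * i + 1)" by (auto simp: Y_def)
        then show "x \<in> Y ` {..<2 * n}" using i(1) by auto
      qed
    qed
  qed
  moreover have "Y (2 * i + 1) \<in> convex hull ((\<lambda>i. Y (2 * i)) ` {..<n})" if i: "i < n" for i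
  proof -
    have Pim: "(\<lambda>i. Y (2 * i)) ` {..<n} = P ` {..<n}" by (auto simp: Y_def)
    have "P (Suc i) \<in> P ` {..<n}"
      using i P_periodic[of 0] by (cases "Suc i = n") auto
    then have "closed_segment (P i) (P (Suc i)) \<subseteq> convex hull (P ` {..<n})"
      using i by (intro closed_segment_subset_convex_hull hull_inc) auto
    then have "midpoint (P i) (P (Suc i)) \<in> convex hull (P ` {..<n})" by auto
    then have "closed_segment z (midpoint (P i) (P (Suc i))) \<subseteq> convex hull (P ` {..<n})"
      using center_in_hull by (intro closed_segment_subset_convex_hull)
    then show ?thesis using inner i unfolding Pim inner_points_def by (auto simp: Y_def)
  qed
  ultimately show thesis using that[of Y] pos gp by blast
qed

section \<open>Universality\<close>

lemma crosses_cnj: "crosses (cnj ` s) (cnj ` t) \<longleftrightarrow> crosses s t"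
proof -
  have "rel_interior (cnj ` S) = cnj ` rel_interior S" for S
    by (rule rel_interior_injective_linear_image) (simp_all add: bounded_linear_cnj inj_def)
  then show ?thesis
    unfolding crosses_def by (simp add: image_Int[symmetric] inj_def)
qed

lemma closed_segment_cnj: "closed_segment (cnj a) (cnj b) = cnj ` closed_segment a b"
  by (rule closed_segment_linear_image) (simp add: bounded_linear.linear bounded_linear_cnj)

lemma cnj_image_image [simp]: "cnj ` cnj ` S = S"
  by (simp add: image_image)

lemma noncrossing_edges_cnj:
  assumes "noncrossing_edges P T"
  shows "noncrossing_edges (cnj ` P) ((`) cnj ` T)"
  unfolding noncrossing_edges_def
proof
  show "(`) cnj ` T \<subseteq> point_edges (cnj ` P)"
  proof
    fix s assume "s \<in> (`) cnj ` T"
    then obtain e where e: "e \<in> T" "s = cnj ` e" by blast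
    then obtain p q where "p \<in> P" "q \<in> P" "p \<noteq> q" "e = closed_segment p q"
      using assms by (auto simp: noncrossing_edges_def point_edges_def)
    then have "s = closed_segment (cnj p) (cnj q)" "cnj p \<noteq> cnj q" "cnj p \<in> cnj ` P" "cnj q \<in> cnj ` P"
      using e(2) by (auto simp: closed_segment_cnj)
    then show "s \<in> point_edges (cnj ` P)" unfolding point_edges_def by blast
  qed
  show "pairwise (\<lambda>s t. \<not> crosses s t) ((`) cnj ` T)"
    using assms unfolding noncrossing_edges_def pairwise_image by (simp add: pairwise_def crosses_cnj)
qed

lemma triangulation_of_cnj:
  assumes "triangulation_of P T"
  shows "triangulation_of (cnj ` P) ((`) cnj ` T)"
  unfolding triangulation_of_def
proof (intro conjI allI impI)
  show "noncrossing_edges (cnj ` P) ((`) cnj ` T)"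
    using assms by (auto simp: triangulation_of_def intro: noncrossing_edges_cnj)
  have inv: "(`) cnj ` (`) cnj ` S = S" for S :: "complex set set"
    by (simp add: image_image)
  fix T' assume T': "noncrossing_edges (cnj ` P) T' \<and> (`) cnj ` T \<subseteq> T'"
  then have "noncrossing_edges P ((`) cnj ` T')" using noncrossing_edges_cnj[of "cnj ` P" T'] by simp
  moreover have "T \<subseteq> (`) cnj ` T'" using T' inv[of T] by (metis image_mono)
  ultimately have "(`) cnj ` T' = T" using assms unfolding triangulation_of_def by blast
  then show "T' = (`) cnj ` T" using inv[of T'] by metis
qed

lemma edge_set_cnj: "edge_set (\<lambda>i. cnj (X i)) \<tau> = (`) cnj ` edge_set X \<tau>"
  unfolding edge_set_def closed_segment_cnj by blast

text \<open>The conclusion mentions no areas, so it can be applied to a mirror image and carried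
  back.\<close>

lemma labelled_triangulation:
  fixes Q :: "complex set" and q :: "nat \<Rightarrow> complex"
  assumes n: "n \<ge> 3" and Q: "finite Q" "card Q = 2 * n"
    and gp: "\<And>a b c. a \<in> Q \<Longrightarrow> b \<in> Q \<Longrightarrow> c \<in> Q \<Longrightarrow> a \<noteq> b \<Longrightarrow> b \<noteq> c \<Longrightarrow> c \<noteq> a \<Longrightarrow> area2 a b c \<noteq> 0"
    and q: "inj_on q {..<n}" "q ` {..<n} \<subseteq> Q"
    and conv: "\<And>i x. i < n \<Longrightarrow> x \<in> Q \<Longrightarrow> x \<noteq> q i \<Longrightarrow> x \<noteq> q (Suc i mod n) \<Longrightarrow>
      area2 (q i) (q (Suc i mod n)) x > 0"
  shows "\<exists>X \<tau>. bij_betw X {..<2 * n} Q \<and> (\<forall>i<n. X (2 * i) = q i) \<and>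
    spans \<tau> (carved_boundary n n) \<and>
    (\<forall>t\<in>#\<tau>. cyc t \<and> corners t \<subseteq> {..<2 * n} \<and> \<not> ear n t) \<and>
    triangulation_of Q (edge_set X (\<tau> + ears n))"
proof -
  obtain X \<tau> where X: "bij_betw X {..<2 * n} Q" "\<And>i. i < n \<Longrightarrow> X (2 * i) = q i"
    "\<And>i w. i < n \<Longrightarrow> w < 2 * n \<Longrightarrow> w \<noteq> 2 * i \<Longrightarrow> w \<noteq> nx n i \<Longrightarrow> area2 (X (2 * i)) (X (nx n i)) (X w) > 0"
    "\<And>t. corners t \<subseteq> {..<2 * n} \<Longrightarrow> proper t \<Longrightarrow> tarea X t \<noteq> 0"
    "spans \<tau> (carved_boundary n n)"
    "\<And>t. t \<in># \<tau> \<Longrightarrow> cyc t \<and> corners t \<subseteq> {..<2 * n} \<and> tarea X t > 0"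
  proof -
    show thesis by (rule positive_labelling[OF n Q gp q conv]; (assumption | fact that))
  qed
  interpret positive_chain X "\<lambda>i. 2 * (i mod n)" n "\<tau> + ears n" "{..<2 * n}"
    by (rule positive_chain_with_ears[OF n X(3,4,5)]) (use X(6) in blast)+
  have "triangulation_of Q (edge_set X (\<tau> + ears n))"
    using triangulation X(1) by (simp add: bij_betw_def)
  \<comment> \<open>A \<open>cyc\<close> triple on the labels of an ear is clockwise by convexity,
    whereas all triples of the chain are counterclockwise.\<close>
  moreover have "\<not> ear n t" if t: "t \<in># \<tau>" for t
  proof
    assume e: "ear n t"
    have "cyc t" using X(6)[OF t] by blast
    then obtain i where i: "i < n" "\<And>X. tarea X t = - area2 (X (2 * i)) (X (nx n i)) (X (2 * i + 1))"
      using ear_area[OF n _ e] by metis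
    have "2 * i + 1 \<noteq> nx n i" by (rule odd_neq_nx)
    then have "area2 (X (2 * i)) (X (nx n i)) (X (2 * i + 1)) > 0" using X(3)[OF i(1), of "2 * i + 1"] i(1) by auto
    then show False using i(2)[of X] X(6)[OF t] by simp
  qed
  ultimately show ?thesis using X(1,2,5,6) by blast
qed

text \<open>In the plane a vector orthogonal to \<open>q - p\<close> is a multiple of
  \<open>\<i> * (q - p)\<close>. The squared norm on the left avoids a division; the identity behind
  it is Lagrange's.\<close>

lemma lagrange_2d:
  assumes "a \<bullet> (q - p) = 0"
  shows "(norm (q - p))\<^sup>2 * (a \<bullet> (x - p)) = area2 p q x * (a \<bullet> (\<i> * (q - p)))"
proof -
  obtain a1 a2 d1 d2 e1 e2 where a: "a = Complex a1 a2" and d: "q - p = Complex d1 d2" and e: "x - p = Complex e1 e2"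
    by (metis complex.collapse)
  have pq: "q = p + Complex d1 d2" "x = p + Complex e1 e2" using d e by (metis add.commute diff_add_cancel)+
  have 0: "a1 * d1 + a2 * d2 = 0" using assms unfolding a d by (simp add: inner_complex_def)
  have "(d1 * d1 + d2 * d2) * (a1 * e1 + a2 * e2) =
      (d1 * e2 - d2 * e1) * (a2 * d1 - a1 * d2) + (a1 * d1 + a2 * d2) * (d1 * e1 + d2 * e2)"
    by (simp add: algebra_simps)
  then have "(d1 * d1 + d2 * d2) * (a1 * e1 + a2 * e2) = (d1 * e2 - d2 * e1) * (a2 * d1 - a1 * d2)"
    using 0 by simp
  moreover have "area2 p q x = d1 * e2 - d2 * e1" unfolding pq by (simp add: area2_alt)
  moreover have "(norm (q - p))\<^sup>2 = d1 * d1 + d2 * d2"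
    unfolding d cmod_power2 by (simp add: power2_eq_square)
  ultimately show ?thesis
    unfolding a e d by (simp add: inner_complex_def)
qed

text \<open>Faces of a polytope are exposed, so some line supports the hull exactly along the
  segment. General position makes the inequality strict at all other points, and the sign of
  \<open>k\<close> tells their side.\<close>

lemma hull_edge_one_side:
  assumes Q: "finite Q" and gp: "\<And>a b c. a \<in> Q \<Longrightarrow> b \<in> Q \<Longrightarrow> c \<in> Q \<Longrightarrow> a \<noteq> b \<Longrightarrow> b \<noteq> c \<Longrightarrow> c \<noteq> a \<Longrightarrow> area2 a b c \<noteq> 0"
    and pq: "p \<in> Q" "q \<in> Q" "p \<noteq> q" and e: "hull_edge Q p q"
  shows "(\<forall>x\<in>Q - {p, q}. area2 p q x > 0) \<or> (\<forall>x\<in>Q - {p, q}. area2 p q x < 0)"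
proof -
  have "closed_segment p q face_of convex hull Q" using e by (simp add: hull_edge_def edge_of_def)
  moreover have "polyhedron (convex hull Q)" using Q by (simp add: polyhedron_convex_hull)
  ultimately have "closed_segment p q exposed_face_of convex hull Q" by (simp add: exposed_face_of_polyhedron)
  then obtain a b where ab: "convex hull Q \<subseteq> {x. a \<bullet> x \<le> b}" "closed_segment p q = convex hull Q \<inter> {x. a \<bullet> x = b}"
    unfolding exposed_face_of_def by blast
  have "p \<in> closed_segment p q" "q \<in> closed_segment p q" by simp_all
  then have apq: "a \<bullet> p = b" "a \<bullet> q = b" using ab(2) by blast+
  have lt: "a \<bullet> x < b" if x: "x \<in> Q - {p, q}" for x
  proof -
    have xh: "x \<in> convex hull Q" using x by (auto intro: hull_inc)
    have "x \<notin> closed_segment p q"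
    proof
      assume "x \<in> closed_segment p q"
      then have "collinear {p, x, q}" by (intro between_imp_collinear) (simp add: between_mem_segment)
      then have "area2 p x q = 0" by (simp add: collinear_iff_area2)
      then show False using gp[of p x q] x pq by auto
    qed
    then have "a \<bullet> x \<noteq> b" using ab(2) xh by blast
    then show ?thesis using ab(1) xh by force
  qed
  define k where "k = a \<bullet> (\<i> * (q - p))"
  have sign: "area2 p q x * k < 0" if x: "x \<in> Q - {p, q}" for x
  proof -
    have "(norm (q - p))\<^sup>2 > 0" using pq(3) by simp
    moreover have "a \<bullet> (x - p) < 0" using lt[OF x] apq by (simp add: inner_diff_right)
    ultimately have "(norm (q - p))\<^sup>2 * (a \<bullet> (x - p)) < 0" by (rule mult_pos_neg)
    then show ?thesis using lagrange_2d[of a q p x] apq by (simp add: k_def inner_diff_right)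
  qed
  show ?thesis
  proof (cases "k > 0")
    case True
    then have "\<forall>x\<in>Q - {p, q}. area2 p q x < 0" using sign by (metis mult_less_0_iff not_less_iff_gr_or_eq)
    then show ?thesis ..
  next
    case False
    then have "\<forall>x\<in>Q - {p, q}. area2 p q x > 0" using sign by (metis mult_less_0_iff)
    then show ?thesis ..
  qed
qed

text \<open>The line through \<open>p\<close> and \<open>q\<close> supports the hull and cuts out a
  face. That face is the hull of some points of \<open>S\<close>, and only \<open>p\<close> and
  \<open>q\<close> lie on the line.\<close>

lemma hull_edge_if_one_side:
  assumes S: "finite S" "p \<in> S" "q \<in> S" "p \<noteq> q" and pos: "\<And>x. x \<in> S \<Longrightarrow> x \<noteq> p \<Longrightarrow> x \<noteq> q \<Longrightarrow> area2 p q x > 0"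
  shows "hull_edge S p q"
proof -
  let ?a = "\<i> * (q - p)" and ?C = "convex hull S"
  have ge: "?a \<bullet> x \<ge> ?a \<bullet> p" if "x \<in> S" for x
    using pos[OF that] area2_eq_inner[of p q x] by (cases "x = p \<or> x = q") auto
  have "S \<subseteq> {x. ?a \<bullet> x \<ge> ?a \<bullet> p}" using ge by auto
  then have "?C \<subseteq> {x. ?a \<bullet> x \<ge> ?a \<bullet> p}" by (intro hull_minimal convex_halfspace_ge)
  then have face: "(?C \<inter> {x. ?a \<bullet> x = ?a \<bullet> p}) face_of ?C"
    by (intro face_of_Int_supporting_hyperplane_ge) auto
  moreover have "compact S" using S(1) by (rule finite_imp_compact)
  ultimately obtain S' where S': "S' \<subseteq> S" "?C \<inter> {x. ?a \<bullet> x = ?a \<bullet> p} = convex hull S'"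
    using face_of_convex_hull_subset by metis
  have "S' \<subseteq> {p, q}"
  proof
    fix x assume x: "x \<in> S'"
    then have "x \<in> convex hull S'" by (rule hull_inc)
    then have "area2 p q x = 0" using S'(2) by (auto simp: area2_eq_inner)
    then show "x \<in> {p, q}" using pos[of x] x S'(1) by force
  qed
  then have "convex hull S' \<subseteq> closed_segment p q" unfolding segment_convex_hull by (rule hull_mono)
  moreover have "closed_segment p q \<subseteq> ?C \<inter> {x. ?a \<bullet> x = ?a \<bullet> p}"
  proof -
    have "convex (?C \<inter> {x. ?a \<bullet> x = ?a \<bullet> p})" by (intro convex_Int convex_convex_hull convex_hyperplane)
    moreover have "p \<in> ?C \<inter> {x. ?a \<bullet> x = ?a \<bullet> p}" using S(2) by (simp add: hull_inc)
    moreover have "q \<in> ?C \<inter> {x. ?a \<bullet> x = ?a \<bullet> p}"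
      using S(3) area2_eq_inner[of p q q] by (simp add: hull_inc)
    ultimately show ?thesis by (rule closed_segment_subset[rotated 2])
  qed
  ultimately have "closed_segment p q face_of ?C" using face S'(2) by (metis subset_antisym)
  moreover have "aff_dim (closed_segment p q) = 1"
    using S(4) by (simp add: segment_convex_hull aff_dim_convex_hull aff_dim_2)
  ultimately show ?thesis by (simp add: hull_edge_def edge_of_def)
qed

theorem theorem6:
  fixes n :: nat and D :: "complex set"
  assumes "n \<ge> 3" and "double_circle n D"
  shows "universal D"
proof -
  note n = assms(1)
  obtain Y where Y: "bij_betw Y {..<2 * n} D"
    "\<And>i w. i < n \<Longrightarrow> w < 2 * n \<Longrightarrow> w \<noteq> 2 * i \<Longrightarrow> w \<noteq> nx n i \<Longrightarrow> area2 (Y (2 * i)) (Y (nx n i)) (Y w) > 0"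
    "\<And>t. cyc t \<Longrightarrow> corners t \<subseteq> {..<2 * n} \<Longrightarrow> \<not> ear n t \<Longrightarrow> tarea Y t > 0"
    "\<And>t. corners t \<subseteq> {..<2 * n} \<Longrightarrow> proper t \<Longrightarrow> tarea Y t \<noteq> 0"
    "\<And>i. i < n \<Longrightarrow> Y (2 * i + 1) \<in> convex hull ((\<lambda>i. Y (2 * i)) ` {..<n})"
  proof -
    show thesis by (rule double_circle_configuration[OF assms]) (fact that)
  qed
  have YD: "Y ` {..<2 * n} = D" and Yinj: "inj_on Y {..<2 * n}" using Y(1) by (simp_all add: bij_betw_def)
  have finD: "finite D" and cardD: "card D = 2 * n"
    using YD Yinj by (auto simp: card_image)
  have mod: "Suc i mod n < n" for i using n by simp
  have nxl: "nx n i < 2 * n" for i using mod[of i] by (simp add: nx_mod)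
  have psD: "point_set D"
    unfolding point_set_def collinear_iff_area2
  proof (intro conjI ballI impI finD)
    fix a b c assume abc: "a \<in> D" "b \<in> D" "c \<in> D" "distinct [a, b, c]"
    obtain u v w where "u < 2 * n" "v < 2 * n" "w < 2 * n" "a = Y u" "b = Y v" "c = Y w"
      using abc(1-3) YD by auto
    then show "area2 a b c \<noteq> 0" using Y(4)[of "(u, v, w)"] abc(4) by auto
  qed
  have edgeD: "hull_edge D (Y (2 * i)) (Y (nx n i))" if i: "i < n" for i
  proof (rule hull_edge_if_one_side[OF finD])
    show "Y (2 * i) \<in> D" "Y (nx n i) \<in> D" using i nxl YD by auto
    have "2 * i \<noteq> nx n i" using i n by (cases rule: nx_cases) auto
    then show "Y (2 * i) \<noteq> Y (nx n i)" using Yinj i nxl[of i] by (auto simp: inj_on_def)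
    show "area2 (Y (2 * i)) (Y (nx n i)) x > 0" if x: "x \<in> D" "x \<noteq> Y (2 * i)" "x \<noteq> Y (nx n i)" for x
    proof -
      obtain w where "w < 2 * n" "x = Y w" using x(1) YD by auto
      then show ?thesis using Y(2)[OF i, of w] x by auto
    qed
  qed
  have hvD: "hull_vertices D = (\<lambda>i. Y (2 * i)) ` {..<n}"
  proof
    show "(\<lambda>i. Y (2 * i)) ` {..<n} \<subseteq> hull_vertices D"
    proof clarify
      fix i assume "i < n"
      then have "closed_segment (Y (2 * i)) (Y (nx n i)) face_of convex hull D"
        using edgeD by (simp add: hull_edge_def edge_of_def)
      from extreme_point_of_face[OF this, of "Y (2 * i)"] show "Y (2 * i) \<in> hull_vertices D"
        by (simp add: hull_vertices_def extreme_point_of_segment)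
    qed
    \<comment> \<open>The inner points lie in the hull of the even labels, so extreme points are to
      be sought among the latter.\<close>
    show "hull_vertices D \<subseteq> (\<lambda>i. Y (2 * i)) ` {..<n}"
    proof
      let ?E = "(\<lambda>i. Y (2 * i)) ` {..<n}"
      fix p assume "p \<in> hull_vertices D"
      then have ext: "p extreme_point_of convex hull D" by (simp add: hull_vertices_def)
      then have "p \<in> D" by (rule extreme_point_of_convex_hull)
      then obtain m where m: "m < 2 * n" "p = Y m" using YD by auto
      have "m div 2 < n" "m = 2 * (m div 2) \<or> m = 2 * (m div 2) + 1" using m(1) by auto
      then obtain k where k: "k < n" "m = 2 * k \<or> m = 2 * k + 1" by blast
      have "Y (2 * k) \<in> convex hull ?E" using k(1) by (intro hull_inc) auto
      then have "Y m \<in> convex hull ?E" using Y(5)[OF k(1)] k(2) by auto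
      moreover have "?E \<subseteq> D" using YD by auto
      ultimately have "p extreme_point_of convex hull ?E"
        using ext hull_mono[of ?E D] m(2) unfolding extreme_point_of_def by blast
      then show "p \<in> ?E" by (rule extreme_point_of_convex_hull)
    qed
  qed
  show ?thesis
    unfolding universal_def
  proof (intro conjI psD allI impI)
    fix Q f0 assume *: "point_set Q \<and> card Q = card D \<and> cyclic_bijection D Q f0"
    have finQ: "finite Q" and cardQ: "card Q = 2 * n"
      using * cardD by (auto simp: point_set_def)
    have gpQ: "area2 a b c \<noteq> 0" if "a \<in> Q" "b \<in> Q" "c \<in> Q" "a \<noteq> b" "b \<noteq> c" "c \<noteq> a" for a b c
      using * that unfolding point_set_def collinear_iff_area2 by auto
    have f0: "bij_betw f0 (hull_vertices D) (hull_vertices Q)"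
      and f0e: "\<And>p1 p2. p1 \<in> hull_vertices D \<Longrightarrow> p2 \<in> hull_vertices D \<Longrightarrow> hull_edge D p1 p2 \<Longrightarrow> hull_edge Q (f0 p1) (f0 p2)"
      using * by (auto simp: cyclic_bijection_def)
    define q where "q i = f0 (Y (2 * i))" for i
    have Ye: "inj_on (\<lambda>i. Y (2 * i)) {..<n}"
    proof (rule inj_onI)
      fix i j assume "i \<in> {..<n}" "j \<in> {..<n}" "Y (2 * i) = Y (2 * j)"
      then have "2 * i = 2 * j" by (intro inj_onD[OF Yinj]) auto
      then show "i = j" by simp
    qed
    have qinj: "inj_on q {..<n}"
      using comp_inj_on[OF Ye, of f0] f0 hvD unfolding q_def by (simp add: bij_betw_def comp_def)
    have "hull_vertices Q \<subseteq> Q" by (auto simp: hull_vertices_def dest: extreme_point_of_convex_hull)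
    then have qQ: "q i \<in> Q" if "i < n" for i
      using f0 that unfolding q_def bij_betw_def hvD by auto
    have qneq: "q i \<noteq> q j" if "i < n" "j < n" "i \<noteq> j" for i j using qinj that by (auto simp: inj_on_def)
    have Smod: "i \<noteq> Suc i mod n" if "i < n" for i
      using that n by (cases "Suc i = n") auto
    have "(\<forall>x\<in>Q - {q i, q (Suc i mod n)}. area2 (q i) (q (Suc i mod n)) x > 0) \<or>
        (\<forall>x\<in>Q - {q i, q (Suc i mod n)}. area2 (q i) (q (Suc i mod n)) x < 0)" if i: "i < n" for i
    proof (rule hull_edge_one_side[OF finQ gpQ])
      show "q i \<in> Q" "q (Suc i mod n) \<in> Q" using qQ i mod by auto
      show "q i \<noteq> q (Suc i mod n)" using qneq i mod Smod by auto
      show "hull_edge Q (q i) (q (Suc i mod n))"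
        unfolding q_def using edgeD[OF i] i mod[of i] by (intro f0e) (auto simp: hvD nx_mod)
    qed
    then have side: "(\<forall>x\<in>Q. x \<noteq> q i \<longrightarrow> x \<noteq> q (Suc i mod n) \<longrightarrow> area2 (q i) (q (Suc i mod n)) x > 0) \<or>
        (\<forall>x\<in>Q. x \<noteq> q i \<longrightarrow> x \<noteq> q (Suc i mod n) \<longrightarrow> area2 (q i) (q (Suc i mod n)) x < 0)" if "i < n" for i
      using that by blast
    \<comment> \<open>Consecutive hull edges share the triangle of three consecutive vertices, and
      its orientation fixes the side of both. So \<open>f0\<close> preserves or reverses orientation
      as a whole.\<close>
    have next_side: "sgn (area2 (q (Suc i)) (q (Suc (Suc i) mod n)) (q i)) = sgn (area2 (q i) (q (Suc i mod n)) (q (Suc (Suc i) mod n)))"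
      "q i \<in> Q" "q i \<noteq> q (Suc i)" "q i \<noteq> q (Suc (Suc i) mod n)"
      "q (Suc (Suc i) mod n) \<in> Q" "q (Suc (Suc i) mod n) \<noteq> q i" "q (Suc (Suc i) mod n) \<noteq> q (Suc i mod n)"
      if i: "Suc i < n" for i
    proof -
      have "Suc (Suc i) mod n \<noteq> i" "Suc (Suc i) mod n \<noteq> Suc i"
        using i n by (cases "Suc (Suc i) = n"; simp)+
      then show "q i \<in> Q" "q i \<noteq> q (Suc i)" "q i \<noteq> q (Suc (Suc i) mod n)"
        "q (Suc (Suc i) mod n) \<in> Q" "q (Suc (Suc i) mod n) \<noteq> q i" "q (Suc (Suc i) mod n) \<noteq> q (Suc i mod n)"
        using i qQ qneq mod by auto
      show "sgn (area2 (q (Suc i)) (q (Suc (Suc i) mod n)) (q i)) = sgn (area2 (q i) (q (Suc i mod n)) (q (Suc (Suc i) mod n)))"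
        using i by (simp add: area2_rotate)
    qed
    have "(\<forall>i<n. \<forall>x\<in>Q. x \<noteq> q i \<longrightarrow> x \<noteq> q (Suc i mod n) \<longrightarrow> area2 (q i) (q (Suc i mod n)) x > 0) \<or>
      (\<forall>i<n. \<forall>x\<in>Q. x \<noteq> q i \<longrightarrow> x \<noteq> q (Suc i mod n) \<longrightarrow> area2 (q i) (q (Suc i mod n)) x < 0)"
      (is "(\<forall>i<n. ?L i) \<or> (\<forall>i<n. ?R i)")
    proof -
      have L: "?L (Suc i)" if i: "Suc i < n" "?L i" for i
      proof -
        have "area2 (q i) (q (Suc i mod n)) (q (Suc (Suc i) mod n)) > 0"
          using i(2) next_side(5-7)[OF i(1)] by blast
        then have "area2 (q (Suc i)) (q (Suc (Suc i) mod n)) (q i) > 0"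
          using next_side(1)[OF i(1)] by (metis sgn_greater)
        then have "\<not> ?R (Suc i)" using next_side(2-4)[OF i(1)] by (metis less_asym)
        then show ?thesis using side[OF i(1)] by blast
      qed
      have R: "?R (Suc i)" if i: "Suc i < n" "?R i" for i
      proof -
        have "area2 (q i) (q (Suc i mod n)) (q (Suc (Suc i) mod n)) < 0"
          using i(2) next_side(5-7)[OF i(1)] by blast
        then have "area2 (q (Suc i)) (q (Suc (Suc i) mod n)) (q i) < 0"
          using next_side(1)[OF i(1)] by (metis sgn_less)
        then have "\<not> ?L (Suc i)" using next_side(2-4)[OF i(1)] by (metis less_asym)
        then show ?thesis using side[OF i(1)] by blast
      qed
      have "?L i" if "?L 0" "i < n" for i using that(2) by (induction i) (use that(1) L in auto)
      moreover have "?R i" if "?R 0" "i < n" for i using that(2) by (induction i) (use that(1) R in auto)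
      moreover have "?L 0 \<or> ?R 0" using side[of 0] n by simp
      ultimately show ?thesis by blast
    qed
    then have "\<exists>X \<tau>. bij_betw X {..<2 * n} Q \<and> (\<forall>i<n. X (2 * i) = q i) \<and>
      spans \<tau> (carved_boundary n n) \<and>
      (\<forall>t\<in>#\<tau>. cyc t \<and> corners t \<subseteq> {..<2 * n} \<and> \<not> ear n t) \<and>
      triangulation_of Q (edge_set X (\<tau> + ears n))"
    proof
      assume "\<forall>i<n. ?L i"
      then show ?thesis using qQ by (intro labelled_triangulation[OF n finQ cardQ gpQ qinj]) auto
    next
      \<comment> \<open>If \<open>f0\<close> reverses orientation, the mirror image of
        \<open>Q\<close> is triangulated instead.\<close>
      assume R: "\<forall>i<n. ?R i"
      have "\<exists>X \<tau>. bij_betw X {..<2 * n} (cnj ` Q) \<and> (\<forall>i<n. X (2 * i) = cnj (q i)) \<and>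
        spans \<tau> (carved_boundary n n) \<and>
        (\<forall>t\<in>#\<tau>. cyc t \<and> corners t \<subseteq> {..<2 * n} \<and> \<not> ear n t) \<and>
        triangulation_of (cnj ` Q) (edge_set X (\<tau> + ears n))"
      proof (rule labelled_triangulation[OF n])
        show "finite (cnj ` Q)" "card (cnj ` Q) = 2 * n"
          using finQ cardQ by (simp_all add: card_image inj_on_def)
        show "area2 a b c \<noteq> 0" if "a \<in> cnj ` Q" "b \<in> cnj ` Q" "c \<in> cnj ` Q" "a \<noteq> b" "b \<noteq> c" "c \<noteq> a" for a b c
          using that gpQ by (auto simp: area2_cnj)
        show "inj_on (\<lambda>i. cnj (q i)) {..<n}" using qinj by (auto simp: inj_on_def)
        show "(\<lambda>i. cnj (q i)) ` {..<n} \<subseteq> cnj ` Q" using qQ by auto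
        show "area2 (cnj (q i)) (cnj (q (Suc i mod n))) x > 0"
          if "i < n" "x \<in> cnj ` Q" "x \<noteq> cnj (q i)" "x \<noteq> cnj (q (Suc i mod n))" for i x
          using that R by (auto simp: area2_cnj)
      qed
      then obtain X \<tau> where X: "bij_betw X {..<2 * n} (cnj ` Q)" "\<forall>i<n. X (2 * i) = cnj (q i)"
        and \<tau>: "spans \<tau> (carved_boundary n n)"
        "\<forall>t\<in>#\<tau>. cyc t \<and> corners t \<subseteq> {..<2 * n} \<and> \<not> ear n t"
        and T: "triangulation_of (cnj ` Q) (edge_set X (\<tau> + ears n))"
        by blast
      have "bij_betw cnj (cnj ` Q) Q" by (auto simp: bij_betw_def inj_on_def image_image)
      then have "bij_betw (cnj \<circ> X) {..<2 * n} Q" using X(1) bij_betw_trans by blast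
      moreover have "triangulation_of Q (edge_set (cnj \<circ> X) (\<tau> + ears n))"
        using triangulation_of_cnj[OF T] edge_set_cnj[of X] by (simp add: comp_def)
      moreover have "\<forall>i<n. (cnj \<circ> X) (2 * i) = q i" using X(2) by simp
      ultimately show ?thesis using \<tau> by blast
    qed
    then obtain X \<tau> where X: "bij_betw X {..<2 * n} Q" "\<And>i. i < n \<Longrightarrow> X (2 * i) = q i"
      and \<tau>: "spans \<tau> (carved_boundary n n)"
      "\<And>t. t \<in># \<tau> \<Longrightarrow> cyc t \<and> corners t \<subseteq> {..<2 * n} \<and> \<not> ear n t"
      and TQ: "triangulation_of Q (edge_set X (\<tau> + ears n))"
      by blast
    \<comment> \<open>The chain found in \<open>Q\<close> is positive in \<open>D\<close> too: its
      triples are \<open>cyc\<close> and no ears.\<close>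
    have TP: "triangulation_of D (edge_set Y (\<tau> + ears n))"
    proof -
      interpret positive_chain Y "\<lambda>i. 2 * (i mod n)" n "\<tau> + ears n" "{..<2 * n}"
        by (rule positive_chain_with_ears[OF n Y(2,4) \<tau>(1)]) (use \<tau>(2) Y(3) in blast)+
      show ?thesis using triangulation YD by simp
    qed
    define f where "f = X \<circ> inv_into {..<2 * n} Y"
    have fY: "f (Y m) = X m" if "m < 2 * n" for m
      using that Yinj by (simp add: f_def)
    have "bij_betw f D Q"
      unfolding f_def using bij_betw_inv_into[OF Y(1)] X(1) by (rule bij_betw_trans)
    moreover have "\<forall>p\<in>hull_vertices D. f p = f0 p"
      unfolding hvD using fY X(2) by (auto simp: q_def)
    moreover have "compatible_triangulation D Q f (edge_set Y (\<tau> + ears n)) (edge_set X (\<tau> + ears n))"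
      unfolding compatible_triangulation_def
    proof (intro conjI TP TQ ballI)
      fix p p' assume "p \<in> D" "p' \<in> D"
      then obtain u v where uv: "u \<in> {..<2 * n}" "v \<in> {..<2 * n}" "p = Y u" "p' = Y v" using YD by auto
      have sub: "corners t \<subseteq> {..<2 * n}" if "t \<in># \<tau> + ears n" for t
      proof (cases "t \<in># \<tau>")
        case False
        then show ?thesis using that nxl by (auto simp: mem_ears)
      qed (use \<tau>(2) in blast)
      have eq: "closed_segment (Z u) (Z v) \<in> edge_set Z (\<tau> + ears n) \<longleftrightarrow>
          (\<exists>t\<in>#\<tau> + ears n. (u, v) \<in> sides t \<or> (v, u) \<in> sides t)"
        if "inj_on Z {..<2 * n}" for Z
        by (rule closed_segment_in_edge_set[OF that sub uv(1,2)])
      show "closed_segment p p' \<in> edge_set Y (\<tau> + ears n) \<longleftrightarrow> closed_segment (f p) (f p') \<in> edge_set X (\<tau> + ears n)"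
        using eq[OF Yinj] eq[OF bij_betw_imp_inj_on[OF X(1)]] uv fY by simp
    qed
    ultimately show "\<exists>f. bij_betw f D Q \<and> (\<forall>p\<in>hull_vertices D. f p = f0 p) \<and>
        (\<exists>TP TQ. compatible_triangulation D Q f TP TQ)" by blast
  qed
qed

end
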